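(* Let $\mathbb K$ be a local field, $\Gamma$ a finitely generated word-hyperbolic group and $\rho:\Gamma\to\mathrm{PGL}_d(\mathbb K)$ an $\{\mathsf a_1\}$-Anosov representation with boundary map $\xi^1:\partial\Gamma\to\mathbb P(\mathbb K^d)$. Then $$\mathrm{Hff}\big(\xi^1(\partial\Gamma)\big)\le h^{\mathsf a_1}_\rho.$$
   Context: $\mathbb K$ is a commutative local field with absolute value $|\cdot|$: the usual modulus if $\mathbb K=\mathbb R,\mathbb C$; if $\mathbb K$ is non-Archimedean with valuation ring $\mathcal O$ and uniformizer $\omega$, then $|\omega|=1/q$ with $q=\#(\mathcal O/\omega\mathcal O)$. $\mathbb K^d$ carries a fixed good norm: induced by an inner/Hermitian product if $\mathbb K$ is Archimedean, and $\|\sum a_ie_i\|=\max|a_i|$ for a fixed basis $(e_i)$ otherwise; exterior powers carry the induced good norms. $\sigma_1(g)\ge\dots\ge\sigma_d(g)$ denote the singular values of $g\in\mathrm{GL}_d(\mathbb K)$; in the non-Archimedean case they are the absolute values $|a_1|\ge\dots\ge|a_d|$ of the diagonal entries in a Cartan decomposition $g=k\,\mathrm{diag}(a_1,\dots,a_d)\,l$, $k,l\in\mathrm{GL}_d(\mathcal O)$. Ratios $\sigma_i/\sigma_j$ are well defined on $\mathrm{PGL}_d(\mathbb K)$. $|\gamma|$ is the word length for a fixed finite symmetric generating set of $\Gamma$ and $\partial\Gamma$ is the Gromov boundary. $\rho$ is $\{\mathsf a_1\}$-Anosov (projective Anosov) if there are $c,\mu>0$ with $\frac{\sigma_2}{\sigma_1}(\rho(\gamma))\le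 ce^{-\mu|\gamma|}$ for all $\gamma\in\Gamma$. Then there is a continuous $\rho$-equivariant map $\xi^1:\partial\Gamma\to\mathbb P(\mathbb K^d)$, $\xi^1(x)=\lim_nU_1(\rho(\gamma_n))$ for any geodesic ray $(\gamma_n)$ converging to $x$, where $U_1(g)=k\cdot \mathbb K e_1$ for a Cartan decomposition $g=kal$ ($k,l$ in the isometry group of the norm, $a$ diagonal in the orthonormal basis $(e_i)$ with entries of decreasing absolute value $\sigma_i(g)$); the limit is independent of all choices. $h^{\mathsf a_1}_\rho$ is the critical exponent of $s\mapsto\sum_{\gamma\in\Gamma}\left(\frac{\sigma_2}{\sigma_1}(\rho(\gamma))\right)^s$. $\mathrm{Hff}$ is Hausdorff dimension for the metric $d([v],[w])=\|v\wedge w\|/(\|v\|\|w\|)$ on $\mathbb P(\mathbb K^d)$. *)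

theory Defs
  imports "HOL-Analysis.Analysis" "HOL-Algebra.Generated_Groups"
begin

section \<open>Local fields\<close>

text \<open>A local field is a field type \<open>'k\<close> together with its absolute value \<open>v\<close>.  In the
  Archimedean case \<open>\<phi>\<close> identifies the field with \<open>\<real>\<close> or with \<open>\<complex>\<close>.\<close>

definition arch_embedding :: "('k::field \<Rightarrow> real) \<Rightarrow> ('k \<Rightarrow> complex) \<Rightarrow> bool" where
  "arch_embedding v \<phi> \<longleftrightarrow>
     \<phi> 1 = 1 \<and> (\<forall>x y. \<phi> (x + y) = \<phi> x + \<phi> y) \<and> (\<forall>x y. \<phi> (x * y) = \<phi> x * \<phi> y) \<and>
     (range \<phi> = \<real> \<or> range \<phi> = UNIV) \<and> (\<forall>x. v x = cmod (\<phi> x))"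

definition valuation_ring :: "('k::field \<Rightarrow> real) \<Rightarrow> 'k set" where
  "valuation_ring v = {x. v x \<le> 1}"

definition uniformizer :: "('k::field \<Rightarrow> real) \<Rightarrow> 'k \<Rightarrow> bool" where
  "uniformizer v \<omega> \<longleftrightarrow>
     \<omega> \<noteq> 0 \<and> v \<omega> < 1 \<and> (\<forall>x. v x < 1 \<longrightarrow> (\<exists>y\<in>valuation_ring v. x = \<omega> * y))"

definition residue_field :: "('k::field \<Rightarrow> real) \<Rightarrow> 'k \<Rightarrow> 'k set set" where
  "residue_field v \<omega> = valuation_ring v //
     {(x, y). x \<in> valuation_ring v \<and> y \<in> valuation_ring v \<and>
              (\<exists>z\<in>valuation_ring v. x - y = \<omega> * z)}"

definition nonarch_local_field :: "('k::field \<Rightarrow> real) \<Rightarrow> bool" where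
  "nonarch_local_field v \<longleftrightarrow>
     (\<forall>x. 0 \<le> v x) \<and> (\<forall>x. v x = 0 \<longleftrightarrow> x = 0) \<and> (\<forall>x y. v (x * y) = v x * v y) \<and>
     (\<forall>x y. v (x + y) \<le> max (v x) (v y)) \<and>
     (\<forall>u. (\<forall>\<epsilon>>0. \<exists>M. \<forall>m\<ge>M. \<forall>n\<ge>M. v (u m - u n) < \<epsilon>) \<longrightarrow>
          (\<exists>l. (\<lambda>n::nat. v (u n - l)) \<longlonglongrightarrow> 0)) \<and>
     (\<exists>\<omega>. uniformizer v \<omega> \<and> finite (residue_field v \<omega>) \<and>
          v \<omega> = 1 / real (card (residue_field v \<omega>)))"

definition local_field :: "('k::field \<Rightarrow> real) \<Rightarrow> bool" where
  "local_field v \<longleftrightarrow> (\<exists>\<phi>. arch_embedding v \<phi>) \<or> nonarch_local_field v"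

section \<open>Good norms\<close>

text \<open>Bases of \<open>\<K>\<^sup>d\<close>, with \<open>d = CARD('d)\<close>, are indexed by \<open>1, \<dots>, d\<close>.\<close>

definition is_basis :: "(nat \<Rightarrow> 'k::field ^ 'd::finite) \<Rightarrow> bool" where
  "is_basis e \<longleftrightarrow> inj_on e {1..CARD('d)} \<and> vec.independent (e ` {1..CARD('d)}) \<and>
     vec.span (e ` {1..CARD('d)}) = UNIV"

definition coord :: "(nat \<Rightarrow> 'k::field ^ 'd::finite) \<Rightarrow> 'k ^ 'd \<Rightarrow> nat \<Rightarrow> 'k" where
  "coord e x i = vec.representation (e ` {1..CARD('d)}) x (e i)"

text \<open>An inner product (\<open>range \<phi> = \<real>\<close>) or a Hermitian product (\<open>range \<phi> = UNIV\<close>), with scalars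
  read through \<open>\<phi>\<close>.  The other identification \<open>cnj \<circ> \<phi>\<close> gives rise to the same norms.\<close>

definition hermitian_product ::
    "('k::field \<Rightarrow> complex) \<Rightarrow> ('k ^ 'd::finite \<Rightarrow> 'k ^ 'd \<Rightarrow> complex) \<Rightarrow> bool" where
  "hermitian_product \<phi> B \<longleftrightarrow>
     (\<forall>x y. B x y \<in> range \<phi>) \<and>
     (\<forall>x y z. B (x + y) z = B x z + B y z) \<and> (\<forall>c x y. B (c *s x) y = \<phi> c * B x y) \<and>
     (\<forall>x y. B y x = cnj (B x y)) \<and> (\<forall>x. x \<noteq> 0 \<longrightarrow> 0 < Re (B x x))"

text \<open>\<open>N\<close> is a good norm on \<open>\<K>\<^sup>d\<close> and \<open>e\<close> is an orthonormal basis for it; in the non-Archimedean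
  case \<open>e\<close> is the basis defining the norm.\<close>

definition good_norm ::
    "('k::field \<Rightarrow> real) \<Rightarrow> ('k ^ 'd::finite \<Rightarrow> real) \<Rightarrow> (nat \<Rightarrow> 'k ^ 'd) \<Rightarrow> bool" where
  "good_norm v N e \<longleftrightarrow> is_basis e \<and>
     ((\<exists>\<phi> B. arch_embedding v \<phi> \<and> hermitian_product \<phi> B \<and>
         (\<forall>i\<in>{1..CARD('d)}. \<forall>j\<in>{1..CARD('d)}. B (e i) (e j) = (if i = j then 1 else 0)) \<and>
         (\<forall>x. N x = sqrt (Re (B x x)))) \<or>
      (nonarch_local_field v \<and> (\<forall>x. N x = Max ((\<lambda>i. v (coord e x i)) ` {1..CARD('d)}))))"

text \<open>\<open>wedge_norm v e x y\<close> is the norm of \<open>x \<and> y\<close> for the induced good norm on the exterior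
  square, for which the \<open>e i \<and> e j\<close> with \<open>i < j\<close> form an orthonormal basis.  The coordinates of
  \<open>x \<and> y\<close> in this basis are the 2 by 2 minors below.\<close>

definition wedge_norm ::
    "('k::field \<Rightarrow> real) \<Rightarrow> (nat \<Rightarrow> 'k ^ 'd::finite) \<Rightarrow> 'k ^ 'd \<Rightarrow> 'k ^ 'd \<Rightarrow> real" where
  "wedge_norm v e x y =
     (let P = {(i, j). 1 \<le> i \<and> i < j \<and> j \<le> CARD('d)};
          m = (\<lambda>(i, j). v (coord e x i * coord e y j - coord e x j * coord e y i))
      in if nonarch_local_field v then Max (m ` P) else sqrt (\<Sum>p\<in>P. (m p)\<^sup>2))"

section \<open>Projective space\<close>

definition proj_space :: "('k::field ^ 'd::finite) set set" where
  "proj_space = {vec.span {x} | x. x \<noteq> 0}"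

text \<open>The distance does not depend on the chosen nonzero vectors.\<close>

definition proj_dist ::
    "('k::field \<Rightarrow> real) \<Rightarrow> ('k ^ 'd::finite \<Rightarrow> real) \<Rightarrow> (nat \<Rightarrow> 'k ^ 'd) \<Rightarrow>
     ('k ^ 'd) set \<Rightarrow> ('k ^ 'd) set \<Rightarrow> real" where
  "proj_dist v N e L L' =
     (THE r. \<exists>x\<in>L - {0}. \<exists>y\<in>L' - {0}. r = wedge_norm v e x y / (N x * N y))"

section \<open>The projective linear group and singular values\<close>

definition GL :: "('k::field ^ 'd::finite ^ 'd) monoid" where
  "GL = \<lparr>carrier = {g. invertible g}, mult = (**), one = mat 1\<rparr>"

definition scalar_matrices :: "('k::field ^ 'd::finite ^ 'd) set" where
  "scalar_matrices = {mat c | c. c \<noteq> 0}"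

text \<open>Elements of the projective linear group are cosets, that is, sets of matrices.\<close>

definition PGL :: "('k::field ^ 'd::finite ^ 'd) set monoid" where
  "PGL = GL Mod scalar_matrices"

definition isometry_group :: "('k::field ^ 'd::finite \<Rightarrow> real) \<Rightarrow> ('k ^ 'd ^ 'd) set" where
  "isometry_group N = {g. invertible g \<and> (\<forall>x. N (g *v x) = N x)}"

text \<open>\<open>g = k A l\<close> is a Cartan decomposition, where \<open>A\<close> is diagonal in the basis \<open>e\<close> with entries
  \<open>a 1, \<dots>, a d\<close>.  In the non-Archimedean case the isometry group is \<open>GL\<^sub>d(\<O>)\<close> in the basis \<open>e\<close>.\<close>

definition cartan ::
    "('k::field \<Rightarrow> real) \<Rightarrow> ('k ^ 'd::finite \<Rightarrow> real) \<Rightarrow> (nat \<Rightarrow> 'k ^ 'd) \<Rightarrow>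
     'k ^ 'd ^ 'd \<Rightarrow> 'k ^ 'd ^ 'd \<Rightarrow> 'k ^ 'd ^ 'd \<Rightarrow> 'k ^ 'd ^ 'd \<Rightarrow> (nat \<Rightarrow> 'k) \<Rightarrow> bool" where
  "cartan v N e g k A l a \<longleftrightarrow>
     k \<in> isometry_group N \<and> l \<in> isometry_group N \<and> g = k ** A ** l \<and>
     (\<forall>i\<in>{1..CARD('d)}. A *v e i = a i *s e i) \<and>
     (\<forall>i\<in>{1..CARD('d)}. \<forall>j\<in>{1..CARD('d)}. i \<le> j \<longrightarrow> v (a j) \<le> v (a i))"

definition singular_value ::
    "('k::field \<Rightarrow> real) \<Rightarrow> ('k ^ 'd::finite \<Rightarrow> real) \<Rightarrow> (nat \<Rightarrow> 'k ^ 'd) \<Rightarrow>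
     nat \<Rightarrow> 'k ^ 'd ^ 'd \<Rightarrow> real" where
  "singular_value v N e i g = (THE s. \<exists>k A l a. cartan v N e g k A l a \<and> s = v (a i))"

text \<open>The ratio of the second to the first singular value on the projective linear group; it does
  not depend on the representative.\<close>

definition sv_ratio ::
    "('k::field \<Rightarrow> real) \<Rightarrow> ('k ^ 'd::finite \<Rightarrow> real) \<Rightarrow> (nat \<Rightarrow> 'k ^ 'd) \<Rightarrow>
     ('k ^ 'd ^ 'd) set \<Rightarrow> real" where
  "sv_ratio v N e X =
     (THE r. \<exists>g\<in>X. r = singular_value v N e 2 g / singular_value v N e 1 g)"

text \<open>All possible values of \<open>U\<^sub>1\<close>: the attracting line depends on the chosen Cartan
  decomposition when the first two singular values agree.\<close>

definition U1 ::
    "('k::field \<Rightarrow> real) \<Rightarrow> ('k ^ 'd::finite \<Rightarrow> real) \<Rightarrow> (nat \<Rightarrow> 'k ^ 'd) \<Rightarrow>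
     ('k ^ 'd ^ 'd) set \<Rightarrow> ('k ^ 'd) set set" where
  "U1 v N e X =
     {(\<lambda>y. k *v y) ` vec.span {e 1} | k. \<exists>g\<in>X. \<exists>A l a. cartan v N e g k A l a}"

section \<open>Word-hyperbolic groups and the Gromov boundary\<close>

definition finite_symmetric_generating :: "('g, 'b) monoid_scheme \<Rightarrow> 'g set \<Rightarrow> bool" where
  "finite_symmetric_generating G S \<longleftrightarrow>
     finite S \<and> S \<subseteq> carrier G \<and> (\<forall>s\<in>S. inv\<^bsub>G\<^esub> s \<in> S) \<and> generate G S = carrier G"

definition word_length :: "('g, 'b) monoid_scheme \<Rightarrow> 'g set \<Rightarrow> 'g \<Rightarrow> nat" where
  "word_length G S g =
     (LEAST n. \<exists>ws. length ws = n \<and> set ws \<subseteq> S \<and> foldr (mult G) ws \<one>\<^bsub>G\<^esub> = g)"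

definition word_dist :: "('g, 'b) monoid_scheme \<Rightarrow> 'g set \<Rightarrow> 'g \<Rightarrow> 'g \<Rightarrow> real" where
  "word_dist G S x y = real (word_length G S (inv\<^bsub>G\<^esub> x \<otimes>\<^bsub>G\<^esub> y))"

definition gromov_product ::
    "('g, 'b) monoid_scheme \<Rightarrow> 'g set \<Rightarrow> 'g \<Rightarrow> 'g \<Rightarrow> 'g \<Rightarrow> real" where
  "gromov_product G S w x y =
     (word_dist G S w x + word_dist G S w y - word_dist G S x y) / 2"

definition word_hyperbolic :: "('g, 'b) monoid_scheme \<Rightarrow> 'g set \<Rightarrow> bool" where
  "word_hyperbolic G S \<longleftrightarrow>
     (\<exists>\<delta>. \<forall>w\<in>carrier G. \<forall>x\<in>carrier G. \<forall>y\<in>carrier G. \<forall>z\<in>carrier G.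
        min (gromov_product G S w x y) (gromov_product G S w y z) - \<delta> \<le> gromov_product G S w x z)"

definition geodesic_ray :: "('g, 'b) monoid_scheme \<Rightarrow> 'g set \<Rightarrow> (nat \<Rightarrow> 'g) \<Rightarrow> bool" where
  "geodesic_ray G S r \<longleftrightarrow>
     range r \<subseteq> carrier G \<and> (\<forall>m n. word_dist G S (r m) (r n) = \<bar>real m - real n\<bar>)"

text \<open>A boundary point is an asymptoty class of geodesic rays; the rays converging to it are its
  elements.\<close>

definition gromov_boundary :: "('g, 'b) monoid_scheme \<Rightarrow> 'g set \<Rightarrow> (nat \<Rightarrow> 'g) set set" where
  "gromov_boundary G S =
     {r. geodesic_ray G S r} //
     {(r, r'). geodesic_ray G S r \<and> geodesic_ray G S r' \<and>
               (\<exists>C. \<forall>n. word_dist G S (r n) (r' n) \<le> C)}"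

section \<open>Projective Anosov representations\<close>

definition projective_anosov ::
    "('k::field \<Rightarrow> real) \<Rightarrow> ('k ^ 'd::finite \<Rightarrow> real) \<Rightarrow> (nat \<Rightarrow> 'k ^ 'd) \<Rightarrow>
     ('g, 'b) monoid_scheme \<Rightarrow> 'g set \<Rightarrow> ('g \<Rightarrow> ('k ^ 'd ^ 'd) set) \<Rightarrow> bool" where
  "projective_anosov v N e G S \<rho> \<longleftrightarrow>
     (\<exists>c>0. \<exists>\<mu>>0. \<forall>\<gamma>\<in>carrier G.
        sv_ratio v N e (\<rho> \<gamma>) \<le> c * exp (- \<mu> * real (word_length G S \<gamma>)))"

text \<open>The value at \<open>x\<close> of the boundary map \<open>\<xi>\<^sup>1\<close>: the common limit over all geodesic rays
  converging to \<open>x\<close> and all choices of \<open>U\<^sub>1\<close> along them.\<close>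

definition boundary_map ::
    "('k::field \<Rightarrow> real) \<Rightarrow> ('k ^ 'd::finite \<Rightarrow> real) \<Rightarrow> (nat \<Rightarrow> 'k ^ 'd) \<Rightarrow>
     ('g \<Rightarrow> ('k ^ 'd ^ 'd) set) \<Rightarrow> (nat \<Rightarrow> 'g) set \<Rightarrow> ('k ^ 'd) set" where
  "boundary_map v N e \<rho> x =
     (THE p. p \<in> proj_space \<and>
        (\<forall>r\<in>x. \<forall>L. (\<forall>n. L n \<in> U1 v N e (\<rho> (r n))) \<longrightarrow>
           (\<lambda>n. proj_dist v N e (L n) p) \<longlonglongrightarrow> 0))"

text \<open>The infimum is over \<open>s \<ge> 0\<close>, so that the exponent is 0 for a finite index set.\<close>

definition critical_exponent :: "'i set \<Rightarrow> ('i \<Rightarrow> real) \<Rightarrow> ereal" where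
  "critical_exponent I f = Inf {ereal s | s. 0 \<le> s \<and> (\<lambda>i. f i powr s) summable_on I}"

section \<open>Hausdorff dimension of a subset of a metric space with carrier M and distance dst\<close>

definition set_diameter :: "('a \<Rightarrow> 'a \<Rightarrow> real) \<Rightarrow> 'a set \<Rightarrow> real" where
  "set_diameter dst U = (if U = {} then 0 else SUP (x, y)\<in>U \<times> U. dst x y)"

definition hausdorff_premeasure ::
    "'a set \<Rightarrow> ('a \<Rightarrow> 'a \<Rightarrow> real) \<Rightarrow> real \<Rightarrow> real \<Rightarrow> 'a set \<Rightarrow> ennreal" where
  "hausdorff_premeasure M dst s \<delta> A =
     Inf {(\<Sum>i. ennreal (set_diameter dst (U i) powr s)) | U :: nat \<Rightarrow> 'a set.
            (\<forall>i. U i \<subseteq> M \<and> (\<forall>x\<in>U i. \<forall>y\<in>U i. dst x y \<le> \<delta>)) \<and> A \<subseteq> (\<Union>i. U i)}"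

definition hausdorff_outer_measure ::
    "'a set \<Rightarrow> ('a \<Rightarrow> 'a \<Rightarrow> real) \<Rightarrow> real \<Rightarrow> 'a set \<Rightarrow> ennreal" where
  "hausdorff_outer_measure M dst s A = (SUP \<delta>\<in>{0<..}. hausdorff_premeasure M dst s \<delta> A)"

text \<open>Restricting to \<open>s > 0\<close> does not change the infimum and avoids the convention for \<open>0 powr 0\<close>.\<close>

definition hausdorff_dim :: "'a set \<Rightarrow> ('a \<Rightarrow> 'a \<Rightarrow> real) \<Rightarrow> 'a set \<Rightarrow> ereal" where
  "hausdorff_dim M dst A = Inf {ereal s | s. 0 < s \<and> hausdorff_outer_measure M dst s A = 0}"

end

theory Submission
  imports Defs
begin

text \<open>Along a geodesic ray \<open>r\<close> the attracting lines \<open>U\<^sub>1(\<rho>(r n))\<close> move by at most a constant times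
  \<open>a n = \<sigma>\<^sub>2/\<sigma>\<^sub>1(\<rho>(r n))\<close> at each step, so that the limit \<open>\<xi>\<^sup>1(x)\<close> is within a constant times
  \<open>\<Sum>m\<ge>n. a m\<close> of \<open>U\<^sub>1(\<rho>(r n))\<close>.  The Anosov condition does not bound this tail by \<open>a n\<close> for every \<open>n\<close>,
  which would need transversality of the attracting lines and repelling hyperplanes.  But
  \<open>a n * exp (\<mu> n / 2)\<close> tends to 0, hence infinitely many of its terms dominate all later ones, and
  for those \<open>n\<close> the tail is at most a constant times \<open>a n\<close>.  So every point of the limit set lies in
  infinitely many of the balls \<open>B(U\<^sub>1(\<rho>(\<gamma>)), K \<sigma>\<^sub>2/\<sigma>\<^sub>1(\<rho>(\<gamma>)))\<close>, and the bound follows by covering with the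
  balls outside a large finite set of \<open>\<gamma>\<close>.\<close>

section \<open>Coordinates\<close>

text \<open>Singular values, their ratio, the projective distance and the boundary map are definite
  descriptions, so each needs existence and uniqueness before it can be estimated. This is why
  Cartan decompositions are constructed, the first two singular values are characterised by the
  growth of lengths and areas, and projective space is shown to be complete. The scalars carry no
  topology, and the two kinds of field have different norms. All arguments up to the dimension bound
  therefore rest on one list of properties, \<open>normed_frame\<close>, in which orthogonality is
  replaced by the kernel of a functional that norms a vector. The step bound along a ray comes from
  right multiplication: consecutive images are \<open>g\<close> and \<open>g h\<close> with
  \<open>h\<close> from a finite set. A unit vector that \<open>g h\<close> stretches most lands on
  the attracting line of \<open>g h\<close>; in the Cartan coordinates of \<open>g\<close>, its
  image has all components but the first at most a constant times \<open>\<sigma>\<^sub>2\<close>,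
  against a length of at least a constant times \<open>\<sigma>\<^sub>1\<close>.\<close>

lemma linear_form_iff:
  fixes l :: "'k::field ^ 'd::finite \<Rightarrow> 'k"
  shows "Vector_Spaces.linear (*s) (*) l \<longleftrightarrow>
    (\<forall>x y. l (x + y) = l x + l y) \<and> (\<forall>c x. l (c *s x) = c * l x)"
  using Vector_Spaces.linear_iff[of "(*s) :: 'k \<Rightarrow> 'k ^ 'd \<Rightarrow> _" "(*) :: 'k \<Rightarrow> 'k \<Rightarrow> 'k" l]
    vec.vector_space_axioms vector_space_over_itself.vector_space_axioms
  by auto

lemma linear_endo_iff:
  fixes f :: "'k::field ^ 'd::finite \<Rightarrow> 'k ^ 'd"
  shows "Vector_Spaces.linear (*s) (*s) f \<longleftrightarrow>
    (\<forall>x y. f (x + y) = f x + f y) \<and> (\<forall>c x. f (c *s x) = c *s f x)"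
  using Vector_Spaces.linear_iff[of "(*s) :: 'k \<Rightarrow> 'k ^ 'd \<Rightarrow> _" "(*s) :: 'k \<Rightarrow> 'k ^ 'd \<Rightarrow> _" f]
    vec.vector_space_axioms
  by auto

lemma coord_add:
  fixes e :: "nat \<Rightarrow> 'k::field ^ 'd::finite"
  assumes "is_basis e"
  shows "coord e (x + y) i = coord e x i + coord e y i"
  using assms by (simp add: coord_def is_basis_def vec.representation_add)

lemma coord_scale:
  fixes e :: "nat \<Rightarrow> 'k::field ^ 'd::finite"
  assumes "is_basis e"
  shows "coord e (c *s x) i = c * coord e x i"
  using assms by (simp add: coord_def is_basis_def vec.representation_scale)

lemma coord_zero:
  fixes e :: "nat \<Rightarrow> 'k::field ^ 'd::finite"
  shows "coord e 0 i = 0"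
  by (simp add: coord_def vec.representation_zero)

lemma linear_coord:
  fixes e :: "nat \<Rightarrow> 'k::field ^ 'd::finite"
  assumes "is_basis e"
  shows "Vector_Spaces.linear (*s) (*) (\<lambda>x. coord e x i)"
  using assms by (simp add: linear_form_iff coord_add coord_scale)

lemma coord_diff:
  fixes e :: "nat \<Rightarrow> 'k::field ^ 'd::finite"
  assumes "is_basis e"
  shows "coord e (x - y) i = coord e x i - coord e y i"
  using assms by (simp add: coord_def is_basis_def vec.representation_diff)

lemma coord_sum:
  fixes e :: "nat \<Rightarrow> 'k::field ^ 'd::finite"
  assumes "is_basis e"
  shows "coord e (\<Sum>j\<in>I. f j) i = (\<Sum>j\<in>I. coord e (f j) i)"
  by (induction I rule: infinite_finite_induct) (simp_all add: coord_zero coord_add assms)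

lemma coord_basis:
  fixes e :: "nat \<Rightarrow> 'k::field ^ 'd::finite"
  assumes "is_basis e" "i \<in> {1..CARD('d)}" "j \<in> {1..CARD('d)}"
  shows "coord e (e j) i = (if i = j then 1 else 0)"
  using assms inj_onD[of e "{1..CARD('d)}" i j]
  by (auto simp: coord_def is_basis_def vec.representation_basis)

lemma coord_comb:
  fixes e :: "nat \<Rightarrow> 'k::field ^ 'd::finite"
  assumes "is_basis e" "i \<in> {1..CARD('d)}"
  shows "coord e (\<Sum>j=1..CARD('d). c j *s e j) i = c i"
  using assms
  by (simp add: coord_sum coord_scale coord_basis if_distrib[of "(*) _"] cong: if_cong)

lemma sum_coord:
  fixes e :: "nat \<Rightarrow> 'k::field ^ 'd::finite"
  assumes "is_basis e"
  shows "(\<Sum>j=1..CARD('d). coord e x j *s e j) = x"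
proof -
  have "(\<Sum>b\<in>e ` {1..CARD('d)}. vec.representation (e ` {1..CARD('d)}) x b *s b) = x"
    using assms by (intro vec.sum_representation_eq) (auto simp: is_basis_def)
  then show ?thesis
    using assms by (simp add: sum.reindex is_basis_def coord_def)
qed

lemma coord_eqI:
  fixes e :: "nat \<Rightarrow> 'k::field ^ 'd::finite"
  assumes "is_basis e" "\<And>i. i \<in> {1..CARD('d)} \<Longrightarrow> coord e x i = coord e y i"
  shows "x = y"
proof -
  have "(\<Sum>j=1..CARD('d). coord e x j *s e j) = (\<Sum>j=1..CARD('d). coord e y j *s e j)"
    using assms(2) by (intro sum.cong) auto
  then show ?thesis unfolding sum_coord[OF assms(1)] .
qed

lemma linear_with_values:
  fixes e f :: "nat \<Rightarrow> 'k::field ^ 'd::finite"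
  assumes "is_basis e"
  shows "\<exists>A :: 'k ^ 'd ^ 'd. \<forall>i\<in>{1..CARD('d)}. A *v e i = f i"
proof -
  define F where "F x = (\<Sum>j=1..CARD('d). coord e x j *s f j)" for x
  have "Vector_Spaces.linear (*s) (*s) F"
    using assms
    by (auto simp: linear_endo_iff F_def coord_add coord_scale sum.distrib vec.scale_sum_right
        vec.scale_left_distrib vec.scale_right_distrib vec.scale_scale)
  then have A: "matrix F *v x = F x" for x by (rule matrix_works)
  have "F (e i) = f i" if "i \<in> {1..CARD('d)}" for i
  proof -
    have "F (e i) = (\<Sum>j=1..CARD('d). if j = i then f i else 0)"
      unfolding F_def using that assms by (intro sum.cong) (auto simp: coord_basis)
    then show ?thesis using that by simp
  qed
  then show ?thesis using A by metis
qed

lemma matrix_eq_on_basis: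
  fixes e :: "nat \<Rightarrow> 'k::field ^ 'd::finite" and A B :: "'k ^ 'd ^ 'd"
  assumes "is_basis e" "\<And>i. i \<in> {1..CARD('d)} \<Longrightarrow> A *v e i = B *v e i"
  shows "A = B"
proof -
  have "A *v x = B *v x" for x
  proof -
    have "A *v (\<Sum>j=1..CARD('d). coord e x j *s e j) = B *v (\<Sum>j=1..CARD('d). coord e x j *s e j)"
      using assms(2) by (simp add: vec.sum vec.scale)
    then show ?thesis unfolding sum_coord[OF assms(1)] .
  qed
  then show ?thesis by (simp add: matrix_eq)
qed

lemma span_scale:
  fixes x :: "'k::field ^ 'd::finite"
  assumes "a \<noteq> 0"
  shows "vec.span {a *s x} = vec.span {x}"
proof -
  have "k *s x = (k / a) *s (a *s x)" for k
    using assms by (simp add: vec.scale_scale)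
  then have "k *s x \<in> range (\<lambda>k. k *s (a *s x))" for k by blast
  then show ?thesis by (auto simp: vec.span_singleton vec.scale_scale)
qed

lemma invertible_nonzero: "invertible g \<Longrightarrow> x \<noteq> 0 \<Longrightarrow> g *v x \<noteq> 0"
  for g :: "'k::field ^ 'd::finite ^ 'd"
  using invertible_left_inverse[of g] matrix_left_invertible_ker[of g] by blast

lemma wedge_norm_shear:
  fixes e :: "nat \<Rightarrow> 'k::field ^ 'd::finite"
  assumes "is_basis e"
  shows "wedge_norm v e x (y - a *s x) = wedge_norm v e x y"
proof -
  have "coord e x i * coord e (y - a *s x) j - coord e x j * coord e (y - a *s x) i
      = coord e x i * coord e y j - coord e x j * coord e y i" for i j
    using assms by (simp add: coord_diff coord_scale algebra_simps)
  then show ?thesis by (simp only: wedge_norm_def)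
qed

lemma null_squeeze:
  fixes f g :: "nat \<Rightarrow> real"
  assumes "g \<longlonglongrightarrow> 0" "\<And>n. 0 \<le> f n" "\<And>n. f n \<le> g n"
  shows "f \<longlonglongrightarrow> 0"
  by (rule real_tendsto_sandwich[of "\<lambda>_. 0" f _ g]) (use assms in auto)

section \<open>Good norms, axiomatically\<close>

text \<open>The common ground of the two kinds of good norm. The kernel of a functional given by
  \<open>norming\<close> plays the part of the orthogonal complement of \<open>x\<close>: by
  \<open>join_ge\<close>, dropping the \<open>x\<close> component does not lengthen a vector, and by
  \<open>join_eq\<close>, the length of \<open>a *s x + w\<close> depends neither on
  \<open>x\<close> nor on the direction of \<open>w\<close>. \<open>maximizer\<close> stands in for
  compactness of the unit sphere. \<open>wedge_proj\<close> says that area is base times height,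
  with a foot of the height no longer than \<open>y\<close>.\<close>

locale normed_frame =
  fixes v :: "'k::field \<Rightarrow> real" and N :: "'k ^ 'd::finite \<Rightarrow> real" and e :: "nat \<Rightarrow> 'k ^ 'd"
  assumes basis: "is_basis e"
    and dim_ge_2: "2 \<le> CARD('d)"
    and v_nonneg: "0 \<le> v a"
    and v_eq_0_iff: "v a = 0 \<longleftrightarrow> a = 0"
    and v_mult: "v (a * b) = v a * v b"
    and N_nonneg: "0 \<le> N x"
    and N_eq_0_iff: "N x = 0 \<longleftrightarrow> x = 0"
    and N_scale: "N (a *s x) = v a * N x"
    and N_triangle: "N (x + y) \<le> N x + N y"
    and N_basis: "i \<in> {1..CARD('d)} \<Longrightarrow> N (e i) = 1"
    and N_mono: "\<lbrakk>0 \<le> t; \<And>i. i \<in> {1..CARD('d)} \<Longrightarrow> v (coord e x i) \<le> t * v (coord e y i)\<rbrakk>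
      \<Longrightarrow> N x \<le> t * N y"
    and N_complete: "\<forall>\<epsilon>>0. \<exists>M. \<forall>m\<ge>M. \<forall>n\<ge>M. N (u m - u n) < \<epsilon>
      \<Longrightarrow> \<exists>x. (\<lambda>n::nat. N (u n - x)) \<longlonglongrightarrow> 0"
    and normalise: "x \<noteq> 0 \<Longrightarrow> \<exists>a. v a * N x = 1"
    and norming: "N x = 1 \<Longrightarrow> \<exists>l. Vector_Spaces.linear (*s) (*) l \<and> l x = 1 \<and> (\<forall>y. v (l y) \<le> N y)"
    and maximizer: "Vector_Spaces.linear (*s) (*s) G \<Longrightarrow> \<exists>x. x \<noteq> 0 \<and> (\<forall>y. N (G y) * N x \<le> N (G x) * N y)"
    and join_ge: "\<lbrakk>Vector_Spaces.linear (*s) (*) l; l x = 1; N x = 1; \<And>y. v (l y) \<le> N y; l w = 0\<rbrakk>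
      \<Longrightarrow> N w \<le> N (a *s x + w)"
    and join_eq: "\<lbrakk>Vector_Spaces.linear (*s) (*) l; l x = 1; N x = 1; \<And>y. v (l y) \<le> N y; l w = 0;
        Vector_Spaces.linear (*s) (*) l'; l' x' = 1; N x' = 1; \<And>y. v (l' y) \<le> N y; l' w' = 0; N w = N w'\<rbrakk>
      \<Longrightarrow> N (a *s x + w) = N (a *s x' + w')"
    and wedge_le: "wedge_norm v e x y \<le> N x * N y"
    and wedge_proj: "x \<noteq> 0 \<Longrightarrow>
      \<exists>a. wedge_norm v e x y = N x * N (y - a *s x) \<and> N (a *s x) \<le> N y"
begin

abbreviation (input) W where "W \<equiv> wedge_norm v e"

lemma v_0 [simp]: "v 0 = 0"
  by (simp add: v_eq_0_iff)

lemma v_1 [simp]: "v 1 = 1"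
  using v_mult[of 1 1] v_eq_0_iff[of 1] by simp

lemma v_minus [simp]: "v (- a) = v a"
proof -
  have "v (-1) * v (-1) = 1" using v_mult[of "-1" "-1"] by simp
  then have "v (-1) = 1" using v_nonneg[of "-1"] by (simp add: square_eq_1_iff)
  then show ?thesis using v_mult[of "-1" a] by simp
qed

lemma v_pos: "a \<noteq> 0 \<Longrightarrow> 0 < v a"
  using v_nonneg[of a] v_eq_0_iff[of a] by simp

lemma v_inverse: "v (inverse a) = inverse (v a)"
proof (cases "a = 0")
  case False
  then have "v (inverse a) * v a = 1" by (simp flip: v_mult)
  then show ?thesis using False v_pos[of a] by (simp add: field_simps)
qed simp

lemma v_divide: "v (a / b) = v a / v b"
  by (simp add: divide_inverse v_mult v_inverse)

lemma N_0 [simp]: "N 0 = 0"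
  by (simp add: N_eq_0_iff)

lemma N_pos: "x \<noteq> 0 \<Longrightarrow> 0 < N x"
  using N_nonneg[of x] N_eq_0_iff[of x] by simp

lemma N_minus [simp]: "N (- x) = N x"
  using N_scale[of "-1" x] by (simp add: vec.scale_minus_left)

lemma N_diff_commute: "N (x - y) = N (y - x)"
  using N_minus[of "x - y"] by simp

lemma N_sum_le: "N (\<Sum>i\<in>I. f i) \<le> (\<Sum>i\<in>I. N (f i))"
proof (induction I rule: infinite_finite_induct)
  case (insert i I)
  then show ?case using N_triangle[of "f i" "\<Sum>i\<in>I. f i"] by simp
qed auto

lemma coord_le: "i \<in> {1..CARD('d)} \<Longrightarrow> v (coord e x i) \<le> N x"
proof -
  assume i: "i \<in> {1..CARD('d)}"
  have "N (coord e x i *s e i) \<le> 1 * N x"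
    using i by (intro N_mono) (auto simp: coord_scale basis coord_basis v_mult v_nonneg)
  then show ?thesis using i by (simp add: N_scale N_basis)
qed

lemma basis_nonzero: "i \<in> {1..CARD('d)} \<Longrightarrow> e i \<noteq> 0"
  using N_basis[of i] by auto

text \<open>Inside the frame this is the only place where the two shapes of the wedge norm, maximum
  and Euclidean norm of the minors, are told apart. Symmetry, homogeneity and the sign at
  \<open>x = 0\<close> are then read off from the minors through it.\<close>

lemma wedge_mono:
  assumes "0 \<le> t"
    and le: "\<And>i j. \<lbrakk>1 \<le> i; i < j; j \<le> CARD('d)\<rbrakk> \<Longrightarrow>
      v (coord e x i * coord e y j - coord e x j * coord e y i)
        \<le> t * v (coord e x' i * coord e y' j - coord e x' j * coord e y' i)"
  shows "W x y \<le> t * W x' y'"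
proof -
  define P where "P = {(i, j). 1 \<le> i \<and> i < j \<and> j \<le> CARD('d)}"
  define m where "m x y = (\<lambda>(i, j). v (coord e x i * coord e y j - coord e x j * coord e y i))" for x y
  have fin: "finite P"
    by (rule finite_subset[of _ "{1..CARD('d)} \<times> {1..CARD('d)}"]) (auto simp: P_def)
  have "(1, 2) \<in> P" using dim_ge_2 by (simp add: P_def)
  then have ne: "P \<noteq> {}" by auto
  have le': "m x y p \<le> t * m x' y' p" if "p \<in> P" for p
    using that le by (auto simp: P_def m_def)
  have nonneg: "0 \<le> m x y p" for x y p
    by (auto simp: m_def v_nonneg split: prod.splits)
  show ?thesis
  proof (cases "nonarch_local_field v")
    case True
    have "Max (m x y ` P) \<le> t * Max (m x' y' ` P)"
    proof (rule Max.boundedI)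
      fix r assume "r \<in> m x y ` P"
      then obtain p where p: "p \<in> P" "r = m x y p" by auto
      have "m x' y' p \<le> Max (m x' y' ` P)" using p fin by simp
      then have "t * m x' y' p \<le> t * Max (m x' y' ` P)" using \<open>0 \<le> t\<close> by (rule mult_left_mono)
      then show "r \<le> t * Max (m x' y' ` P)" using le'[OF p(1)] p(2) by linarith
    qed (use fin ne in auto)
    then show ?thesis using True by (simp add: wedge_norm_def Let_def P_def m_def)
  next
    case False
    have "(\<Sum>p\<in>P. (m x y p)\<^sup>2) \<le> (\<Sum>p\<in>P. (t * m x' y' p)\<^sup>2)"
      using le' nonneg by (intro sum_mono power_mono) auto
    also have "\<dots> = t\<^sup>2 * (\<Sum>p\<in>P. (m x' y' p)\<^sup>2)"
      by (simp add: power_mult_distrib sum_distrib_left)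
    finally have "sqrt (\<Sum>p\<in>P. (m x y p)\<^sup>2) \<le> sqrt (t\<^sup>2 * (\<Sum>p\<in>P. (m x' y' p)\<^sup>2))"
      by (rule real_sqrt_le_mono)
    also have "\<dots> = t * sqrt (\<Sum>p\<in>P. (m x' y' p)\<^sup>2)"
      using \<open>0 \<le> t\<close> by (simp add: real_sqrt_mult)
    finally show ?thesis using False by (simp add: wedge_norm_def Let_def P_def m_def)
  qed
qed

lemma wedge_cong:
  assumes "\<And>i j. \<lbrakk>1 \<le> i; i < j; j \<le> CARD('d)\<rbrakk> \<Longrightarrow>
      v (coord e x i * coord e y j - coord e x j * coord e y i)
        = v (coord e x' i * coord e y' j - coord e x' j * coord e y' i)"
  shows "W x y = W x' y'"
  using wedge_mono[of 1 x y x' y'] wedge_mono[of 1 x' y' x y] assms by force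

lemma wedge_commute: "W x y = W y x"
proof (rule wedge_cong)
  fix i j
  show "v (coord e x i * coord e y j - coord e x j * coord e y i) =
        v (coord e y i * coord e x j - coord e y j * coord e x i)"
    using v_minus[of "coord e x i * coord e y j - coord e x j * coord e y i"]
    by (simp add: algebra_simps)
qed

lemma wedge_nonneg: "0 \<le> W x y"
proof (cases "x = 0")
  case True
  \<comment> \<open>All minors vanish, so the common value \<open>w\<close> of both wedge norms
    satisfies \<open>w \<le> 2 * w\<close>, which forces \<open>0 \<le> w\<close> without evaluating
    the norm.\<close>
  have "W x x \<le> 2 * W x y" by (rule wedge_mono) (use True in \<open>auto simp: coord_zero\<close>)
  moreover have "W x x = W x y" by (rule wedge_cong) (use True in \<open>auto simp: coord_zero\<close>)
  ultimately show ?thesis by simp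
next
  case False
  then show ?thesis using wedge_proj[of x y] N_nonneg by force
qed

lemma wedge_scale_left: "W (a *s x) y = v a * W x y"
proof (rule antisym)
  show "W (a *s x) y \<le> v a * W x y"
    by (rule wedge_mono)
      (simp_all add: coord_scale basis v_nonneg mult.assoc flip: right_diff_distrib v_mult)
  show "v a * W x y \<le> W (a *s x) y"
  proof (cases "a = 0")
    case False
    have "W x y \<le> inverse (v a) * W (a *s x) y"
    proof (rule wedge_mono)
      fix i j
      have "v (coord e (a *s x) i * coord e y j - coord e (a *s x) j * coord e y i)
          = v a * v (coord e x i * coord e y j - coord e x j * coord e y i)"
        by (simp add: coord_scale basis mult.assoc flip: right_diff_distrib v_mult)
      then show "v (coord e x i * coord e y j - coord e x j * coord e y i) \<le> inverse (v a) *
          v (coord e (a *s x) i * coord e y j - coord e (a *s x) j * coord e y i)"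
        using v_pos[OF False] by (simp flip: mult.assoc)
    qed (simp add: v_nonneg)
    then show ?thesis using v_pos[OF False] by (simp add: field_simps)
  qed (simp add: wedge_nonneg)
qed

lemma wedge_scale_right: "W x (a *s y) = v a * W x y"
  using wedge_scale_left wedge_commute by metis

lemma wedge_le_diff: "W x y \<le> N x * N (y - a *s x)"
  using wedge_le[of x "y - a *s x"] by (simp add: wedge_norm_shear[OF basis])

subsection \<open>The distance on projective space\<close>

text \<open>In the Archimedean case this is the sine of the angle between two nonzero vectors. In
  both cases it is the distance from \<open>y\<close> to the line of \<open>x\<close> relative to
  \<open>N y\<close>, as \<open>dist_vec_le\<close> and \<open>dist_vec_attained\<close>
  show.\<close>

definition dist_vec :: "'k ^ 'd \<Rightarrow> 'k ^ 'd \<Rightarrow> real" where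
  "dist_vec x y = W x y / (N x * N y)"

lemma dist_vec_nonneg: "0 \<le> dist_vec x y"
  by (simp add: dist_vec_def wedge_nonneg N_nonneg)

lemma dist_vec_commute: "dist_vec x y = dist_vec y x"
  by (simp add: dist_vec_def wedge_commute[of x y] mult.commute)

lemma dist_vec_scale_left: "a \<noteq> 0 \<Longrightarrow> dist_vec (a *s x) y = dist_vec x y"
  using v_eq_0_iff[of a] by (simp add: dist_vec_def wedge_scale_left N_scale)

lemma dist_vec_scale_right: "a \<noteq> 0 \<Longrightarrow> dist_vec x (a *s y) = dist_vec x y"
  using dist_vec_scale_left dist_vec_commute by metis

lemma dist_vec_le: "x \<noteq> 0 \<Longrightarrow> y \<noteq> 0 \<Longrightarrow> dist_vec x y * N y \<le> N (y - a *s x)"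
  using wedge_le_diff[of x y a] N_pos[of x] N_pos[of y] by (simp add: dist_vec_def field_simps)

lemma dist_vec_attained:
  assumes "x \<noteq> 0" "y \<noteq> 0"
  obtains a where "N (y - a *s x) = dist_vec x y * N y" "N (a *s x) \<le> N y"
  using wedge_proj[OF assms(1), of y] N_pos[OF assms(1)] N_pos[OF assms(2)]
  by (force simp: dist_vec_def field_simps)

text \<open>Approximate \<open>z\<close> by \<open>b *s y\<close>, and then \<open>b *s y\<close> by
  a multiple of \<open>x\<close>. The bound \<open>N (b *s y) \<le> N z\<close> is what allows the
  second error to be measured relative to \<open>z\<close>.\<close>

lemma dist_vec_triangle:
  assumes "x \<noteq> 0" "y \<noteq> 0" "z \<noteq> 0"
  shows "dist_vec x z \<le> dist_vec x y + dist_vec y z"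
proof -
  obtain b where b: "N (z - b *s y) = dist_vec y z * N z" "N (b *s y) \<le> N z"
    using dist_vec_attained assms by metis
  obtain a where a: "N (y - a *s x) = dist_vec x y * N y"
    using dist_vec_attained assms by metis
  have "dist_vec x z * N z \<le> N (z - (b * a) *s x)"
    using assms by (intro dist_vec_le)
  also have "z - (b * a) *s x = (z - b *s y) + b *s (y - a *s x)"
    by (simp add: vec.scale_right_diff_distrib vec.scale_scale)
  also have "N \<dots> \<le> N (z - b *s y) + N (b *s (y - a *s x))" by (rule N_triangle)
  also have "N (b *s (y - a *s x)) = dist_vec x y * N (b *s y)"
    unfolding N_scale a by simp
  also have "\<dots> \<le> dist_vec x y * N z"
    using b(2) dist_vec_nonneg by (rule mult_left_mono)
  finally have "dist_vec x z * N z \<le> (dist_vec x y + dist_vec y z) * N z"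
    using b(1) by (simp add: algebra_simps)
  then show ?thesis using N_pos[OF assms(3)] by simp
qed

lemma dist_vec_eq_0:
  assumes "x \<noteq> 0" "y \<noteq> 0" "dist_vec x y = 0"
  shows "vec.span {x} = vec.span {y}"
proof -
  obtain a where "N (y - a *s x) = dist_vec x y * N y"
    using dist_vec_attained assms by metis
  then have y: "y = a *s x" using assms(3) by (simp add: N_eq_0_iff)
  then have "a \<noteq> 0" using assms(2) by auto
  then show ?thesis unfolding y by (simp add: span_scale)
qed

section \<open>Cartan decompositions\<close>

text \<open>Stage \<open>k\<close> of the construction of a Cartan decomposition of \<open>g\<close>: the vectors \<open>f i\<close> and
  \<open>h i\<close>, \<open>i \<le> k\<close>, are the first columns of the inverse of the right and of the left isometry, and \<open>U\<close>,
  \<open>U'\<close> are the orthogonal complements of their spans.  Orthogonality is expressed by comparison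
  with \<open>e\<close>, which treats the Archimedean and the non-Archimedean case alike.\<close>

definition orthogonal_split :: "nat \<Rightarrow> (nat \<Rightarrow> 'k ^ 'd) \<Rightarrow> ('k ^ 'd) set \<Rightarrow> bool" where
  "orthogonal_split k f U \<longleftrightarrow>
     (\<forall>c u u'. u \<in> U \<and> (\<forall>i\<in>{1..k}. coord e u' i = 0) \<and> N u = N u' \<longrightarrow>
        N ((\<Sum>i=1..k. c i *s f i) + u) = N ((\<Sum>i=1..k. c i *s e i) + u'))"

definition partial_cartan ::
    "'k ^ 'd ^ 'd \<Rightarrow> nat \<Rightarrow> (nat \<Rightarrow> 'k ^ 'd) \<Rightarrow> (nat \<Rightarrow> 'k ^ 'd) \<Rightarrow> (nat \<Rightarrow> 'k) \<Rightarrow>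
     ('k ^ 'd) set \<Rightarrow> ('k ^ 'd) set \<Rightarrow> ('k ^ 'd \<Rightarrow> 'k ^ 'd) \<Rightarrow> bool" where
  "partial_cartan g k f h a U U' \<pi> \<longleftrightarrow>
     orthogonal_split k f U \<and> orthogonal_split k h U' \<and>
     (\<forall>i\<in>{1..k}. g *v f i = a i *s h i) \<and>
     (\<forall>i\<in>{1..k}. \<forall>j\<in>{1..k}. i \<le> j \<longrightarrow> v (a j) \<le> v (a i)) \<and>
     (\<forall>i\<in>{1..k}. \<forall>u\<in>U. N (g *v u) \<le> v (a i) * N u) \<and>
     vec.subspace U \<and> vec.subspace U' \<and> (\<forall>u\<in>U. g *v u \<in> U') \<and>
     Vector_Spaces.linear (*s) (*s) \<pi> \<and> (\<forall>x. \<pi> x \<in> U \<and> N (\<pi> x) \<le> N x) \<and> (\<forall>u\<in>U. \<pi> u = u) \<and>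
     (\<forall>x. \<exists>c. x = (\<Sum>i=1..k. c i *s f i) + \<pi> x)"

text \<open>The new term is absorbed into the old complement: \<open>c (Suc k) *s x + u\<close> lies
  in \<open>U\<close>, and by \<open>join_eq\<close> it is as long as its model on
  \<open>e (Suc k)\<close>, which is normed by the coordinate functional. The split at stage
  \<open>k\<close> then applies to this longer vector.\<close>

lemma orthogonal_split_extend:
  assumes split: "orthogonal_split k f U" and k: "Suc k \<le> CARD('d)"
    and U: "vec.subspace U" "x \<in> U"
    and l: "Vector_Spaces.linear (*s) (*) l" "l x = 1" "N x = 1" "\<And>y. v (l y) \<le> N y"
  shows "orthogonal_split (Suc k) (f(Suc k := x)) {u \<in> U. l u = 0}"
  unfolding orthogonal_split_def
proof (intro allI impI, elim conjE)
  fix c u u' assume u: "u \<in> {u \<in> U. l u = 0}" and u': "\<forall>i\<in>{1..Suc k}. coord e u' i = 0"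
    and Neq: "N u = N u'"
  let ?w = "c (Suc k) *s x + u" and ?w' = "c (Suc k) *s e (Suc k) + u'"
  have "N ?w = N ?w'"
  proof (rule join_eq[OF l])
    show "l u = 0" using u by simp
    show "Vector_Spaces.linear (*s) (*) (\<lambda>x. coord e x (Suc k))" by (rule linear_coord[OF basis])
    show "coord e (e (Suc k)) (Suc k) = 1" using k by (simp add: coord_basis[OF basis])
    show "N (e (Suc k)) = 1" using k by (simp add: N_basis)
    show "coord e u' (Suc k) = 0" using u' by simp
    show "v (coord e y (Suc k)) \<le> N y" for y using k by (intro coord_le) simp
    show "N u = N u'" by (rule Neq)
  qed
  moreover have "?w \<in> U" using U u by (auto intro: vec.subspace_add vec.subspace_scale)
  moreover have "\<forall>i\<in>{1..k}. coord e ?w' i = 0"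
    using u' k by (simp add: coord_add coord_scale coord_basis basis)
  ultimately have "N ((\<Sum>i=1..k. c i *s f i) + ?w) = N ((\<Sum>i=1..k. c i *s e i) + ?w')"
    using split unfolding orthogonal_split_def by blast
  moreover have "(\<Sum>i=1..Suc k. c i *s (f(Suc k := x)) i) + u = (\<Sum>i=1..k. c i *s f i) + ?w"
    by (simp add: add.assoc)
  moreover have "(\<Sum>i=1..Suc k. c i *s e i) + u' = (\<Sum>i=1..k. c i *s e i) + ?w'"
    by (simp add: add.assoc)
  ultimately show "N ((\<Sum>i=1..Suc k. c i *s (f(Suc k := x)) i) + u)
      = N ((\<Sum>i=1..Suc k. c i *s e i) + u')" by (simp only:)
qed

lemma partial_cartan_0: "partial_cartan g 0 f h a UNIV UNIV (\<lambda>x. x)"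
  by (auto simp: partial_cartan_def orthogonal_split_def linear_endo_iff)

text \<open>The next right vector maximises the stretching by \<open>g\<close> on \<open>U\<close>,
  and the next left vector is its normalised image. A functional norming the left vector is pulled
  back to one norming the right vector, so that both complements shrink by matching hyperplanes and
  \<open>g\<close> still maps one into the other.\<close>

lemma partial_cartan_Suc:
  assumes pc: "partial_cartan g k f h a U U' \<pi>" and k: "Suc k \<le> CARD('d)"
    and inj: "\<And>x. g *v x = 0 \<Longrightarrow> x = 0"
  shows "\<exists>f h a U U' \<pi>. partial_cartan g (Suc k) f h a U U' \<pi>"
proof -
  have splitf: "orthogonal_split k f U" and splith: "orthogonal_split k h U'"
    and gf: "\<And>i. i \<in> {1..k} \<Longrightarrow> g *v f i = a i *s h i"
    and dec: "\<And>i j. i \<in> {1..k} \<Longrightarrow> j \<in> {1..k} \<Longrightarrow> i \<le> j \<Longrightarrow> v (a j) \<le> v (a i)"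
    and bound: "\<And>i u. i \<in> {1..k} \<Longrightarrow> u \<in> U \<Longrightarrow> N (g *v u) \<le> v (a i) * N u"
    and U: "vec.subspace U" and U': "vec.subspace U'"
    and gU: "\<And>u. u \<in> U \<Longrightarrow> g *v u \<in> U'"
    and pi_lin: "Vector_Spaces.linear (*s) (*s) \<pi>" and pi_U: "\<And>x. \<pi> x \<in> U"
    and pi_le: "\<And>x. N (\<pi> x) \<le> N x" and pi_id: "\<And>u. u \<in> U \<Longrightarrow> \<pi> u = u"
    and decomp: "\<And>x. \<exists>c. x = (\<Sum>i=1..k. c i *s f i) + \<pi> x"
    using pc unfolding partial_cartan_def by (elim conjE; blast)+
  have pi_add: "\<pi> (x + y) = \<pi> x + \<pi> y" and pi_scale: "\<pi> (b *s x) = b *s \<pi> x" for x y b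
    using pi_lin by (auto simp: linear_endo_iff)
  \<comment> \<open>\<open>maximizer\<close> concerns endomorphisms of the whole space; composing
    with the norm-nonincreasing projection \<open>\<pi>\<close> turns it into a maximum over
    \<open>U\<close>.\<close>
  define G where "G x = g *v \<pi> x" for x
  have G_lin: "Vector_Spaces.linear (*s) (*s) G"
    by (auto simp: linear_endo_iff G_def pi_add pi_scale vec.add vec.scale)
  obtain x0 where x0: "x0 \<noteq> 0" and max: "\<And>y. N (G y) * N x0 \<le> N (G x0) * N y"
    using maximizer[OF G_lin] by blast
  \<comment> \<open>Dimension count: otherwise the \<open>k\<close> vectors \<open>f i\<close>,
    fewer than the dimension, would span the space. This makes the maximal stretching on
    \<open>U\<close> positive.\<close>
  have "\<exists>z. \<pi> z \<noteq> 0"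
  proof (rule ccontr)
    assume "\<not> (\<exists>z. \<pi> z \<noteq> 0)"
    then have "\<exists>c. x = (\<Sum>i=1..k. c i *s f i)" for x using decomp[of x] by simp
    then have "x \<in> vec.span (f ` {1..k})" for x
    proof -
      obtain c where "x = (\<Sum>i=1..k. c i *s f i)" using \<open>\<And>x. \<exists>c. x = (\<Sum>i=1..k. c i *s f i)\<close> by blast
      moreover have "c i *s f i \<in> vec.span (f ` {1..k})" if "i \<in> {1..k}" for i
        using that by (auto intro!: vec.span_scale intro: vec.span_base)
      ultimately show ?thesis by (simp only: vec.span_sum)
    qed
    then have "vec.dim (UNIV :: ('k ^ 'd) set) \<le> card (f ` {1..k})"
      by (intro vec.dim_le_card) auto
    also have "\<dots> \<le> k" using card_image_le[of "{1..k}" f] by simp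
    finally show False using k by (simp add: card_cart_basis)
  qed
  then obtain z where z: "\<pi> z \<noteq> 0" by blast
  have "G z \<noteq> 0" using inj z by (auto simp: G_def)
  then have "0 < N (G z) * N x0" using x0 by (simp add: N_pos)
  then have Gx0: "G x0 \<noteq> 0" using max[of z] by auto
  then have pix0: "\<pi> x0 \<noteq> 0" by (auto simp: G_def vec.zero)
  then obtain s where s: "v s * N (\<pi> x0) = 1" using normalise by blast
  then have s0: "s \<noteq> 0" by auto
  define f0 where "f0 = s *s \<pi> x0"
  have f0: "f0 \<in> U" "N f0 = 1"
    using s pi_U U by (auto simp: f0_def N_scale intro: vec.subspace_scale)
  have gf0: "g *v f0 = s *s G x0" by (simp add: f0_def G_def vec.scale)
  then have "g *v f0 \<noteq> 0" using s0 Gx0 by simp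
  then obtain r where r: "v r * N (g *v f0) = 1" using normalise by blast
  then have r0: "r \<noteq> 0" by auto
  \<comment> \<open>The diagonal entry has to be a scalar of the field with absolute value
    \<open>N (g *v f0)\<close>; \<open>normalise\<close> yields the inverse of such a
    scalar.\<close>
  define b where "b = inverse r"
  define h0 where "h0 = r *s (g *v f0)"
  have b: "b \<noteq> 0" "v b = N (g *v f0)"
    using r r0 v_pos[OF r0] unfolding b_def v_inverse by (auto simp: field_simps)
  have gf0: "g *v f0 = b *s h0" using r0 by (simp add: h0_def b_def vec.scale_scale)
  have h0: "h0 \<in> U'" "N h0 = 1"
    using r gU[OF f0(1)] U' by (auto simp: h0_def N_scale intro: vec.subspace_scale)
  have gbound: "N (g *v u) \<le> v b * N u" if "u \<in> U" for u
  proof -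
    have "N (g *v u) * N x0 \<le> N (G x0) * N u" using max[of u] that by (simp add: G_def pi_id)
    also have "N (G x0) = v b * N (\<pi> x0)"
    proof -
      have "v b = v s * N (G x0)" by (simp only: b(2) \<open>g *v f0 = s *s G x0\<close> N_scale)
      then show ?thesis using s by (metis mult.assoc mult.commute mult_1_right)
    qed
    \<comment> \<open>The maximum is attained at \<open>x0\<close>, but \<open>f0\<close> is a
      multiple of \<open>\<pi> x0\<close>; the exchange costs nothing because \<open>\<pi>\<close>
      does not increase norms.\<close>
    also have "v b * N (\<pi> x0) * N u \<le> v b * N x0 * N u"
      using pi_le[of x0] by (intro mult_right_mono mult_left_mono) (auto simp: v_nonneg N_nonneg)
    finally have "N (g *v u) * N x0 \<le> v b * N u * N x0" by (simp add: mult.commute mult.left_commute)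
    then show ?thesis using N_pos[OF x0] by simp
  qed
  obtain l where l: "Vector_Spaces.linear (*s) (*) l" "l h0 = 1" "\<And>y. v (l y) \<le> N y"
    using norming[OF h0(2)] by blast
  have l_add: "l (x + y) = l x + l y" and l_scale: "l (t *s x) = t * l x" for x y t
    using l(1) by (auto simp: linear_form_iff)
  \<comment> \<open>The pullback of \<open>l\<close> along \<open>g\<close>, scaled to take the
    value 1 at \<open>f0\<close>. By \<open>gbound\<close> it is bounded by the norm, so it norms
    \<open>f0\<close> and its kernel is orthogonal to \<open>f0\<close>.\<close>
  define m where "m x = l (G x) / b" for x
  have m_lin: "Vector_Spaces.linear (*s) (*) m"
    using G_lin by (auto simp: linear_form_iff linear_endo_iff m_def l_add l_scale add_divide_distrib)
  then have m_add: "m (x + y) = m x + m y" and m_scale: "m (t *s x) = t * m x" for x y t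
    by (auto simp: linear_form_iff)
  have m_f0: "m f0 = 1" using b f0 l(2) by (simp add: m_def G_def pi_id gf0 l_scale)
  have m_pi: "v (m x) \<le> N (\<pi> x)" for x
  proof -
    have "v (l (G x)) \<le> v b * N (\<pi> x)" using l(3)[of "G x"] gbound[OF pi_U, of x] by (simp add: G_def)
    then show ?thesis using v_pos[OF b(1)] by (simp add: m_def v_divide field_simps)
  qed
  then have m_le: "v (m x) \<le> N x" for x using pi_le order_trans by blast
  \<comment> \<open>Removing the \<open>f0\<close> component with \<open>m\<close> does not lengthen
    a vector, by \<open>join_ge\<close>, so the new projection is again norm-nonincreasing.\<close>
  define \<pi>1 where "\<pi>1 x = \<pi> x - m x *s f0" for x
  define U1 where "U1 = {u \<in> U. m u = 0}"
  define U1' where "U1' = {u \<in> U'. l u = 0}"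
  define f1 where "f1 = f(Suc k := f0)"
  define h1 where "h1 = h(Suc k := h0)"
  define a1 where "a1 = a(Suc k := b)"
  have m_pi_eq: "m (\<pi> x) = m x" for x by (simp add: m_def G_def pi_id pi_U)
  have m_pi1: "m (\<pi>1 x) = 0" for x
  proof -
    have "m (\<pi>1 x + m x *s f0) = m (\<pi> x)" by (simp add: \<pi>1_def)
    then show ?thesis by (simp add: m_add m_scale m_f0 m_pi_eq)
  qed
  have pi1_U: "\<pi>1 x \<in> U" for x
    unfolding \<pi>1_def using U pi_U f0 by (intro vec.subspace_diff vec.subspace_scale) auto
  have pi1_le: "N (\<pi>1 x) \<le> N x" for x
  proof -
    have "N (\<pi>1 x) \<le> N (m x *s f0 + \<pi>1 x)"
      by (rule join_ge[OF m_lin m_f0 f0(2) m_le m_pi1])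
    also have "m x *s f0 + \<pi>1 x = \<pi> x" by (simp add: \<pi>1_def)
    finally show ?thesis using pi_le[of x] by simp
  qed
  have "partial_cartan g (Suc k) f1 h1 a1 U1 U1' \<pi>1"
    unfolding partial_cartan_def
  proof (intro conjI ballI allI impI)
    show "orthogonal_split (Suc k) f1 U1"
      unfolding f1_def U1_def by (rule orthogonal_split_extend[OF splitf k U f0(1) m_lin m_f0 f0(2) m_le])
    show "orthogonal_split (Suc k) h1 U1'"
      unfolding h1_def U1'_def by (rule orthogonal_split_extend[OF splith k U' h0(1) l(1,2) h0(2) l(3)])
    show "g *v f1 i = a1 i *s h1 i" if "i \<in> {1..Suc k}" for i
      using that gf gf0 by (auto simp: f1_def a1_def h1_def)
    have b_le: "v b \<le> v (a i)" if "i \<in> {1..k}" for i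
      using bound[OF that f0(1)] f0(2) b(2) by simp
    show "v (a1 j) \<le> v (a1 i)" if "i \<in> {1..Suc k}" "j \<in> {1..Suc k}" "i \<le> j" for i j
      using that dec b_le by (auto simp: a1_def)
    show "N (g *v u) \<le> v (a1 i) * N u" if "i \<in> {1..Suc k}" "u \<in> U1" for i u
      using that bound gbound by (auto simp: a1_def U1_def)
    show "vec.subspace U1"
      unfolding U1_def vec.subspace_def using U m_scale[of 0 0]
      by (auto simp: m_add m_scale vec.subspace_add vec.subspace_scale vec.subspace_0)
    show "vec.subspace U1'"
      unfolding U1'_def vec.subspace_def using U' l_scale[of 0 0]
      by (auto simp: l_add l_scale vec.subspace_add vec.subspace_scale vec.subspace_0)
    show "g *v u \<in> U1'" if "u \<in> U1" for u
      using that gU b(1) by (auto simp: U1_def U1'_def m_def G_def pi_id)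
    show "Vector_Spaces.linear (*s) (*s) \<pi>1"
      by (auto simp: linear_endo_iff \<pi>1_def pi_add pi_scale m_add m_scale vec.scale_left_distrib
          vec.scale_right_diff_distrib vec.scale_scale)
    show "\<pi>1 x \<in> U1" for x using pi1_U m_pi1 by (simp add: U1_def)
    show "N (\<pi>1 x) \<le> N x" for x by (rule pi1_le)
    show "\<pi>1 u = u" if "u \<in> U1" for u using that by (simp add: U1_def \<pi>1_def pi_id)
    show "\<exists>c. x = (\<Sum>i=1..Suc k. c i *s f1 i) + \<pi>1 x" for x
    proof -
      obtain c where c: "x = (\<Sum>i=1..k. c i *s f i) + \<pi> x" using decomp by blast
      have "(\<Sum>i=1..k. c i *s f i) = (\<Sum>i=1..k. (c(Suc k := m x)) i *s f1 i)"
        by (rule sum.cong) (auto simp: f1_def)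
      then have "x = (\<Sum>i=1..Suc k. (c(Suc k := m x)) i *s f1 i) + \<pi>1 x"
        using c by (simp add: \<pi>1_def f1_def)
      then show ?thesis by blast
    qed
  qed
  then show ?thesis by blast
qed

lemma partial_cartan_exists:
  assumes "\<And>x. g *v x = 0 \<Longrightarrow> x = 0" "k \<le> CARD('d)"
  shows "\<exists>f h a U U' \<pi>. partial_cartan g k f h a U U' \<pi>"
  using assms(2)
proof (induction k)
  case 0
  then show ?case using partial_cartan_0 by blast
next
  case (Suc k)
  then show ?case using partial_cartan_Suc[OF _ _ assms(1)] by (metis Suc_leD)
qed

lemma isometryI:
  assumes "\<And>x. N (g *v x) = N x"
  shows "g \<in> isometry_group N"
proof -
  have "x = 0" if "g *v x = 0" for x
    using assms[of x] that by (simp add: N_eq_0_iff)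
  then have "\<exists>h. h ** g = mat 1"
    by (simp add: matrix_left_invertible_ker)
  then show ?thesis using assms by (simp add: isometry_group_def invertible_left_inverse)
qed

lemma isometry_inverse:
  assumes "g \<in> isometry_group N"
  obtains h where "h \<in> isometry_group N" "g ** h = mat 1" "h ** g = mat 1"
proof -
  obtain h where h: "g ** h = mat 1" "h ** g = mat 1"
    using assms by (auto simp: isometry_group_def invertible_def)
  have "N (h *v x) = N x" for x
  proof -
    have "N (g *v (h *v x)) = N (h *v x)" using assms by (simp add: isometry_group_def)
    then show ?thesis by (simp add: matrix_vector_mul_assoc h)
  qed
  then show thesis using that h isometryI by blast
qed

lemma orthogonal_split_isometry:
  assumes "orthogonal_split (CARD('d)) f U" "vec.subspace U" "\<And>i. i \<in> {1..CARD('d)} \<Longrightarrow> m *v e i = f i"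
  shows "m \<in> isometry_group N"
proof (rule isometryI)
  fix x
  have "N ((\<Sum>i=1..CARD('d). coord e x i *s f i) + 0) = N ((\<Sum>i=1..CARD('d). coord e x i *s e i) + 0)"
    using assms(1)[unfolded orthogonal_split_def, rule_format, of 0 0 "coord e x"] vec.subspace_0[OF assms(2)]
    by (simp add: coord_zero)
  moreover have "m *v (\<Sum>i=1..CARD('d). coord e x i *s e i) = (\<Sum>i=1..CARD('d). coord e x i *s f i)"
    using assms(3) by (simp add: vec.sum vec.scale)
  ultimately show "N (m *v x) = N x" unfolding sum_coord[OF basis] by simp
qed

text \<open>At the last stage the matrices \<open>m\<close> and \<open>k\<close> taking
  \<open>e\<close> to \<open>f\<close> and to \<open>h\<close> are isometries with
  \<open>g ** m = k ** A\<close>; the right factor \<open>l\<close> is the inverse of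
  \<open>m\<close>.\<close>

theorem cartan_exists:
  assumes "invertible g"
  shows "\<exists>k A l a. cartan v N e g k A l a"
proof -
  have "x = 0" if "g *v x = 0" for x
    using invertible_nonzero[OF assms, of x] that by blast
  then have "\<exists>f h a U U' \<pi>. partial_cartan g (CARD('d)) f h a U U' \<pi>"
    by (rule partial_cartan_exists) simp_all
  then obtain f h a U U' \<pi> where pc: "partial_cartan g (CARD('d)) f h a U U' \<pi>"
    by (elim exE)
  obtain m where m: "\<forall>i\<in>{1..CARD('d)}. m *v e i = f i"
    using linear_with_values[OF basis] by blast
  obtain k where k: "\<forall>i\<in>{1..CARD('d)}. k *v e i = h i"
    using linear_with_values[OF basis] by blast
  obtain A where A: "\<forall>i\<in>{1..CARD('d)}. A *v e i = a i *s e i"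
    using linear_with_values[OF basis, of "\<lambda>i. a i *s e i"] by blast
  have m_iso: "m \<in> isometry_group N" and k_iso: "k \<in> isometry_group N"
    using pc m k orthogonal_split_isometry[of f U m] orthogonal_split_isometry[of h U' k]
    by (simp_all add: partial_cartan_def)
  obtain l where l: "l \<in> isometry_group N" "m ** l = mat 1"
    by (rule isometry_inverse[OF m_iso])
  have "g ** m = k ** A"
  proof (rule matrix_eq_on_basis[OF basis])
    fix i assume i: "i \<in> {1..CARD('d)}"
    then have "g *v f i = a i *s h i" using pc by (simp add: partial_cartan_def)
    then show "(g ** m) *v e i = (k ** A) *v e i"
      using i by (simp add: m k A vec.scale flip: matrix_vector_mul_assoc)
  qed
  then have "g ** m ** l = k ** A ** l" by simp
  then have "g = k ** A ** l" by (simp add: l(2) flip: matrix_mul_assoc)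
  then have "cartan v N e g k A l a"
    using l(1) k_iso A pc by (simp add: cartan_def partial_cartan_def)
  then show ?thesis by blast
qed

end

declare One_nat_def [simp del]

section \<open>Singular values on the projective linear group\<close>

lemma mat_mult_vector: "mat c *v x = c *s x"
  for x :: "'k::field ^ 'd::finite"
  by (simp add: vec_eq_iff mat_def matrix_vector_mult_def mult_delta_left)

lemma mat_mult_mat: "mat c ** mat b = (mat (c * b) :: 'k::field ^ 'd::finite ^ 'd)"
  by (simp add: matrix_eq mat_mult_vector vec.scale_scale flip: matrix_vector_mul_assoc)

lemma mat_mult_commute: "g ** mat c = mat c ** g"
  for g :: "'k::field ^ 'd::finite ^ 'd"
  by (simp add: matrix_eq mat_mult_vector vec.scale flip: matrix_vector_mul_assoc)

lemma invertible_mat: "c \<noteq> 0 \<Longrightarrow> invertible (mat c :: 'k::field ^ 'd::finite ^ 'd)"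
  unfolding invertible_def by (rule exI[of _ "mat (inverse c)"]) (simp add: mat_mult_mat)

lemma carrier_PGL: "X \<in> carrier PGL \<longleftrightarrow> (\<exists>g. invertible g \<and> X = {mat c ** g | c. c \<noteq> 0})"
  by (auto simp: PGL_def FactGroup_def RCOSETS_def r_coset_def GL_def scalar_matrices_def)

lemma mult_PGL: "X \<otimes>\<^bsub>PGL\<^esub> Y = {g ** h | g h. g \<in> X \<and> h \<in> Y}"
  by (auto simp: PGL_def FactGroup_def set_mult_def GL_def)

context normed_frame
begin

lemma coord_diagonal:
  assumes "\<And>i. i \<in> {1..CARD('d)} \<Longrightarrow> A *v e i = a i *s e i" "i \<in> {1..CARD('d)}"
  shows "coord e (A *v x) i = a i * coord e x i"
proof -
  have "A *v (\<Sum>j=1..CARD('d). coord e x j *s e j) = (\<Sum>j=1..CARD('d). (a j * coord e x j) *s e j)"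
    using assms(1) by (simp add: vec.sum vec.scale vec.scale_scale mult.commute)
  then show ?thesis using coord_comb[OF basis assms(2)] unfolding sum_coord[OF basis] by metis
qed

text \<open>Area is base times height, and an isometry preserves the base and carries the optimal
  height to an admissible one. This gives one inequality; the inverse isometry gives the
  other.\<close>

lemma wedge_isometry:
  assumes "g \<in> isometry_group N"
  shows "W (g *v x) (g *v y) = W x y"
proof -
  have le: "W (g *v x) (g *v y) \<le> W x y" if "g \<in> isometry_group N" for g x y
  proof (cases "x = 0")
    case False
    have Ng: "N (g *v x) = N x" for x using that by (simp add: isometry_group_def)
    obtain a where a: "W x y = N x * N (y - a *s x)" using wedge_proj[OF False] by blast
    have "W (g *v x) (g *v y) \<le> N (g *v x) * N (g *v y - a *s (g *v x))" by (rule wedge_le_diff)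
    also have "g *v y - a *s (g *v x) = g *v (y - a *s x)" by (simp add: vec.diff vec.scale)
    finally show ?thesis by (simp only: a Ng)
  next
    case True
    then show ?thesis using wedge_scale_left[of 0 0] by (simp add: vec.zero)
  qed
  obtain h where h: "h \<in> isometry_group N" "h ** g = mat 1"
    using isometry_inverse[OF assms] by metis
  have "W (h *v (g *v x)) (h *v (g *v y)) \<le> W (g *v x) (g *v y)" by (rule le[OF h(1)])
  then show ?thesis using le[OF assms, of x y] by (simp add: matrix_vector_mul_assoc h(2))
qed

lemma wedge_basis: "W (e 1) (e 2) = 1"
proof -
  have e: "1 \<in> {1..CARD('d)}" "2 \<in> {1..CARD('d)}" using dim_ge_2 by auto
  obtain a where a: "W (e 1) (e 2) = N (e 1) * N (e 2 - a *s e 1)"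
    using wedge_proj[OF basis_nonzero[OF e(1)]] by blast
  have "coord e (e 2 - a *s e 1) 2 = 1"
    using e by (simp add: coord_diff coord_scale basis coord_basis)
  then have "1 \<le> N (e 2 - a *s e 1)" using coord_le[OF e(2), of "e 2 - a *s e 1"] by simp
  then show ?thesis using a wedge_le[of "e 1" "e 2"] by (simp add: N_basis[OF e(1)] N_basis[OF e(2)])
qed

section \<open>Growth of lengths and areas under a matrix with a given Cartan decomposition\<close>

context
  fixes g k A l a
  assumes cartan: "cartan v N e g k A l a"
begin

lemma cartan_g: "g = k ** A ** l" and cartan_k: "k \<in> isometry_group N"
  and cartan_l: "l \<in> isometry_group N"
  and cartan_A: "\<And>i. i \<in> {1..CARD('d)} \<Longrightarrow> A *v e i = a i *s e i"
  and cartan_decreasing: "\<And>i j. \<lbrakk>1 \<le> i; i \<le> j; j \<le> CARD('d)\<rbrakk> \<Longrightarrow> v (a j) \<le> v (a i)"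
  using cartan by (auto simp: cartan_def)

lemma cartan_coord: "i \<in> {1..CARD('d)} \<Longrightarrow> coord e (A *v x) i = a i * coord e x i"
  by (rule coord_diagonal[OF cartan_A])

lemma cartan_apply: "g *v x = k *v (A *v (l *v x))"
  by (simp add: cartan_g matrix_vector_mul_assoc matrix_mul_assoc)

lemma cartan_N: "N (k *v x) = N x" "N (l *v x) = N x"
  using cartan_k cartan_l by (simp_all add: isometry_group_def)

lemma cartan_l_inverse:
  obtains j where "\<And>x. l *v (j *v x) = x" "\<And>x. N (j *v x) = N x" "\<And>x y. W (j *v x) (j *v y) = W x y"
proof -
  obtain j where j: "j \<in> isometry_group N" "l ** j = mat 1"
    using isometry_inverse[OF cartan_l] by metis
  show thesis
    by (rule that[of j]) (use j in \<open>simp_all add: matrix_vector_mul_assoc wedge_isometry isometry_group_def\<close>)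
qed

lemma cartan_N_le: "N (g *v x) \<le> v (a 1) * N x"
proof -
  have "N (A *v (l *v x)) \<le> v (a 1) * N (l *v x)"
    using cartan_decreasing by (intro N_mono) (auto simp: v_nonneg cartan_coord v_mult intro: mult_right_mono)
  then show ?thesis by (simp add: cartan_apply cartan_N)
qed

lemma cartan_N_attained: obtains x where "N x = 1" "g *v x = a 1 *s (k *v e 1)"
proof -
  obtain j where j: "\<And>x. l *v (j *v x) = x" "\<And>x. N (j *v x) = N x"
    using cartan_l_inverse by metis
  have "g *v (j *v e 1) = a 1 *s (k *v e 1)" using dim_ge_2 by (simp add: cartan_apply j cartan_A vec.scale)
  then show thesis using that[of "j *v e 1"] dim_ge_2 by (simp add: j N_basis)
qed

text \<open>A diagonal matrix multiplies the minor with indices \<open>i < j\<close> by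
  \<open>a i * a j\<close>, and the largest of these factors belongs to the pair 1, 2. With
  \<open>cartan_wedge_attained\<close>, the product of the first two singular values becomes the
  exact norm on areas.\<close>

lemma cartan_wedge_le: "W (g *v x) (g *v y) \<le> v (a 1) * v (a 2) * W x y"
proof -
  have "W (A *v (l *v x)) (A *v (l *v y)) \<le> v (a 1) * v (a 2) * W (l *v x) (l *v y)"
  proof (rule wedge_mono)
    fix i j assume ij: "1 \<le> i" "i < j" "j \<le> CARD('d)"
    let ?x = "l *v x" and ?y = "l *v y"
    have "coord e (A *v ?x) i * coord e (A *v ?y) j - coord e (A *v ?x) j * coord e (A *v ?y) i
        = a i * a j * (coord e ?x i * coord e ?y j - coord e ?x j * coord e ?y i)"
      using ij by (simp add: cartan_coord algebra_simps)
    moreover have "v (a i) * v (a j) \<le> v (a 1) * v (a 2)"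
      using ij cartan_decreasing[of 1 i] cartan_decreasing[of 2 j] by (intro mult_mono) (auto simp: v_nonneg)
    ultimately show "v (coord e (A *v ?x) i * coord e (A *v ?y) j - coord e (A *v ?x) j * coord e (A *v ?y) i)
        \<le> v (a 1) * v (a 2) * v (coord e ?x i * coord e ?y j - coord e ?x j * coord e ?y i)"
      by (auto simp: v_mult v_nonneg intro: mult_right_mono)
  qed (simp add: v_nonneg)
  then show ?thesis by (simp add: cartan_apply wedge_isometry cartan_k cartan_l)
qed

lemma cartan_wedge_attained: obtains x y where "W x y = 1" "W (g *v x) (g *v y) = v (a 1) * v (a 2)"
proof -
  obtain j where j: "\<And>x. l *v (j *v x) = x" "\<And>x y. W (j *v x) (j *v y) = W x y"
    using cartan_l_inverse by metis
  have "W (g *v (j *v e 1)) (g *v (j *v e 2)) = v (a 1) * v (a 2)" using dim_ge_2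
    by (simp add: cartan_apply j cartan_A wedge_isometry[OF cartan_k] wedge_scale_left wedge_scale_right wedge_basis[simplified])
  then show thesis using that[of "j *v e 1" "j *v e 2"] by (simp add: j wedge_basis[simplified])
qed

lemma cartan_scale:
  assumes "c \<noteq> 0"
  shows "cartan v N e (mat c ** g) k (mat c ** A) l (\<lambda>i. c * a i)"
  using cartan unfolding cartan_def
  by (auto simp: v_mult v_nonneg mat_mult_commute[of k] matrix_mul_assoc mat_mult_vector vec.scale_scale
      intro: mult_left_mono simp flip: matrix_vector_mul_assoc)

lemma cartan_k_nonzero: "k *v e 1 \<noteq> 0"
  using dim_ge_2 N_basis[of 1] N_eq_0_iff[of "k *v e 1"] by (simp add: cartan_N)

end

text \<open>\<open>v (a 1)\<close> is the operator norm of \<open>g\<close> on vectors and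
  \<open>v (a 1) * v (a 2)\<close> the one on areas, and neither refers to a decomposition.
  Concretely, a vector or pair that attains the value for one decomposition is tested against the
  upper bound of the other.\<close>

lemma cartan_unique:
  assumes "cartan v N e g k A l a" "cartan v N e g k' A' l' a'" "invertible g"
  shows "v (a 1) = v (a' 1)" "v (a 2) = v (a' 2)" "0 < v (a 1)"
proof -
  have le: "v (a 1) \<le> v (a' 1) \<and> v (a 1) * v (a 2) \<le> v (a' 1) * v (a' 2) \<and> 0 < v (a 1)"
    if 1: "cartan v N e g k A l a" and 2: "cartan v N e g k' A' l' a'" for k A l a k' A' l' a'
  proof -
    obtain x where x: "N x = 1" "g *v x = a 1 *s (k *v e 1)" using cartan_N_attained[OF 1] by blast
    then have Ngx: "N (g *v x) = v (a 1)"
      using dim_ge_2 N_basis[of 1] by (simp add: N_scale cartan_N[OF 1])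
    have "g *v x \<noteq> 0" using x(1) assms(3) by (intro invertible_nonzero) auto
    then have "0 < v (a 1)" using N_pos Ngx by metis
    moreover have "v (a 1) \<le> v (a' 1)" using cartan_N_le[OF 2, of x] x(1) Ngx by simp
    moreover obtain y z where "W y z = 1" "W (g *v y) (g *v z) = v (a 1) * v (a 2)"
      using cartan_wedge_attained[OF 1] by blast
    ultimately show ?thesis using cartan_wedge_le[OF 2, of y z] by simp
  qed
  from le[OF assms(1,2)] le[OF assms(2,1)]
  show "v (a 1) = v (a' 1)" "v (a 2) = v (a' 2)" "0 < v (a 1)" by auto
qed

lemma singular_value_eq:
  assumes "cartan v N e g k A l a" "invertible g"
  shows "singular_value v N e 1 g = v (a 1)" "singular_value v N e 2 g = v (a 2)"
proof -
  note unique = cartan_unique[OF assms(1) _ assms(2)]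
  show "singular_value v N e 1 g = v (a 1)"
    unfolding singular_value_def
  proof (rule the_equality)
    show "\<exists>k A l b. cartan v N e g k A l b \<and> v (a 1) = v (b 1)" using assms(1) by blast
  qed (use unique(1) in metis)
  show "singular_value v N e 2 g = v (a 2)"
    unfolding singular_value_def
  proof (rule the_equality)
    show "\<exists>k A l b. cartan v N e g k A l b \<and> v (a 2) = v (b 2)" using assms(1) by blast
  qed (use unique(2) in metis)
qed

lemma sv_ratio_eq:
  assumes X: "X \<in> carrier PGL" "g \<in> X" and g: "cartan v N e g k A l a"
  shows "sv_ratio v N e X = v (a 2) / v (a 1)"
  unfolding sv_ratio_def
proof (rule the_equality)
  obtain g0 where g0: "invertible g0" "X = {mat c ** g0 | c. c \<noteq> 0}" using X by (auto simp: carrier_PGL)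
  then obtain c where c: "c \<noteq> 0" "g = mat c ** g0" using X by auto
  then have inv: "invertible g" using g0 by (simp add: invertible_mult invertible_mat)
  then show "\<exists>g\<in>X. v (a 2) / v (a 1) = singular_value v N e 2 g / singular_value v N e 1 g"
    using X(2) singular_value_eq[OF g] by metis
  fix r assume "\<exists>g\<in>X. r = singular_value v N e 2 g / singular_value v N e 1 g"
  then obtain b where b: "b \<noteq> 0"
    and r: "r = singular_value v N e 2 (mat b ** g0) / singular_value v N e 1 (mat b ** g0)"
    using g0 by auto
  have bc: "b / c \<noteq> 0" using b c by simp
  have "mat b ** g0 = mat (b / c) ** g"
    using c by (simp add: matrix_mul_assoc mat_mult_mat)
  moreover have "invertible (mat (b / c) ** g)" using bc inv by (simp add: invertible_mult invertible_mat)
  ultimately have "r = v (b / c * a 2) / v (b / c * a 1)"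
    using r by (simp only: singular_value_eq[OF cartan_scale[OF g bc]])
  then show "r = v (a 2) / v (a 1)" using v_pos[OF bc] unfolding v_mult by simp
qed

lemma PGL_cartan:
  assumes "X \<in> carrier PGL"
  obtains g k A l a where "g \<in> X" "invertible g" "cartan v N e g k A l a"
    "X = {mat c ** g | c. c \<noteq> 0}"
proof -
  obtain g where g: "invertible g" "X = {mat c ** g | c. c \<noteq> 0}" using assms by (auto simp: carrier_PGL)
  have "g \<in> X" unfolding g(2) by (rule CollectI, rule exI[of _ 1]) simp
  moreover obtain k A l a where "cartan v N e g k A l a" using cartan_exists[OF g(1)] by blast
  ultimately show thesis using that g by blast
qed

text \<open>These are the conditions on the weights in \<open>hausdorff_dim_limsup\<close>:
  positivity for the powers, and the bound by 1 so that raising the exponent preserves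
  summability.\<close>

lemma sv_ratio_bounds:
  assumes "X \<in> carrier PGL"
  shows "0 < sv_ratio v N e X" "sv_ratio v N e X \<le> 1"
proof -
  obtain g k A l a where g: "g \<in> X" "invertible g" "cartan v N e g k A l a"
    using PGL_cartan[OF assms] by metis
  have a1: "0 < v (a 1)" using cartan_unique(3)[OF g(3,3,2)] .
  have "v (a 2) \<noteq> 0"
  proof
    assume a2: "v (a 2) = 0"
    obtain j where j: "\<And>x. l *v (j *v x) = x" "\<And>x. N (j *v x) = N x"
      using cartan_l_inverse[OF g(3)] by metis
    have "g *v (j *v e 2) = 0"
      using dim_ge_2 a2 by (simp add: cartan_apply[OF g(3)] j cartan_A[OF g(3)] v_eq_0_iff vec.zero)
    moreover have "j *v e 2 \<noteq> 0" using j(2)[of "e 2"] dim_ge_2 by (auto simp: N_basis)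
    ultimately show False using invertible_nonzero[OF g(2)] by blast
  qed
  then have "0 < v (a 2)" using v_nonneg[of "a 2"] by simp
  then show "0 < sv_ratio v N e X" "sv_ratio v N e X \<le> 1"
    using a1 cartan_decreasing[OF g(3), of 1 2] dim_ge_2 by (simp_all add: sv_ratio_eq[OF assms g(1,3)])
qed

section \<open>Attracting lines\<close>

lemma N_bounded: obtains C where "0 \<le> C" "\<And>x. N (g *v x) \<le> C * N x"
proof
  show "0 \<le> (\<Sum>i=1..CARD('d). N (g *v e i))" by (simp add: sum_nonneg N_nonneg)
  fix x
  have "N (g *v (\<Sum>i=1..CARD('d). coord e x i *s e i)) \<le> (\<Sum>i=1..CARD('d). N (coord e x i *s (g *v e i)))"
    by (simp add: vec.sum vec.scale N_sum_le del: sum.cong)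
  also have "\<dots> \<le> (\<Sum>i=1..CARD('d). N x * N (g *v e i))"
    using coord_le by (intro sum_mono) (auto simp: N_scale N_nonneg intro: mult_right_mono)
  finally show "N (g *v x) \<le> (\<Sum>i=1..CARD('d). N (g *v e i)) * N x"
    unfolding sum_coord[OF basis] by (simp add: sum_distrib_left mult.commute)
qed

text \<open>Take a unit vector \<open>u\<close> that \<open>g' = g ** h\<close> stretches most, so
  that \<open>g *v w\<close> with \<open>w = h *v u\<close> spans the attracting line of
  \<open>g'\<close>. Its part off the attracting line of \<open>g\<close> is at most
  \<open>v (a 2) * C\<close>, while its length \<open>v (a' 1)\<close> is at least
  \<open>v (a 1) / C'\<close> when \<open>C'\<close> is positive. The quotient of the two bounds the
  distance.\<close>

lemma attracting_line_mult:
  assumes g: "cartan v N e g k A l a" "invertible g"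
    and g': "cartan v N e g' k' A' l' a'" "g' = g ** h"
    and h: "h ** h' = mat 1" "0 \<le> C" "0 \<le> C'"
      "\<And>x. N (h *v x) \<le> C * N x" "\<And>x. N (h' *v x) \<le> C' * N x"
  shows "dist_vec (k *v e 1) (k' *v e 1) \<le> C * C' * (v (a 2) / v (a 1))"
proof -
  have e1: "1 \<in> {1..CARD('d)}" using dim_ge_2 by simp
  obtain u where u: "N u = 1" "g' *v u = a' 1 *s (k' *v e 1)" using cartan_N_attained[OF g'(1)] by blast
  define w where "w = h *v u"
  define y where "y = l *v w"
  \<comment> \<open>\<open>A *v y\<close> without its first component: only the entries
    \<open>a i\<close> with \<open>2 \<le> i\<close> act on it.\<close>
  define z where "z = A *v y - (a 1 * coord e y 1) *s e 1"
  have gw: "g *v w = a' 1 *s (k' *v e 1)"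
    using u(2) by (simp add: w_def g'(2) matrix_vector_mul_assoc)
  have a1: "0 < v (a 1)" using cartan_unique(3)[OF g(1,1,2)] .
  obtain x where x: "N x = 1" "g *v x = a 1 *s (k *v e 1)" using cartan_N_attained[OF g(1)] by blast
  \<comment> \<open>The vector that \<open>g\<close> stretches most, moved by \<open>h'\<close>,
    shows that passing from \<open>g\<close> to \<open>g'\<close> lowers the first singular value by
    at most the factor \<open>C'\<close>.\<close>
  have "g *v x = g' *v (h' *v x)"
    by (simp add: g'(2) matrix_vector_mul_assoc h(1) flip: matrix_mul_assoc)
  moreover have "N (g *v x) = v (a 1)"
    using e1 unfolding x(2) by (simp add: N_scale cartan_N[OF g(1)] N_basis)
  ultimately have "v (a 1) = N (g' *v (h' *v x))" by simp
  also have "\<dots> \<le> v (a' 1) * N (h' *v x)" by (rule cartan_N_le[OF g'(1)])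
  also have "\<dots> \<le> v (a' 1) * C'" using h(5)[of x] x(1) by (simp add: v_nonneg mult_left_mono)
  finally have a1_le: "v (a 1) \<le> v (a' 1) * C'" .
  then have a'1: "a' 1 \<noteq> 0" using a1 by auto
  have "N z \<le> v (a 2) * N y"
  proof (rule N_mono)
    fix i assume i: "i \<in> {1..CARD('d)}"
    show "v (coord e z i) \<le> v (a 2) * v (coord e y i)"
    proof (cases "i = 1")
      case True
      then show ?thesis using i
        by (simp add: z_def coord_diff coord_scale basis coord_basis cartan_coord[OF g(1)] v_nonneg)
    next
      case False
      then have "coord e z i = a i * coord e y i" using i e1
        by (simp add: z_def coord_diff coord_scale basis coord_basis cartan_coord[OF g(1)])
      moreover have "v (a i) \<le> v (a 2)" using i False by (intro cartan_decreasing[OF g(1)]) auto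
      ultimately show ?thesis by (simp add: v_mult v_nonneg mult_right_mono)
    qed
  qed (simp add: v_nonneg)
  also have "N y \<le> C" using h(4)[of u] u(1) by (simp add: y_def w_def cartan_N[OF g(1)])
  finally have Nz: "N z \<le> v (a 2) * C" by (simp add: v_nonneg mult_left_mono)
  have "g *v w - (a 1 * coord e y 1) *s (k *v e 1) = k *v z"
    by (simp add: cartan_apply[OF g(1)] z_def y_def vec.diff vec.scale)
  then have "dist_vec (k *v e 1) (g *v w) * N (g *v w) \<le> N z"
    using dist_vec_le[OF cartan_k_nonzero[OF g(1)], of "g *v w" "a 1 * coord e y 1"] a'1
      cartan_k_nonzero[OF g'(1)] by (simp add: gw cartan_N[OF g(1)])
  moreover have "N (g *v w) = v (a' 1)" using e1 by (simp add: gw N_scale cartan_N[OF g'(1)] N_basis)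
  moreover have "dist_vec (k *v e 1) (g *v w) = dist_vec (k *v e 1) (k' *v e 1)"
    unfolding gw by (rule dist_vec_scale_right[OF a'1])
  ultimately have d: "dist_vec (k *v e 1) (k' *v e 1) * v (a' 1) \<le> v (a 2) * C" using Nz by simp
  have "dist_vec (k *v e 1) (k' *v e 1) * v (a 1) \<le> dist_vec (k *v e 1) (k' *v e 1) * (v (a' 1) * C')"
    using a1_le dist_vec_nonneg by (rule mult_left_mono)
  also have "\<dots> \<le> (v (a 2) * C) * C'" using mult_right_mono[OF d h(3)] by (simp add: mult.assoc)
  finally show ?thesis using a1 by (simp add: field_simps)
qed

lemma proj_dist_span:
  assumes "x \<noteq> 0" "y \<noteq> 0"
  shows "proj_dist v N e (vec.span {x}) (vec.span {y}) = dist_vec x y"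
  unfolding proj_dist_def
proof (rule the_equality)
  show "\<exists>x'\<in>vec.span {x} - {0}. \<exists>y'\<in>vec.span {y} - {0}. dist_vec x y = W x' y' / (N x' * N y')"
    using assms vec.span_base[of x "{x}"] vec.span_base[of y "{y}"] by (auto simp: dist_vec_def)
  fix r assume "\<exists>x'\<in>vec.span {x} - {0}. \<exists>y'\<in>vec.span {y} - {0}. r = W x' y' / (N x' * N y')"
  then obtain x' y' where xy: "x' \<in> vec.span {x}" "x' \<noteq> 0" "y' \<in> vec.span {y}" "y' \<noteq> 0"
    and r: "r = dist_vec x' y'" unfolding dist_vec_def by blast
  obtain b c where "x' = b *s x" "y' = c *s y" using xy by (auto simp: vec.span_singleton)
  moreover from this have "b \<noteq> 0" "c \<noteq> 0" using xy by auto
  ultimately show "r = dist_vec x y" by (simp add: r dist_vec_scale_left dist_vec_scale_right)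
qed

lemma U1_iff:
  "L \<in> U1 v N e X \<longleftrightarrow> (\<exists>g\<in>X. \<exists>k A l a. cartan v N e g k A l a \<and> L = vec.span {k *v e 1})"
proof -
  have eq: "(\<lambda>y. k *v y) ` vec.span {e 1} = vec.span {k *v e 1}" for k
    using vec.linear_span_image[OF matrix_vector_mul_linear_gen, of k "{e 1}"] by simp
  show ?thesis unfolding U1_def mem_Collect_eq eq by (intro iffI; elim exE bexE conjE; blast)
qed

lemma U1_nonempty:
  assumes "X \<in> carrier PGL"
  shows "U1 v N e X \<noteq> {}"
proof -
  obtain g k A l a where "g \<in> X" "cartan v N e g k A l a" using PGL_cartan[OF assms] by metis
  then have "vec.span {k *v e 1} \<in> U1 v N e X" unfolding U1_iff by blast
  then show ?thesis by blast
qed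

lemma U1_proj_space: "L \<in> U1 v N e X \<Longrightarrow> L \<in> proj_space"
  using cartan_k_nonzero by (force simp: U1_iff proj_space_def)

text \<open>The constant is a product of bounds for a representative of \<open>H\<close> and for its
  inverse. Both are chosen before \<open>X\<close>, so one constant serves for all points of all
  rays.\<close>

lemma U1_mult:
  assumes H: "H \<in> carrier PGL"
  obtains C where "0 \<le> C" "\<And>X L L'. \<lbrakk>X \<in> carrier PGL; L \<in> U1 v N e X; L' \<in> U1 v N e (X \<otimes>\<^bsub>PGL\<^esub> H)\<rbrakk>
    \<Longrightarrow> proj_dist v N e L L' \<le> C * sv_ratio v N e X"
proof -
  obtain h where h: "invertible h" "H = {mat c ** h | c. c \<noteq> 0}" using H by (auto simp: carrier_PGL)
  then obtain h' where h': "h ** h' = mat 1" by (auto simp: invertible_def)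
  obtain C where C: "0 \<le> C" "\<And>x. N (h *v x) \<le> C * N x" using N_bounded by blast
  obtain C' where C': "0 \<le> C'" "\<And>x. N (h' *v x) \<le> C' * N x" using N_bounded by blast
  show thesis
  proof (rule that[of "C * C'"])
    show "0 \<le> C * C'" using C C' by simp
    fix X L L' assume X: "X \<in> carrier PGL" and L: "L \<in> U1 v N e X" "L' \<in> U1 v N e (X \<otimes>\<^bsub>PGL\<^esub> H)"
    obtain g k A l a where g: "g \<in> X" "cartan v N e g k A l a" "L = vec.span {k *v e 1}"
      using L by (auto simp: U1_iff)
    obtain g' k' A' l' a' where g': "g' \<in> X \<otimes>\<^bsub>PGL\<^esub> H" "cartan v N e g' k' A' l' a'"
      "L' = vec.span {k' *v e 1}" using L by (auto simp: U1_iff)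
    obtain g0 where g0: "invertible g0" "X = {mat c ** g0 | c. c \<noteq> 0}" using X by (auto simp: carrier_PGL)
    obtain b where b: "b \<noteq> 0" "g = mat b ** g0" using g(1) g0 by auto
    obtain c1 c2 where c: "c1 \<noteq> 0" "c2 \<noteq> 0" "g' = (mat c1 ** g0) ** (mat c2 ** h)"
      using g'(1) g0 h by (auto simp: mult_PGL)
    \<comment> \<open>Representatives in the projective group agree only up to scalars;
      \<open>c\<close> collects the scalars of the representatives involved into the left factor
      \<open>g\<close>, whose attracting line and singular value ratio do not change.\<close>
    define c where "c = c1 * c2 / b"
    have c0: "c \<noteq> 0" using b c by (simp add: c_def)
    have "g' = (mat c1 ** (g0 ** mat c2)) ** h" by (simp add: c(3) matrix_mul_assoc)
    also have "mat c1 ** (g0 ** mat c2) = mat (c1 * c2) ** g0"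
      unfolding mat_mult_commute[of g0] by (simp add: matrix_mul_assoc mat_mult_mat)
    also have "mat (c1 * c2) ** g0 = mat c ** g"
      using b by (simp add: matrix_mul_assoc mat_mult_mat c_def)
    finally have g'_eq: "g' = (mat c ** g) ** h" .
    have inv: "invertible (mat c ** g)"
      using c0 b g0 by (simp add: invertible_mult invertible_mat)
    have "dist_vec (k *v e 1) (k' *v e 1) \<le> C * C' * (v (c * a 2) / v (c * a 1))"
      by (rule attracting_line_mult[OF cartan_scale[OF g(2) c0] inv g'(2) g'_eq h' C(1) C'(1) C(2) C'(2)])
    moreover have "v (c * a 2) / v (c * a 1) = sv_ratio v N e X"
      using v_pos[OF c0] by (simp add: v_mult sv_ratio_eq[OF X g(1,2)])
    ultimately show "proj_dist v N e L L' \<le> C * C' * sv_ratio v N e X"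
      by (simp only: g(3) g'(3) proj_dist_span[OF cartan_k_nonzero[OF g(2)] cartan_k_nonzero[OF g'(2)]])
  qed
qed

section \<open>Projective space as a complete metric space\<close>

lemma proj_dist_nonneg: "L \<in> proj_space \<Longrightarrow> L' \<in> proj_space \<Longrightarrow> 0 \<le> proj_dist v N e L L'"
  by (auto simp: proj_space_def proj_dist_span dist_vec_nonneg)

lemma proj_dist_commute:
  "L \<in> proj_space \<Longrightarrow> L' \<in> proj_space \<Longrightarrow> proj_dist v N e L L' = proj_dist v N e L' L"
  by (auto simp: proj_space_def proj_dist_span intro: dist_vec_commute)

lemma proj_dist_triangle:
  "\<lbrakk>L \<in> proj_space; L' \<in> proj_space; L'' \<in> proj_space\<rbrakk>
    \<Longrightarrow> proj_dist v N e L L'' \<le> proj_dist v N e L L' + proj_dist v N e L' L''"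
  by (auto simp: proj_space_def proj_dist_span intro!: dist_vec_triangle)

lemma proj_dist_eq_0: "\<lbrakk>L \<in> proj_space; L' \<in> proj_space; proj_dist v N e L L' = 0\<rbrakk> \<Longrightarrow> L = L'"
  using dist_vec_eq_0 proj_dist_span unfolding proj_space_def by auto

end

section \<open>Completeness: limits of sequences of lines with summable steps\<close>

context normed_frame
begin

lemma line_eq_span:
  assumes "L \<in> proj_space" "y \<in> L" "y \<noteq> 0"
  shows "L = vec.span {y}"
proof -
  obtain x where L: "L = vec.span {x}" using assms(1) by (auto simp: proj_space_def)
  then obtain c where y: "y = c *s x" using assms(2) by (auto simp: vec.span_singleton)
  then have "c \<noteq> 0" using assms(3) by auto
  then show ?thesis unfolding L y by (rule span_scale[symmetric])
qed

text \<open>The lines are lifted to vectors one after another, each lift being a closest multiple to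
  the previous one in the next line. The lifts never grow, so their steps are summable and they
  converge; what has to be excluded is that the limit is 0.\<close>

lemma proj_complete:
  assumes L: "\<And>n. L n \<in> proj_space" and b: "\<And>n. proj_dist v N e (L n) (L (Suc n)) \<le> b n" "summable b"
  shows "\<exists>p\<in>proj_space. (\<lambda>n. proj_dist v N e (L n) p) \<longlonglongrightarrow> 0"
proof -
  have b_nonneg: "0 \<le> b n" for n using proj_dist_nonneg[OF L L] b(1) order_trans by blast
  \<comment> \<open>Starting late enough to have total step size below 1/2 serves twice: each step
    is below 1, so the next lift is nonzero, and the total displacement cannot use up the length of
    the first lift.\<close>
  obtain n0 where n0: "\<And>n. n \<ge> n0 \<Longrightarrow> norm (\<Sum>i. b (i + n)) < 1 / 2"
    using suminf_exist_split[of "1/2" b] b(2) by auto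
  define \<beta> where "\<beta> i = b (i + n0)" for i
  have \<beta>: "summable \<beta>" "\<And>i. 0 \<le> \<beta> i" "suminf \<beta> < 1 / 2"
    using b(2) n0[of n0] b_nonneg by (auto simp: \<beta>_def[abs_def])
  have \<beta>_le: "sum \<beta> I \<le> suminf \<beta>" if "finite I" for I
    using sum_le_suminf[OF \<beta>(1) that] \<beta>(2) by simp
  define P where "P n y \<longleftrightarrow> y \<in> L (n + n0) \<and> y \<noteq> 0" for n y
  have "\<exists>y. \<forall>n. P n (y n) \<and> N (y n - y (Suc n)) \<le> \<beta> n * N (y n) \<and> N (y (Suc n)) \<le> N (y n)"
  proof (rule dependent_nat_choice)
    obtain x where "x \<noteq> 0" "L n0 = vec.span {x}" using L[of n0] by (auto simp: proj_space_def)
    then show "\<exists>y. P 0 y" using vec.span_base[of x "{x}"] by (auto simp: P_def)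
    fix y n assume y: "P n y"
    obtain x where x: "x \<noteq> 0" "L (Suc n + n0) = vec.span {x}" using L by (auto simp: proj_space_def)
    have Ly: "L (n + n0) = vec.span {y}" using y line_eq_span[OF L] by (simp add: P_def)
    have y0: "y \<noteq> 0" using y by (simp add: P_def)
    obtain a where a: "N (y - a *s x) = dist_vec x y * N y" "N (a *s x) \<le> N y"
      using dist_vec_attained[OF x(1) y0] by blast
    have "dist_vec x y \<le> \<beta> n"
      using b(1)[of "n + n0"] x Ly y0 by (simp add: \<beta>_def proj_dist_span dist_vec_commute)
    then have le: "N (y - a *s x) \<le> \<beta> n * N y" unfolding a(1) using N_nonneg by (rule mult_right_mono)
    have "\<beta> n < 1" using \<beta>_le[of "{n}"] \<beta>(3) by simp
    then have "\<beta> n * N y < N y" using N_pos[OF y0] by simp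
    then have "a *s x \<noteq> 0" using le by auto
    moreover have "a *s x \<in> L (Suc n + n0)" unfolding x(2) by (simp add: vec.span_scale vec.span_base)
    ultimately show "\<exists>y'. P (Suc n) y' \<and> N (y - y') \<le> \<beta> n * N y \<and> N y' \<le> N y"
      using le a(2) by (auto simp: P_def)
  qed
  then obtain y where y: "\<And>n. P n (y n)" "\<And>n. N (y n - y (Suc n)) \<le> \<beta> n * N (y n)"
    "\<And>n. N (y (Suc n)) \<le> N (y n)" by blast
  define K where "K = N (y 0)"
  have K: "0 < K" using y(1)[of 0] by (simp add: K_def P_def N_pos)
  have "N (y n) \<le> K" for n
    by (induction n) (use y(3) order_trans in \<open>auto simp: K_def\<close>)
  then have step: "N (y n - y (Suc n)) \<le> \<beta> n * K" for n
    using y(2)[of n] \<beta>(2) mult_left_mono order_trans by blast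
  have tele: "N (y m - y n) \<le> K * sum \<beta> {m..<n}" if "m \<le> n" for m n
    using that
  proof (induction n rule: dec_induct)
    case (step n)
    have "N (y m - y (Suc n)) \<le> N (y m - y n) + N (y n - y (Suc n))"
      using N_triangle[of "y m - y n" "y n - y (Suc n)"] by simp
    then show ?case using step \<open>\<And>n. N (y n - y (Suc n)) \<le> \<beta> n * K\<close>[of n] by (simp add: algebra_simps)
  qed simp
  have "\<forall>\<epsilon>>0. \<exists>M. \<forall>m\<ge>M. \<forall>n\<ge>M. N (y m - y n) < \<epsilon>"
  proof (intro allI impI)
    fix \<epsilon> :: real assume "0 < \<epsilon>"
    then have "0 < \<epsilon> / K" using K by simp
    then obtain M where M: "\<And>m n. m \<ge> M \<Longrightarrow> norm (sum \<beta> {m..<n}) < \<epsilon> / K"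
      using \<beta>(1) unfolding summable_Cauchy by blast
    have le: "N (y m - y n) < \<epsilon>" if "M \<le> m" "m \<le> n" for m n
    proof -
      have "sum \<beta> {m..<n} < \<epsilon> / K" using M[OF that(1), of n] by simp
      then have "K * sum \<beta> {m..<n} < \<epsilon>" using K by (simp add: field_simps)
      then show ?thesis using tele[OF that(2)] by simp
    qed
    then have "N (y m - y n) < \<epsilon>" if "M \<le> m" "M \<le> n" for m n
      using that N_diff_commute[of "y m" "y n"] by (metis nat_le_linear)
    then show "\<exists>M. \<forall>m\<ge>M. \<forall>n\<ge>M. N (y m - y n) < \<epsilon>" by blast
  qed
  then obtain z where z: "(\<lambda>n. N (y n - z)) \<longlonglongrightarrow> 0" using N_complete by blast
  have "z \<noteq> 0"
  proof
    assume "z = 0"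
    \<comment> \<open>The total loss of length is less than half of the initial length
      \<open>K\<close>, so the lengths cannot tend to 0.\<close>
    have "K - N (y n) \<le> K * suminf \<beta>" for n
    proof -
      have "K - N (y n) \<le> N (y 0 - y n)"
        using N_triangle[of "y 0 - y n" "y n"] by (simp add: K_def)
      also have "\<dots> \<le> K * suminf \<beta>" using tele[of 0 n] \<beta>_le[of "{0..<n}"] K
        by (meson finite_atLeastLessThan le0 less_imp_le mult_left_mono order_trans)
      finally show ?thesis .
    qed
    moreover have "(\<lambda>n. K - N (y n)) \<longlonglongrightarrow> K - 0"
      using z \<open>z = 0\<close> by (intro tendsto_diff tendsto_const) simp
    ultimately have "K - 0 \<le> K * suminf \<beta>" by (intro LIMSEQ_le_const2) auto
    then show False using K \<beta>(3) by (simp add: field_simps)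
  qed
  have le: "proj_dist v N e (L (n + n0)) (vec.span {z}) \<le> N (y n - z) / N z" for n
  proof -
    have "L (n + n0) = vec.span {y n}" "y n \<noteq> 0"
      using y(1)[of n] line_eq_span[OF L] by (simp_all add: P_def)
    moreover have "dist_vec (y n) z * N z \<le> N (z - 1 *s y n)"
      using \<open>y n \<noteq> 0\<close> \<open>z \<noteq> 0\<close> by (rule dist_vec_le)
    ultimately show ?thesis using N_pos[OF \<open>z \<noteq> 0\<close>]
      by (simp add: proj_dist_span \<open>z \<noteq> 0\<close> N_diff_commute[of z] field_simps)
  qed
  have zP: "vec.span {z} \<in> proj_space" using \<open>z \<noteq> 0\<close> by (auto simp: proj_space_def)
  have "(\<lambda>n. N (y n - z) / N z) \<longlonglongrightarrow> 0" using tendsto_divide[OF z tendsto_const, of "N z"] \<open>z \<noteq> 0\<close>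
    by (simp add: N_eq_0_iff)
  then have "(\<lambda>n. proj_dist v N e (L (n + n0)) (vec.span {z})) \<longlonglongrightarrow> 0"
    by (rule null_squeeze[OF _ proj_dist_nonneg[OF L zP] le])
  then have "(\<lambda>n. proj_dist v N e (L n) (vec.span {z})) \<longlonglongrightarrow> 0" by (rule LIMSEQ_offset)
  then show ?thesis using zP by blast
qed

lemma proj_dist_limit_le:
  assumes L: "\<And>n. L n \<in> proj_space" and b: "\<And>n. proj_dist v N e (L n) (L (Suc n)) \<le> b n" "summable b"
    and p: "p \<in> proj_space" "(\<lambda>n. proj_dist v N e (L n) p) \<longlonglongrightarrow> 0"
  shows "proj_dist v N e (L 0) p \<le> suminf b"
proof -
  have b_nonneg: "0 \<le> b n" for n using proj_dist_nonneg[OF L L] b(1) order_trans by blast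
  have tele: "proj_dist v N e (L 0) p \<le> sum b {..<n} + proj_dist v N e (L n) p" for n
  proof (induction n)
    case (Suc n)
    have "proj_dist v N e (L n) p \<le> b n + proj_dist v N e (L (Suc n)) p"
      using proj_dist_triangle[OF L L p(1), of n "Suc n"] b(1)[of n] by linarith
    then show ?case using Suc by simp
  qed simp
  have "proj_dist v N e (L 0) p - suminf b \<le> proj_dist v N e (L n) p" for n
    using tele[of n] sum_le_suminf[OF b(2), of "{..<n}"] b_nonneg by force
  then have "proj_dist v N e (L 0) p - suminf b \<le> 0"
    using p(2) by (intro LIMSEQ_le_const) auto
  then show ?thesis by simp
qed

end

section \<open>Word length\<close>

context
  fixes G :: "('g, 'b) monoid_scheme" (structure) and S :: "'g set"
  assumes group: "group G" and gen: "finite_symmetric_generating G S"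
begin

interpretation group G by (rule group)

lemma S_carrier: "S \<subseteq> carrier G"
  using gen by (simp add: finite_symmetric_generating_def)

lemma word_append:
  assumes "set xs \<subseteq> carrier G" "set ys \<subseteq> carrier G"
  shows "foldr (mult G) xs \<one> \<in> carrier G"
    "foldr (mult G) (xs @ ys) \<one> = foldr (mult G) xs \<one> \<otimes> foldr (mult G) ys \<one>"
proof -
  have cl: "foldr (mult G) xs \<one> \<in> carrier G" if "set xs \<subseteq> carrier G" for xs
    using that by (induction xs) auto
  then show "foldr (mult G) xs \<one> \<in> carrier G" using assms by blast
  show "foldr (mult G) (xs @ ys) \<one> = foldr (mult G) xs \<one> \<otimes> foldr (mult G) ys \<one>"
    using assms(1) by (induction xs) (use cl assms(2) in \<open>auto simp: m_assoc\<close>)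
qed

lemma word_exists:
  assumes "g \<in> carrier G"
  shows "\<exists>ws. set ws \<subseteq> S \<and> foldr (mult G) ws \<one> = g"
proof -
  have "g \<in> generate G S" using assms gen by (simp add: finite_symmetric_generating_def)
  then show ?thesis
  proof (induction g rule: generate.induct)
    case one
    then show ?case by (intro exI[of _ "[]"]) simp
  next
    case (incl h)
    then show ?case using S_carrier by (intro exI[of _ "[h]"]) auto
  next
    case (inv h)
    then have "inv h \<in> S" using gen by (simp add: finite_symmetric_generating_def)
    then show ?case using S_carrier by (intro exI[of _ "[inv h]"]) auto
  next
    case (eng h1 h2)
    then obtain w1 w2 where w: "set w1 \<subseteq> S" "foldr (mult G) w1 \<one> = h1"
      "set w2 \<subseteq> S" "foldr (mult G) w2 \<one> = h2" by blast
    then show ?case using word_append(2)[of w1 w2] S_carrier by (intro exI[of _ "w1 @ w2"]) auto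
  qed
qed

lemma word_length_attained:
  assumes "g \<in> carrier G"
  obtains ws where "length ws = word_length G S g" "set ws \<subseteq> S" "foldr (mult G) ws \<one> = g"
proof -
  have "\<exists>n ws. length ws = n \<and> set ws \<subseteq> S \<and> foldr (mult G) ws \<one> = g"
    using word_exists[OF assms] by blast
  then have "\<exists>ws. length ws = word_length G S g \<and> set ws \<subseteq> S \<and> foldr (mult G) ws \<one> = g"
    unfolding word_length_def by (rule LeastI_ex)
  then show thesis using that by blast
qed

lemma word_length_le: "set ws \<subseteq> S \<Longrightarrow> word_length G S (foldr (mult G) ws \<one>) \<le> length ws"
  unfolding word_length_def by (rule Least_le) blast

lemma word_length_mult:
  assumes "g \<in> carrier G" "h \<in> carrier G"
  shows "word_length G S (g \<otimes> h) \<le> word_length G S g + word_length G S h"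
proof -
  obtain xs where xs: "length xs = word_length G S g" "set xs \<subseteq> S" "foldr (mult G) xs \<one> = g"
    using word_length_attained[OF assms(1)] by blast
  obtain ys where ys: "length ys = word_length G S h" "set ys \<subseteq> S" "foldr (mult G) ys \<one> = h"
    using word_length_attained[OF assms(2)] by blast
  show ?thesis
    using word_length_le[of "xs @ ys"] word_append(2)[of xs ys] xs ys S_carrier by auto
qed

lemma word_length_one: "word_length G S \<one> = 0"
  using word_length_le[of "[]"] by simp

text \<open>There are finitely many words of bounded length. This finiteness yields both the uniform
  constant in \<open>lines_close\<close> and the countability of the group, hence of the
  cover.\<close>

lemma finite_word_ball: "finite {g \<in> carrier G. word_length G S g \<le> R}"
proof (rule finite_subset)
  show "{g \<in> carrier G. word_length G S g \<le> R}
      \<subseteq> (\<lambda>ws. foldr (mult G) ws \<one>) ` {ws. set ws \<subseteq> S \<and> length ws \<le> R}"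
    using word_length_attained by (smt (verit) image_eqI mem_Collect_eq subsetI)
  show "finite ((\<lambda>ws. foldr (mult G) ws \<one>) ` {ws. set ws \<subseteq> S \<and> length ws \<le> R})"
    using gen by (intro finite_imageI finite_lists_length_le) (simp add: finite_symmetric_generating_def)
qed

lemma countable_carrier: "countable (carrier G)"
proof -
  have "countable (\<Union>R. {g \<in> carrier G. word_length G S g \<le> R})"
    by (rule countable_UN) (auto intro: countable_finite finite_word_ball)
  also have "(\<Union>R. {g \<in> carrier G. word_length G S g \<le> R}) = carrier G" by auto
  finally show ?thesis .
qed

lemma geodesic_ray_props:
  assumes "geodesic_ray G S r"
  shows "r n \<in> carrier G" "word_length G S (inv (r n) \<otimes> r (Suc n)) \<le> 1"
    "inj r" "n \<le> word_length G S (inv (r 0)) + word_length G S (r n)"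
proof -
  have r: "\<And>n. r n \<in> carrier G" and d: "\<And>m n. word_dist G S (r m) (r n) = \<bar>real m - real n\<bar>"
    using assms by (auto simp: geodesic_ray_def)
  show "r n \<in> carrier G" by (rule r)
  show "word_length G S (inv (r n) \<otimes> r (Suc n)) \<le> 1"
    using d[of n "Suc n"] by (simp add: word_dist_def)
  show "inj r"
  proof (rule injI)
    fix m n assume "r m = r n"
    then have "word_dist G S (r m) (r n) = 0" using r by (simp add: word_dist_def word_length_one)
    then show "m = n" using d[of m n] by simp
  qed
  \<comment> \<open>A ray may start anywhere; its base point costs an additive constant.\<close>
  have "n = word_length G S (inv (r 0) \<otimes> r n)" using d[of 0 n] by (simp add: word_dist_def)
  also have "\<dots> \<le> word_length G S (inv (r 0)) + word_length G S (r n)"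
    using r by (intro word_length_mult) auto
  finally show "n \<le> word_length G S (inv (r 0)) + word_length G S (r n)" .
qed

end

section \<open>Hausdorff dimension of a limsup set\<close>

text \<open>Smallness of the tail is stated for finite sets away from \<open>F\<close>, which is the
  form in which the partial sums of the cover meet it.\<close>

lemma summable_on_small_tail:
  fixes f :: "'i \<Rightarrow> real"
  assumes "f summable_on I" "0 < \<epsilon>"
  obtains F where "finite F" "F \<subseteq> I" "\<And>F'. finite F' \<Longrightarrow> F' \<subseteq> I - F \<Longrightarrow> sum f F' < \<epsilon>"
proof -
  obtain s where "(f has_sum s) I" using assms(1) by (auto simp: summable_on_def)
  then have "\<forall>\<^sub>F X in finite_subsets_at_top I. dist (sum f X) s < \<epsilon> / 2"
    unfolding has_sum_def using assms(2) by (intro tendstoD) auto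
  then obtain F where F: "finite F" "F \<subseteq> I"
    "\<forall>X. finite X \<and> F \<subseteq> X \<and> X \<subseteq> I \<longrightarrow> dist (sum f X) s < \<epsilon> / 2"
    unfolding eventually_finite_subsets_at_top by (elim exE conjE)
  show thesis
  proof (rule that[OF F(1,2)])
    fix F' assume F': "finite F'" "F' \<subseteq> I - F"
    have "sum f (F \<union> F') = sum f F + sum f F'" using F F' by (intro sum.union_disjoint) auto
    moreover have "dist (sum f (F \<union> F')) s < \<epsilon> / 2" "dist (sum f F) s < \<epsilon> / 2" using F F' by auto
    ultimately show "sum f F' < \<epsilon>" unfolding dist_real_def by linarith
  qed
qed

lemma set_diameter_bounds:
  assumes "\<And>x y. x \<in> U \<Longrightarrow> y \<in> U \<Longrightarrow> 0 \<le> dst x y" "\<And>x y. x \<in> U \<Longrightarrow> y \<in> U \<Longrightarrow> dst x y \<le> t" "0 \<le> t"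
  shows "0 \<le> set_diameter dst U" "set_diameter dst U \<le> t"
proof -
  have bdd: "bdd_above ((\<lambda>(x, y). dst x y) ` (U \<times> U))"
    using assms(2) by (intro bdd_aboveI[of _ t]) auto
  show "set_diameter dst U \<le> t"
    using assms by (auto simp: set_diameter_def intro!: cSUP_least)
  show "0 \<le> set_diameter dst U"
  proof (cases "U = {}")
    case False
    then obtain x where x: "x \<in> U" by blast
    have "0 \<le> (\<lambda>(x, y). dst x y) (x, x)" using assms(1) x by simp
    also have "\<dots> \<le> (SUP (x, y)\<in>U \<times> U. dst x y)" by (rule cSUP_upper[OF _ bdd]) (use x in simp)
    finally show ?thesis using False by (simp add: set_diameter_def)
  qed (simp add: set_diameter_def)
qed

text \<open>The convergence half of the Borel-Cantelli argument, with powers of diameters in place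
  of probabilities. The assumption \<open>cover\<close> says that each point of \<open>A\<close>
  lies in \<open>U i\<close> for infinitely many \<open>i\<close>, so any finite part of the family
  may be discarded.\<close>

lemma hausdorff_outer_measure_limsup:
  fixes a :: "'i \<Rightarrow> real"
  assumes I: "countable I" and U: "\<And>i. i \<in> I \<Longrightarrow> U i \<subseteq> M"
    and dst: "\<And>i x y. \<lbrakk>i \<in> I; x \<in> U i; y \<in> U i\<rbrakk> \<Longrightarrow> 0 \<le> dst x y \<and> dst x y \<le> K * a i"
    and a: "\<And>i. i \<in> I \<Longrightarrow> 0 < a i" and K: "0 < K" and t: "0 < t"
    and sum: "(\<lambda>i. a i powr t) summable_on I"
    and cover: "\<And>x F. \<lbrakk>x \<in> A; finite F\<rbrakk> \<Longrightarrow> \<exists>i\<in>I - F. x \<in> U i"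
  shows "hausdorff_outer_measure M dst t A = 0"
proof -
  have pre: "hausdorff_premeasure M dst t \<delta> A \<le> ennreal \<eta>" if "0 < \<delta>" "0 < \<eta>" for \<delta> \<eta>
  proof -
    \<comment> \<open>The bound by \<open>\<eta>\<close> controls the sum of the cover. The bound by
      \<open>\<delta> powr t\<close> controls the mesh: each single summand is also below the tail
      bound, hence every remaining diameter is at most \<open>\<delta>\<close>.\<close>
    define \<epsilon> where "\<epsilon> = min \<eta> (\<delta> powr t) / K powr t"
    have \<epsilon>: "0 < \<epsilon>" "K powr t * \<epsilon> \<le> \<eta>" "K powr t * \<epsilon> \<le> \<delta> powr t"
      using that K by (auto simp: \<epsilon>_def)
    obtain F where F: "finite F" "F \<subseteq> I"
      "\<And>F'. finite F' \<Longrightarrow> F' \<subseteq> I - F \<Longrightarrow> (\<Sum>i\<in>F'. a i powr t) < \<epsilon>"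
      using summable_on_small_tail[OF sum \<epsilon>(1)] by blast
    \<comment> \<open>The premeasure asks for a sequence of sets. \<open>J\<close> holds the codes
      of the indices outside \<open>F\<close>; at all other positions the empty set is used, whose
      diameter 0 contributes nothing.\<close>
    define J where "J = to_nat_on I ` (I - F)"
    define g where "g = from_nat_into I"
    have g: "g n \<in> I - F" if "n \<in> J" for n using that I by (auto simp: J_def g_def)
    have g_inj: "inj_on g J" using I by (auto simp: inj_on_def J_def g_def)
    define V where "V n = (if n \<in> J then U (g n) else {})" for n
    have Ka: "K * a i \<le> \<delta>" if "i \<in> I - F" for i
    proof (rule ccontr)
      assume "\<not> K * a i \<le> \<delta>"
      then have "\<delta> powr t < (K * a i) powr t" using \<open>0 < \<delta>\<close> t by (intro powr_less_mono2) auto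
      also have "\<dots> = K powr t * a i powr t" using K a that by (simp add: powr_mult)
      also have "\<dots> \<le> K powr t * \<epsilon>" using F(3)[of "{i}"] that by (intro mult_left_mono) auto
      finally show False using \<epsilon>(3) by simp
    qed
    have diam: "ennreal (set_diameter dst (V n) powr t) \<le> (if n \<in> J then ennreal ((K * a (g n)) powr t) else 0)" for n
    proof (cases "n \<in> J")
      case True
      then have n: "g n \<in> I" "V n = U (g n)" using g by (auto simp: V_def)
      have "0 \<le> set_diameter dst (V n)" "set_diameter dst (V n) \<le> K * a (g n)"
        using set_diameter_bounds[of "V n" dst "K * a (g n)"] dst[OF n(1)] a[OF n(1)] K unfolding n(2) by auto
      then show ?thesis using True t by (auto intro!: ennreal_leI powr_mono2)
    qed (simp add: V_def set_diameter_def)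
    have "(\<Sum>n. ennreal (set_diameter dst (V n) powr t)) \<le> ennreal \<eta>"
      unfolding suminf_eq_SUP
    proof (rule SUP_least)
      fix m :: nat
      let ?X = "{..<m} \<inter> J"
      have "(\<Sum>n<m. ennreal (set_diameter dst (V n) powr t))
          \<le> (\<Sum>n<m. if n \<in> J then ennreal ((K * a (g n)) powr t) else 0)"
        by (intro sum_mono diam)
      also have "\<dots> = (\<Sum>n\<in>?X. ennreal ((K * a (g n)) powr t))" by (rule sum.inter_restrict[symmetric]) simp
      also have "\<dots> = ennreal (\<Sum>n\<in>?X. (K * a (g n)) powr t)" by (rule sum_ennreal) simp
      also have "(\<Sum>n\<in>?X. (K * a (g n)) powr t) = (\<Sum>n\<in>?X. K powr t * a (g n) powr t)"
        using K a g by (intro sum.cong) (auto simp: powr_mult less_imp_le)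
      also have "\<dots> = K powr t * (\<Sum>i\<in>g ` ?X. a i powr t)"
        using g_inj by (subst sum.reindex) (auto simp: sum_distrib_left intro: inj_on_subset)
      also have "\<dots> \<le> K powr t * \<epsilon>"
        using F(3)[of "g ` ?X"] g by (intro mult_left_mono) (auto intro: less_imp_le)
      also have "\<dots> \<le> \<eta>" by (rule \<epsilon>(2))
      finally show "(\<Sum>n<m. ennreal (set_diameter dst (V n) powr t)) \<le> ennreal \<eta>"
        by (simp add: ennreal_leI)
    qed
    moreover have "V n \<subseteq> M" for n using U g by (auto simp: V_def)
    moreover have "dst x y \<le> \<delta>" if xy: "x \<in> V n" "y \<in> V n" for n x y
    proof -
      have n: "n \<in> J" using xy by (auto simp: V_def split: if_splits)
      then have "dst x y \<le> K * a (g n)" using dst[of "g n" x y] g[OF n] xy by (simp add: V_def)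
      then show ?thesis using Ka[OF g[OF n]] by simp
    qed
    moreover have "A \<subseteq> (\<Union>n. V n)"
    proof
      fix x assume "x \<in> A"
      then obtain i where i: "i \<in> I - F" "x \<in> U i" using cover F(1) by blast
      then have "to_nat_on I i \<in> J" "g (to_nat_on I i) = i" using I by (auto simp: J_def g_def)
      then have "x \<in> V (to_nat_on I i)" using i by (simp add: V_def)
      then show "x \<in> (\<Union>n. V n)" by blast
    qed
    ultimately show ?thesis
      unfolding hausdorff_premeasure_def
      by (intro Inf_lower2[of "\<Sum>n. ennreal (set_diameter dst (V n) powr t)"] CollectI exI[of _ V]) simp_all
  qed
  have "hausdorff_premeasure M dst t \<delta> A = 0" if "0 < \<delta>" for \<delta>
    using pre[OF that] ennreal_le_epsilon[of 0 "hausdorff_premeasure M dst t \<delta> A"] by simp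
  then show ?thesis by (simp add: hausdorff_outer_measure_def)
qed

lemma hausdorff_dim_limsup:
  fixes a :: "'i \<Rightarrow> real"
  assumes "countable I" "\<And>i. i \<in> I \<Longrightarrow> U i \<subseteq> M"
    and "\<And>i x y. \<lbrakk>i \<in> I; x \<in> U i; y \<in> U i\<rbrakk> \<Longrightarrow> 0 \<le> dst x y \<and> dst x y \<le> K * a i"
    and a: "\<And>i. i \<in> I \<Longrightarrow> 0 < a i \<and> a i \<le> 1" and "0 < K"
    and "\<And>x F. \<lbrakk>x \<in> A; finite F\<rbrakk> \<Longrightarrow> \<exists>i\<in>I - F. x \<in> U i"
  shows "hausdorff_dim M dst A \<le> critical_exponent I a"
  unfolding critical_exponent_def
proof (rule Inf_greatest)
  fix z assume "z \<in> {ereal s |s. 0 \<le> s \<and> (\<lambda>i. a i powr s) summable_on I}"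
  then obtain s where z: "z = ereal s" and s: "0 \<le> s" "(\<lambda>i. a i powr s) summable_on I" by blast
  \<comment> \<open>The exponent \<open>s\<close> may be 0, whereas \<open>hausdorff_dim\<close>
    ranges over positive exponents; the extra \<open>\<epsilon>\<close> bridges this.\<close>
  have "hausdorff_dim M dst A \<le> ereal s + ereal \<epsilon>" if "0 < \<epsilon>" for \<epsilon>
  proof -
    have "(\<lambda>i. a i powr (s + \<epsilon>)) summable_on I"
    proof (rule summable_on_comparison_test[OF s(2)])
      show "a i powr (s + \<epsilon>) \<le> a i powr s" if "i \<in> I" for i
        using a[OF that] \<open>0 < \<epsilon>\<close> by (intro powr_mono') auto
    qed simp
    then have "hausdorff_outer_measure M dst (s + \<epsilon>) A = 0"
      using assms s(1) \<open>0 < \<epsilon>\<close> by (intro hausdorff_outer_measure_limsup[of I U M dst K a]) auto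
    then show ?thesis
      unfolding hausdorff_dim_def using s(1) \<open>0 < \<epsilon>\<close> by (intro Inf_lower) auto
  qed
  then show "hausdorff_dim M dst A \<le> z" unfolding z by (rule ereal_le_epsilon2)
qed

section \<open>The boundary map\<close>

text \<open>From some \<open>M\<close> on all terms are below \<open>b n0\<close>, so a maximum over
  the finite stretch from \<open>n0\<close> to \<open>M\<close> is a maximum over the whole
  tail.\<close>

lemma tail_record:
  fixes b :: "nat \<Rightarrow> real"
  assumes "\<And>n. 0 < b n" "b \<longlonglongrightarrow> 0"
  obtains n where "n0 \<le> n" "\<And>m. n \<le> m \<Longrightarrow> b m \<le> b n"
proof -
  obtain M where M: "\<And>m. M \<le> m \<Longrightarrow> b m < b n0"
    using order_tendstoD(2)[OF assms(2) assms(1)[of n0]] by (auto simp: eventually_sequentially)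
  have ne: "finite {n0..max n0 M}" "{n0..max n0 M} \<noteq> {}" by auto
  obtain n where n: "n \<in> {n0..max n0 M}" "b n = Max (b ` {n0..max n0 M})"
    using Max_in[of "b ` {n0..max n0 M}"] ne by (metis (no_types, lifting) finite_imageI image_is_empty imageE)
  have max: "b m \<le> b n" if "m \<in> {n0..max n0 M}" for m using that ne n by simp
  have "b m \<le> b n" if "n \<le> m" for m
  proof (cases "m \<le> max n0 M")
    case False
    then have "b m < b n0" using M by simp
    then show ?thesis using max[of n0] by simp
  qed (use that n max in auto)
  then show thesis using that n by auto
qed

locale anosov = normed_frame v N e
  for v :: "'k::field \<Rightarrow> real" and N :: "'k ^ 'd::finite \<Rightarrow> real" and e :: "nat \<Rightarrow> 'k ^ 'd" +
  fixes \<Gamma> :: "('g, 'b) monoid_scheme" (structure) and S :: "'g set" and \<rho> :: "'g \<Rightarrow> ('k ^ 'd ^ 'd) set"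
  assumes group: "group \<Gamma>" and gen: "finite_symmetric_generating \<Gamma> S"
    and hom: "\<rho> \<in> hom \<Gamma> PGL" and projective_anosov: "projective_anosov v N e \<Gamma> S \<rho>"
begin

interpretation \<Gamma>: group \<Gamma> by (rule group)

abbreviation ratio where "ratio \<gamma> \<equiv> sv_ratio v N e (\<rho> \<gamma>)"
abbreviation lines where "lines \<gamma> \<equiv> U1 v N e (\<rho> \<gamma>)"
abbreviation pdist where "pdist \<equiv> proj_dist v N e"

lemma rho_PGL: "\<gamma> \<in> carrier \<Gamma> \<Longrightarrow> \<rho> \<gamma> \<in> carrier PGL"
  using hom by (auto simp: hom_def)

lemma ratio_bounds: "\<gamma> \<in> carrier \<Gamma> \<Longrightarrow> 0 < ratio \<gamma> \<and> ratio \<gamma> \<le> 1"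
  using sv_ratio_bounds[OF rho_PGL] by blast

lemma lines_nonempty: "\<gamma> \<in> carrier \<Gamma> \<Longrightarrow> \<exists>L. L \<in> lines \<gamma>"
  using U1_nonempty[OF rho_PGL] by blast

text \<open>\<open>\<eta>\<close> is \<open>\<gamma> \<otimes> h\<close> with \<open>h\<close> in a
  finite ball, so finitely many constants from \<open>U1_mult\<close> suffice. Radius 1 compares
  consecutive points of a ray; general \<open>R\<close> compares asymptotic rays.\<close>

lemma lines_close:
  obtains C where "0 < C" "\<And>\<gamma> \<eta> L L'. \<lbrakk>\<gamma> \<in> carrier \<Gamma>; \<eta> \<in> carrier \<Gamma>;
    word_length \<Gamma> S (inv \<gamma> \<otimes> \<eta>) \<le> R; L \<in> lines \<gamma>; L' \<in> lines \<eta>\<rbrakk> \<Longrightarrow> pdist L L' \<le> C * ratio \<gamma>"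
proof -
  define F where "F = {h \<in> carrier \<Gamma>. word_length \<Gamma> S h \<le> R}"
  have "\<exists>C\<ge>0. \<forall>X L L'. X \<in> carrier PGL \<longrightarrow> L \<in> U1 v N e X \<longrightarrow> L' \<in> U1 v N e (X \<otimes>\<^bsub>PGL\<^esub> \<rho> h)
      \<longrightarrow> pdist L L' \<le> C * sv_ratio v N e X" if h: "h \<in> F" for h
  proof -
    have "\<rho> h \<in> carrier PGL" using h rho_PGL by (simp add: F_def)
    then obtain C where C: "0 \<le> C" "\<And>X L L'. \<lbrakk>X \<in> carrier PGL; L \<in> U1 v N e X;
        L' \<in> U1 v N e (X \<otimes>\<^bsub>PGL\<^esub> \<rho> h)\<rbrakk> \<Longrightarrow> pdist L L' \<le> C * sv_ratio v N e X"
      by (rule U1_mult) (rule that)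
    show ?thesis by (rule exI[of _ C]) (simp add: C)
  qed
  then obtain c where c: "\<And>h. h \<in> F \<Longrightarrow> 0 \<le> c h" "\<And>h X L L'. \<lbrakk>h \<in> F; X \<in> carrier PGL; L \<in> U1 v N e X;
      L' \<in> U1 v N e (X \<otimes>\<^bsub>PGL\<^esub> \<rho> h)\<rbrakk> \<Longrightarrow> pdist L L' \<le> c h * sv_ratio v N e X"
    by metis
  have fin: "finite F" unfolding F_def by (rule finite_word_ball[OF group gen])
  show thesis
  \<comment> \<open>The sum dominates each nonnegative constant \<open>c h\<close>, and the summand
    1 makes the result positive.\<close>
  proof (rule that[of "1 + sum c F"])
    show "0 < 1 + sum c F" using c(1) by (simp add: add_pos_nonneg sum_nonneg)
    fix \<gamma> \<eta> L L' assume g: "\<gamma> \<in> carrier \<Gamma>" "\<eta> \<in> carrier \<Gamma>" and R: "word_length \<Gamma> S (inv \<gamma> \<otimes> \<eta>) \<le> R"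
      and L: "L \<in> lines \<gamma>" "L' \<in> lines \<eta>"
    define h where "h = inv \<gamma> \<otimes> \<eta>"
    have h: "h \<in> F" "\<gamma> \<otimes> h = \<eta>" using g R by (simp_all add: F_def h_def \<Gamma>.m_assoc[symmetric])
    then have "\<rho> \<eta> = \<rho> \<gamma> \<otimes>\<^bsub>PGL\<^esub> \<rho> h" using hom_mult[OF hom g(1), of h] by (simp add: F_def)
    then have "pdist L L' \<le> c h * ratio \<gamma>" using c(2)[OF h(1) rho_PGL[OF g(1)] L(1)] L(2) by simp
    also have "c h \<le> 1 + sum c F" using member_le_sum[OF h(1), of c] c(1) fin by force
    finally show "pdist L L' \<le> (1 + sum c F) * ratio \<gamma>"
      using ratio_bounds[OF g(1)] by (simp add: mult_right_mono)
  qed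
qed

text \<open>The rate \<open>\<mu>\<close> is fixed before the ray, and only the factor
  \<open>c\<close> depends on the ray, through its base point. This order keeps the constant in
  \<open>boundary_map_near_lines\<close> independent of the boundary point.\<close>

lemma ratio_decay:
  obtains \<mu> where "0 < \<mu>" "\<And>r. geodesic_ray \<Gamma> S r \<Longrightarrow> \<exists>c>0. \<forall>n. ratio (r n) \<le> c * exp (- \<mu> * real n)"
proof -
  obtain c \<mu> where c: "0 < c" "0 < \<mu>" and
    le: "\<And>\<gamma>. \<gamma> \<in> carrier \<Gamma> \<Longrightarrow> ratio \<gamma> \<le> c * exp (- \<mu> * real (word_length \<Gamma> S \<gamma>))"
    using projective_anosov unfolding projective_anosov_def by blast
  show thesis
  proof (rule that[OF c(2)])
    fix r assume r: "geodesic_ray \<Gamma> S r"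
    note r_props = geodesic_ray_props[OF group gen r]
    define k where "k = word_length \<Gamma> S (inv (r 0))"
    have "ratio (r n) \<le> c * exp (\<mu> * real k) * exp (- \<mu> * real n)" for n
    proof -
      have "real n \<le> real k + real (word_length \<Gamma> S (r n))" using r_props(4)[of n] by (simp add: k_def)
      then have "\<mu> * real n \<le> \<mu> * (real k + real (word_length \<Gamma> S (r n)))" using c(2) by (simp add: mult_left_mono)
      then have "exp (- \<mu> * real (word_length \<Gamma> S (r n))) \<le> exp (\<mu> * real k + - \<mu> * real n)"
        by (simp add: algebra_simps)
      then have "c * exp (- \<mu> * real (word_length \<Gamma> S (r n))) \<le> c * (exp (\<mu> * real k) * exp (- \<mu> * real n))"
        using c(1) unfolding exp_add by (intro mult_left_mono) auto
      then show ?thesis using le[OF r_props(1)[of n]] by (simp add: mult.assoc)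
    qed
    then show "\<exists>c>0. \<forall>n. ratio (r n) \<le> c * exp (- \<mu> * real n)"
      using c(1) by (intro exI[of _ "c * exp (\<mu> * real k)"]) simp
  qed
qed

lemma summable_exp: "0 < \<mu> \<Longrightarrow> summable (\<lambda>n. exp (- \<mu> * real n))"
proof -
  assume "0 < \<mu>"
  then have "summable (\<lambda>n. exp (- \<mu>) ^ n)" by (intro summable_geometric) simp
  then show ?thesis by (simp add: exp_of_nat_mult[symmetric] mult.commute)
qed

lemma ray_limit:
  assumes r: "geodesic_ray \<Gamma> S r" and L: "\<And>n. L n \<in> lines (r n)"
  shows "\<exists>p\<in>proj_space. (\<lambda>n. pdist (L n) p) \<longlonglongrightarrow> 0"
proof -
  note r_props = geodesic_ray_props[OF group gen r]
  obtain C where C: "0 < C" "\<And>\<gamma> \<eta> L L'. \<lbrakk>\<gamma> \<in> carrier \<Gamma>; \<eta> \<in> carrier \<Gamma>;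
    word_length \<Gamma> S (inv \<gamma> \<otimes> \<eta>) \<le> 1; L \<in> lines \<gamma>; L' \<in> lines \<eta>\<rbrakk> \<Longrightarrow> pdist L L' \<le> C * ratio \<gamma>"
    using lines_close by blast
  obtain \<mu> c where \<mu>: "0 < \<mu>" "0 < c" "\<And>n. ratio (r n) \<le> c * exp (- \<mu> * real n)"
    using ratio_decay r by metis
  show ?thesis
  proof (rule proj_complete)
    show "L n \<in> proj_space" for n using L by (rule U1_proj_space)
    show "summable (\<lambda>n. C * (c * exp (- \<mu> * real n)))" by (intro summable_mult summable_exp \<mu>)
    show "pdist (L n) (L (Suc n)) \<le> C * (c * exp (- \<mu> * real n))" for n
      by (rule order_trans[OF C(2)[OF r_props(1,1,2) L L] mult_left_mono[OF \<mu>(3) less_imp_le[OF C(1)]]])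
  qed
qed

text \<open>Justifies the definite description. One ray with one choice of lines yields a limit; any
  other ray of the class stays within bounded distance \<open>R\<close>, so by
  \<open>lines_close\<close> its lines differ from these by a constant times a ratio that tends to
  0.\<close>

lemma boundary_map_limit:
  assumes x: "x \<in> gromov_boundary \<Gamma> S"
  shows "boundary_map v N e \<rho> x \<in> proj_space"
    "\<And>r L. \<lbrakk>r \<in> x; \<And>n. L n \<in> lines (r n)\<rbrakk> \<Longrightarrow> (\<lambda>n. pdist (L n) (boundary_map v N e \<rho> x)) \<longlonglongrightarrow> 0"
    "\<exists>r\<in>x. geodesic_ray \<Gamma> S r"
proof -
  obtain r0 where r0: "geodesic_ray \<Gamma> S r0" and x_def: "x = {r. geodesic_ray \<Gamma> S r \<and>
      (\<exists>C. \<forall>n. word_dist \<Gamma> S (r0 n) (r n) \<le> C)}"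
    using x by (auto simp: gromov_boundary_def quotient_def)
  note r0_props = geodesic_ray_props[OF group gen r0]
  have "word_dist \<Gamma> S (r0 n) (r0 n) \<le> 0" for n
    using r0_props(1)[of n] by (simp add: word_dist_def word_length_one[OF group gen])
  then have r0_x: "r0 \<in> x" using r0 by (auto simp: x_def)
  then show "\<exists>r\<in>x. geodesic_ray \<Gamma> S r" using r0 by blast
  have "\<forall>n. \<exists>L. L \<in> lines (r0 n)" using lines_nonempty r0_props(1) by blast
  then obtain L0 where L0: "\<And>n. L0 n \<in> lines (r0 n)" by metis
  obtain p where p: "p \<in> proj_space" "(\<lambda>n. pdist (L0 n) p) \<longlonglongrightarrow> 0"
    using ray_limit[OF r0 L0] by blast
  let ?P = "\<lambda>p. p \<in> proj_space \<and>
        (\<forall>r\<in>x. \<forall>L. (\<forall>n. L n \<in> lines (r n)) \<longrightarrow> (\<lambda>n. pdist (L n) p) \<longlonglongrightarrow> 0)"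
  have "?P p"
  proof (intro conjI p(1) ballI allI impI)
    fix r L assume r: "r \<in> x" and L: "\<forall>n. L n \<in> lines (r n)"
    then obtain K where ray: "geodesic_ray \<Gamma> S r" and K: "\<And>n. word_dist \<Gamma> S (r0 n) (r n) \<le> K"
      by (auto simp: x_def)
    define R where "R = nat \<lceil>K\<rceil>"
    have R: "word_length \<Gamma> S (inv (r0 n) \<otimes> r n) \<le> R" for n
      using K[of n] unfolding word_dist_def R_def by linarith
    obtain C where C: "0 < C" "\<And>\<gamma> \<eta> L L'. \<lbrakk>\<gamma> \<in> carrier \<Gamma>; \<eta> \<in> carrier \<Gamma>;
      word_length \<Gamma> S (inv \<gamma> \<otimes> \<eta>) \<le> R; L \<in> lines \<gamma>; L' \<in> lines \<eta>\<rbrakk> \<Longrightarrow> pdist L L' \<le> C * ratio \<gamma>"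
      using lines_close by blast
    obtain \<mu> c where \<mu>: "0 < \<mu>" "0 < c" "\<And>n. ratio (r0 n) \<le> c * exp (- \<mu> * real n)"
      using ratio_decay r0 by metis
    have P: "L n \<in> proj_space" "L0 n \<in> proj_space" for n
      using L L0 U1_proj_space by blast+
    have le: "pdist (L n) p \<le> C * (c * exp (- \<mu> * real n)) + pdist (L0 n) p" for n
    proof -
      have "pdist (L n) p \<le> pdist (L n) (L0 n) + pdist (L0 n) p"
        by (rule proj_dist_triangle[OF P p(1)])
      also have "pdist (L n) (L0 n) = pdist (L0 n) (L n)" by (rule proj_dist_commute[OF P])
      also have "pdist (L0 n) (L n) \<le> C * ratio (r0 n)"
        using C(2)[OF r0_props(1) geodesic_ray_props(1)[OF group gen ray] R L0] L by blast
      also have "\<dots> \<le> C * (c * exp (- \<mu> * real n))" using \<mu>(3) C(1) by (intro mult_left_mono) auto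
      finally show ?thesis by simp
    qed
    have "(\<lambda>n. C * (c * exp (- \<mu> * real n))) \<longlonglongrightarrow> 0"
      by (intro summable_LIMSEQ_zero summable_mult summable_exp \<mu>)
    then have "(\<lambda>n. C * (c * exp (- \<mu> * real n)) + pdist (L0 n) p) \<longlonglongrightarrow> 0"
      using tendsto_add[OF _ p(2)] by fastforce
    then show "(\<lambda>n. pdist (L n) p) \<longlonglongrightarrow> 0"
      by (rule null_squeeze[OF _ proj_dist_nonneg[OF P(1) p(1)] le])
  qed
  moreover have "q = p" if q: "?P q" for q
  proof -
    have q_lim: "(\<lambda>n. pdist (L0 n) q) \<longlonglongrightarrow> 0" and qP: "q \<in> proj_space" using q r0_x L0 by blast+
    have P: "L0 n \<in> proj_space" for n using L0 by (rule U1_proj_space)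
    have "pdist q p \<le> pdist (L0 n) q + pdist (L0 n) p" for n
      using proj_dist_triangle[OF qP P p(1), of n] proj_dist_commute[OF qP P, of n] by simp
    moreover have "(\<lambda>n. pdist (L0 n) q + pdist (L0 n) p) \<longlonglongrightarrow> 0 + 0"
      by (intro tendsto_add q_lim p(2))
    ultimately have "pdist q p \<le> 0 + 0" by (intro LIMSEQ_le_const) auto
    then have "pdist q p = 0" using proj_dist_nonneg[OF qP p(1)] by simp
    then show ?thesis by (rule proj_dist_eq_0[OF qP p(1)])
  qed
  ultimately have "?P (boundary_map v N e \<rho> x)"
    unfolding boundary_map_def by (rule theI)
  then show "boundary_map v N e \<rho> x \<in> proj_space"
    "\<And>r L. \<lbrakk>r \<in> x; \<And>n. L n \<in> lines (r n)\<rbrakk> \<Longrightarrow> (\<lambda>n. pdist (L n) (boundary_map v N e \<rho> x)) \<longlonglongrightarrow> 0"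
    by blast+
qed

text \<open>At a record \<open>n\<close> of \<open>n \<mapsto> ratio (r n) * exp (\<mu> n / 2)\<close> the ratios beyond \<open>n\<close> are dominated by a
  geometric series with first term \<open>ratio (r n)\<close>.\<close>

lemma boundary_map_near_lines:
  obtains K where "0 < K" "\<And>x F \<Lambda>. \<lbrakk>x \<in> gromov_boundary \<Gamma> S; finite F; \<And>\<gamma>. \<gamma> \<in> carrier \<Gamma> \<Longrightarrow> \<Lambda> \<gamma> \<in> lines \<gamma>\<rbrakk>
    \<Longrightarrow> \<exists>\<gamma>\<in>carrier \<Gamma> - F. pdist (\<Lambda> \<gamma>) (boundary_map v N e \<rho> x) \<le> K * ratio \<gamma>"
proof -
  obtain C where C: "0 < C" "\<And>\<gamma> \<eta> L L'. \<lbrakk>\<gamma> \<in> carrier \<Gamma>; \<eta> \<in> carrier \<Gamma>;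
    word_length \<Gamma> S (inv \<gamma> \<otimes> \<eta>) \<le> 1; L \<in> lines \<gamma>; L' \<in> lines \<eta>\<rbrakk> \<Longrightarrow> pdist L L' \<le> C * ratio \<gamma>"
    using lines_close by blast
  obtain \<mu> where \<mu>: "0 < \<mu>"
    "\<And>r. geodesic_ray \<Gamma> S r \<Longrightarrow> \<exists>c>0. \<forall>n. ratio (r n) \<le> c * exp (- \<mu> * real n)"
    using ratio_decay by blast
  \<comment> \<open>The decay rate is split in two: one half makes the weighted ratios
    \<open>b n\<close> tend to 0, so that records exist, and the other half is the rate of the
    geometric series after a record. The sum \<open>Z\<close> of that series depends on
    \<open>\<mu>\<close> alone.\<close>
  define \<nu> where "\<nu> = \<mu> / 2"
  have \<nu>: "0 < \<nu>" "\<mu> = \<nu> + \<nu>" using \<mu>(1) by (simp_all add: \<nu>_def)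
  define Z where "Z = (\<Sum>i. exp (- \<nu> * real i))"
  have "0 < Z" unfolding Z_def by (intro suminf_pos summable_exp \<nu>(1)) simp
  show thesis
  proof (rule that[of "C * Z"])
    show "0 < C * Z" using C(1) \<open>0 < Z\<close> by simp
    fix x and F :: "'g set" and \<Lambda> assume x: "x \<in> gromov_boundary \<Gamma> S" and F: "finite F"
      and \<Lambda>: "\<And>\<gamma>. \<gamma> \<in> carrier \<Gamma> \<Longrightarrow> \<Lambda> \<gamma> \<in> lines \<gamma>"
    define p where "p = boundary_map v N e \<rho> x"
    note lim = boundary_map_limit[OF x, folded p_def]
    obtain r where rx: "r \<in> x" and r: "geodesic_ray \<Gamma> S r" using lim(3) by blast
    note r_props = geodesic_ray_props[OF group gen r]
    obtain c where c: "0 < c" "\<And>n. ratio (r n) \<le> c * exp (- \<mu> * real n)" using \<mu>(2)[OF r] by blast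
    define b where "b n = ratio (r n) * exp (\<nu> * real n)" for n
    have b_pos: "0 < b n" for n using ratio_bounds[OF r_props(1)] by (simp add: b_def)
    have "b n \<le> c * exp (- \<nu> * real n)" for n
    proof -
      have "b n \<le> c * exp (- \<mu> * real n) * exp (\<nu> * real n)"
        unfolding b_def using c(2) by (intro mult_right_mono) auto
      also have "\<dots> = c * exp (- \<nu> * real n)"
        unfolding mult.assoc exp_add[symmetric] \<nu>(2) by (simp add: algebra_simps)
      finally show ?thesis .
    qed
    moreover have "(\<lambda>n. c * exp (- \<nu> * real n)) \<longlonglongrightarrow> 0"
      by (intro summable_LIMSEQ_zero summable_mult summable_exp \<nu>)
    ultimately have b_lim: "b \<longlonglongrightarrow> 0"
      using null_squeeze[of "\<lambda>n. c * exp (- \<nu> * real n)" b] b_pos less_imp_le by blast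
    \<comment> \<open>A geodesic ray is injective, so it leaves the finite set \<open>F\<close>; a
      record beyond \<open>n0\<close> therefore lies outside \<open>F\<close>.\<close>
    have "finite (r -` F)" using F r_props(3) by (intro finite_vimageI)
    then obtain n0 where n0: "\<forall>n\<in>r -` F. n < n0"
      unfolding finite_nat_set_iff_bounded by (elim exE)
    obtain n where n: "n0 \<le> n" "\<And>m. n \<le> m \<Longrightarrow> b m \<le> b n"
      using tail_record[OF b_pos b_lim] by blast
    have decay: "ratio (r (n + i)) \<le> ratio (r n) * exp (- \<nu> * real i)" for i
    proof -
      have "ratio (r (n + i)) * exp (\<nu> * real (n + i)) \<le> ratio (r n) * exp (\<nu> * real n)"
        using n(2)[of "n + i"] by (simp add: b_def)
      also have "exp (\<nu> * real n) = exp (- \<nu> * real i) * exp (\<nu> * real (n + i))"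
        unfolding exp_add[symmetric] by (simp add: algebra_simps)
      finally have "ratio (r (n + i)) * exp (\<nu> * real (n + i))
          \<le> (ratio (r n) * exp (- \<nu> * real i)) * exp (\<nu> * real (n + i))" by (simp only: mult.assoc)
      then show ?thesis by (rule mult_right_le_imp_le) simp
    qed
    define L where "L i = \<Lambda> (r (n + i))" for i
    have L: "L i \<in> lines (r (n + i))" for i using \<Lambda>[OF r_props(1)] by (simp add: L_def)
    have "pdist (L 0) p \<le> (\<Sum>i. C * ratio (r n) * exp (- \<nu> * real i))"
    proof (rule proj_dist_limit_le)
      show "L i \<in> proj_space" for i using L by (rule U1_proj_space)
      show "pdist (L i) (L (Suc i)) \<le> C * ratio (r n) * exp (- \<nu> * real i)" for i
      proof -
        have "pdist (L i) (L (Suc i)) \<le> C * ratio (r (n + i))"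
          using C(2)[OF r_props(1,1,2) L[of i], of "L (Suc i)"] L[of "Suc i"] by simp
        also have "\<dots> \<le> C * (ratio (r n) * exp (- \<nu> * real i))"
          using decay C(1) by (intro mult_left_mono) auto
        finally show ?thesis by (simp only: mult.assoc)
      qed
      show "summable (\<lambda>i. C * ratio (r n) * exp (- \<nu> * real i))"
        by (intro summable_mult summable_exp \<nu>)
      show "p \<in> proj_space" by (rule lim(1))
      have "(\<lambda>i. pdist (\<Lambda> (r i)) p) \<longlonglongrightarrow> 0" by (rule lim(2)[OF rx]) (rule \<Lambda>[OF r_props(1)])
      then have "(\<lambda>i. pdist (\<Lambda> (r (i + n))) p) \<longlonglongrightarrow> 0" by (rule LIMSEQ_ignore_initial_segment)
      then show "(\<lambda>i. pdist (L i) p) \<longlonglongrightarrow> 0" by (simp add: L_def add.commute)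
    qed
    also have "\<dots> = C * ratio (r n) * Z"
      unfolding Z_def by (rule suminf_mult[OF summable_exp[OF \<nu>(1)]])
    finally have "pdist (\<Lambda> (r n)) p \<le> C * Z * ratio (r n)" by (simp add: L_def mult_ac)
    moreover have "r n \<in> carrier \<Gamma> - F" using r_props(1)[of n] n0 n(1) by (auto simp: not_less[symmetric])
    ultimately show "\<exists>\<gamma>\<in>carrier \<Gamma> - F. pdist (\<Lambda> \<gamma>) (boundary_map v N e \<rho> x) \<le> C * Z * ratio \<gamma>"
      unfolding p_def by blast
  qed
qed

theorem hausdorff_dim_le_critical_exponent:
  "hausdorff_dim proj_space pdist (boundary_map v N e \<rho> ` gromov_boundary \<Gamma> S)
     \<le> critical_exponent (carrier \<Gamma>) ratio"
proof -
  obtain K where K: "0 < K" "\<And>x F \<Lambda>. \<lbrakk>x \<in> gromov_boundary \<Gamma> S; finite F; \<And>\<gamma>. \<gamma> \<in> carrier \<Gamma> \<Longrightarrow> \<Lambda> \<gamma> \<in> lines \<gamma>\<rbrakk>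
    \<Longrightarrow> \<exists>\<gamma>\<in>carrier \<Gamma> - F. pdist (\<Lambda> \<gamma>) (boundary_map v N e \<rho> x) \<le> K * ratio \<gamma>"
    using boundary_map_near_lines by blast
  \<comment> \<open>One line per group element is fixed, so that the cover is indexed by the group
    although \<open>lines \<gamma>\<close> may contain several lines.\<close>
  obtain \<Lambda> where \<Lambda>: "\<And>\<gamma>. \<gamma> \<in> carrier \<Gamma> \<Longrightarrow> \<Lambda> \<gamma> \<in> lines \<gamma>" using lines_nonempty by metis
  define U where "U \<gamma> = {p \<in> proj_space. pdist (\<Lambda> \<gamma>) p \<le> K * ratio \<gamma>}" for \<gamma>
  show ?thesis
  proof (rule hausdorff_dim_limsup)
    show "countable (carrier \<Gamma>)" by (rule countable_carrier[OF group gen])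
    show "U \<gamma> \<subseteq> proj_space" for \<gamma> by (auto simp: U_def)
    show "0 \<le> pdist p q \<and> pdist p q \<le> (2 * K) * ratio \<gamma>"
      if "\<gamma> \<in> carrier \<Gamma>" "p \<in> U \<gamma>" "q \<in> U \<gamma>" for \<gamma> p q
    proof -
      have P: "\<Lambda> \<gamma> \<in> proj_space" "p \<in> proj_space" "q \<in> proj_space"
        using \<Lambda>[OF that(1)] U1_proj_space that by (auto simp: U_def)
      have "pdist p q \<le> pdist (\<Lambda> \<gamma>) p + pdist (\<Lambda> \<gamma>) q"
        using proj_dist_triangle[OF P(2,1,3)] proj_dist_commute[OF P(1,2)] by simp
      then show ?thesis using that proj_dist_nonneg[OF P(2,3)] by (simp add: U_def)
    qed
    show "0 < ratio \<gamma> \<and> ratio \<gamma> \<le> 1" if "\<gamma> \<in> carrier \<Gamma>" for \<gamma> using that by (rule ratio_bounds)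
    show "0 < 2 * K" using K(1) by simp
    show "\<exists>\<gamma>\<in>carrier \<Gamma> - F. p \<in> U \<gamma>"
      if p: "p \<in> boundary_map v N e \<rho> ` gromov_boundary \<Gamma> S" and F: "finite F" for p F
    proof -
      obtain x where x: "x \<in> gromov_boundary \<Gamma> S" "p = boundary_map v N e \<rho> x" using p by blast
      obtain \<gamma> where "\<gamma> \<in> carrier \<Gamma> - F" "pdist (\<Lambda> \<gamma>) p \<le> K * ratio \<gamma>"
        using K(2)[OF x(1) F \<Lambda>] x(2) by blast
      then show ?thesis using boundary_map_limit(1)[OF x(1)] x(2) by (auto simp: U_def)
    qed
  qed
qed

end

section \<open>The non-Archimedean case\<close>

locale nonarch_frame =
  fixes v :: "'k::field \<Rightarrow> real" and N :: "'k ^ 'd::finite \<Rightarrow> real" and e :: "nat \<Rightarrow> 'k ^ 'd"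
  assumes field: "nonarch_local_field v" and e_basis: "is_basis e" and dim: "2 \<le> CARD('d)"
    and norm: "N x = Max ((\<lambda>i. v (coord e x i)) ` {1..CARD('d)})"
begin

lemma v_facts: "0 \<le> v a" "v a = 0 \<longleftrightarrow> a = 0" "v (a * b) = v a * v b" "v (a + b) \<le> max (v a) (v b)"
  using field by (simp_all add: nonarch_local_field_def)

lemma v_units: "v 0 = 0" "v 1 = 1" "v (- a) = v a"
proof -
  show v0: "v 0 = 0" by (simp add: v_facts)
  show v1: "v 1 = 1" using v_facts(3)[of 1 1] v_facts(2)[of 1] by simp
  have "v (-1) * v (-1) = 1" using v_facts(3)[of "-1" "-1"] v1 by simp
  then have "v (-1) = 1" using v_facts(1)[of "-1"] by (simp add: square_eq_1_iff)
  then show "v (- a) = v a" using v_facts(3)[of "-1" a] by simp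
qed

lemma v_quotient: "b \<noteq> 0 \<Longrightarrow> v (a / b) = v a / v b"
  using v_facts(3)[of "a / b" b] v_facts(2)[of b] by (simp add: field_simps)

lemma N_le_iff: "N x \<le> t \<longleftrightarrow> (\<forall>i\<in>{1..CARD('d)}. v (coord e x i) \<le> t)"
  using dim by (auto simp: norm)

lemma coord_le_N: "i \<in> {1..CARD('d)} \<Longrightarrow> v (coord e x i) \<le> N x"
  using N_le_iff[of x "N x"] by blast

lemma N_attained: obtains i where "i \<in> {1..CARD('d)}" "N x = v (coord e x i)"
proof -
  have "N x \<in> (\<lambda>i. v (coord e x i)) ` {1..CARD('d)}"
    using dim unfolding norm by (intro Max_in) auto
  then show thesis using that by auto
qed

lemma N_ge_0: "0 \<le> N x"
  using N_attained[of x] v_facts(1) by metis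

lemma N_ultrametric: "N (x + y) \<le> max (N x) (N y)"
  unfolding N_le_iff
proof
  fix i assume "i \<in> {1..CARD('d)}"
  then have "v (coord e x i) \<le> N x" "v (coord e y i) \<le> N y" by (simp_all only: coord_le_N)
  then show "v (coord e (x + y) i) \<le> max (N x) (N y)"
    using v_facts(4)[of "coord e x i" "coord e y i"] by (simp add: coord_add e_basis)
qed

lemma N_homogeneous: "N (a *s x) = v a * N x"
proof (rule antisym)
  show "N (a *s x) \<le> v a * N x"
    unfolding N_le_iff using coord_le_N by (auto simp: coord_scale e_basis v_facts intro: mult_left_mono)
  obtain i where i: "i \<in> {1..CARD('d)}" "N x = v (coord e x i)" by (rule N_attained)
  have "v a * N x = v (coord e (a *s x) i)" by (simp add: i coord_scale e_basis v_facts)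
  also have "\<dots> \<le> N (a *s x)" by (rule coord_le_N[OF i(1)])
  finally show "v a * N x \<le> N (a *s x)" .
qed

lemma N_neg: "N (- x) = N x"
  using N_homogeneous[of "-1" x] by (simp add: vec.scale_minus_left v_units)

lemma N_zero_iff: "N x = 0 \<longleftrightarrow> x = 0"
proof
  assume "N x = 0"
  then have "v (coord e x i) = 0" if "i \<in> {1..CARD('d)}" for i
    using coord_le_N[OF that, of x] v_facts(1)[of "coord e x i"] by simp
  then show "x = 0" using coord_eqI[OF e_basis] by (metis coord_zero v_facts(2))
qed (use N_homogeneous[of 0 0] v_units in auto)

lemma N_sum_ultrametric:
  assumes "0 \<le> t" "\<And>i. i \<in> I \<Longrightarrow> N (f i) \<le> t"
  shows "N (\<Sum>i\<in>I. f i) \<le> t"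
  using assms(2)
proof (induction I rule: infinite_finite_induct)
  case (insert i I)
  then show ?case using N_ultrametric[of "f i" "\<Sum>i\<in>I. f i"] by fastforce
qed (use assms(1) N_zero_iff[of 0] in auto)

text \<open>Applying \<open>l\<close> bounds \<open>v a\<close> by \<open>N (a *s x + w)\<close>.
  Then \<open>w\<close>, the difference of \<open>a *s x + w\<close> and \<open>a *s x\<close>, is
  no longer either; the ultrametric inequality gives the converse.\<close>

lemma N_join:
  assumes "Vector_Spaces.linear (*s) (*) l" "l x = 1" "N x = 1" "\<And>y. v (l y) \<le> N y" "l w = 0"
  shows "N (a *s x + w) = max (v a) (N w)"
proof -
  have "l (a *s x + w) = a" using assms(1,2,5) by (simp add: linear_form_iff)
  then have va: "v a \<le> N (a *s x + w)" using assms(4) by metis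
  have "N w = N (a *s x + w + - (a *s x))" by simp
  also have "\<dots> \<le> max (N (a *s x + w)) (N (- (a *s x)))" by (rule N_ultrametric)
  also have "N (- (a *s x)) = v a" by (simp only: N_neg N_homogeneous assms(3) mult_1_right)
  finally have "N w \<le> N (a *s x + w)" using va by simp
  moreover have "N (a *s x + w) \<le> max (v a) (N w)"
    using N_ultrametric[of "a *s x" w] by (simp add: N_homogeneous assms(3))
  ultimately show ?thesis using va by simp
qed

lemma N_Cauchy_convergent:
  assumes u: "\<forall>\<epsilon>>0. \<exists>M. \<forall>m\<ge>M. \<forall>n\<ge>M. N (u m - u n) < \<epsilon>"
  shows "\<exists>x. (\<lambda>n::nat. N (u n - x)) \<longlonglongrightarrow> 0"
proof -
  have "\<exists>l. (\<lambda>n. v (coord e (u n) i - l)) \<longlonglongrightarrow> 0" if i: "i \<in> {1..CARD('d)}" for i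
  proof -
    have Cauchy: "\<forall>\<epsilon>>0. \<exists>M. \<forall>m\<ge>M. \<forall>n\<ge>M. v (coord e (u m) i - coord e (u n) i) < \<epsilon>"
    proof (intro allI impI)
      fix \<epsilon> :: real assume "0 < \<epsilon>"
      then obtain M where M: "\<And>m n. M \<le> m \<Longrightarrow> M \<le> n \<Longrightarrow> N (u m - u n) < \<epsilon>" using u by blast
      have "v (coord e (u m) i - coord e (u n) i) < \<epsilon>" if "M \<le> m" "M \<le> n" for m n
        using coord_le_N[OF i, of "u m - u n"] M[OF that] by (simp add: coord_diff e_basis)
      then show "\<exists>M. \<forall>m\<ge>M. \<forall>n\<ge>M. v (coord e (u m) i - coord e (u n) i) < \<epsilon>" by blast
    qed
    have "\<forall>w. (\<forall>\<epsilon>>0. \<exists>M. \<forall>m\<ge>M. \<forall>n\<ge>M. v (w m - w n) < \<epsilon>) \<longrightarrow>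
        (\<exists>l. (\<lambda>n::nat. v (w n - l)) \<longlonglongrightarrow> 0)"
      using field by (simp add: nonarch_local_field_def)
    from this[THEN spec[where x = "\<lambda>n. coord e (u n) i"]] Cauchy show ?thesis by (rule mp)
  qed
  then obtain l where l: "\<And>i. i \<in> {1..CARD('d)} \<Longrightarrow> (\<lambda>n. v (coord e (u n) i - l i)) \<longlonglongrightarrow> 0"
    by metis
  define x where "x = (\<Sum>i=1..CARD('d). l i *s e i)"
  have le: "N (u n - x) \<le> (\<Sum>i=1..CARD('d). v (coord e (u n) i - l i))" for n
    unfolding N_le_iff
  proof
    fix i assume i: "i \<in> {1..CARD('d)}"
    have "v (coord e (u n - x) i) = v (coord e (u n) i - l i)"
      unfolding x_def coord_diff[OF e_basis] coord_comb[OF e_basis i] ..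
    also have "\<dots> \<le> (\<Sum>i=1..CARD('d). v (coord e (u n) i - l i))"
      using i by (intro member_le_sum) (auto simp: v_facts)
    finally show "v (coord e (u n - x) i) \<le> (\<Sum>i=1..CARD('d). v (coord e (u n) i - l i))" .
  qed
  have "(\<lambda>n. \<Sum>i=1..CARD('d). v (coord e (u n) i - l i)) \<longlonglongrightarrow> (\<Sum>i=1..CARD('d). 0)"
    by (intro tendsto_sum l)
  then have "(\<lambda>n. \<Sum>i=1..CARD('d). v (coord e (u n) i - l i)) \<longlonglongrightarrow> 0" by simp
  then have "(\<lambda>n. N (u n - x)) \<longlonglongrightarrow> 0"
    by (rule null_squeeze[OF _ N_ge_0 le])
  then show ?thesis ..
qed

lemma wedge_eq_Max: "wedge_norm v e x y =
    Max ((\<lambda>(i, j). v (coord e x i * coord e y j - coord e x j * coord e y i)) `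
      {(i, j). 1 \<le> i \<and> i < j \<and> j \<le> CARD('d)})"
  using field by (simp add: wedge_norm_def)

lemma finite_pairs: "finite {(i::nat, j). 1 \<le> i \<and> i < j \<and> j \<le> CARD('d)}"
  by (rule finite_subset[of _ "{1..CARD('d)} \<times> {1..CARD('d)}"]) auto

lemma wedge_le_mult: "wedge_norm v e x y \<le> N x * N y"
  unfolding wedge_eq_Max
proof (rule Max.boundedI)
  have "(1::nat, 2) \<in> {(i, j). 1 \<le> i \<and> i < j \<and> j \<le> CARD('d)}" using dim by simp
  then show "(\<lambda>(i, j). v (coord e x i * coord e y j - coord e x j * coord e y i)) `
      {(i, j). 1 \<le> i \<and> i < j \<and> j \<le> CARD('d)} \<noteq> {}" by blast
  fix r assume "r \<in> (\<lambda>(i, j). v (coord e x i * coord e y j - coord e x j * coord e y i)) `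
      {(i, j). 1 \<le> i \<and> i < j \<and> j \<le> CARD('d)}"
  then obtain p where p: "p \<in> {(i, j). 1 \<le> i \<and> i < j \<and> j \<le> CARD('d)}"
    and rp: "r = (\<lambda>(i, j). v (coord e x i * coord e y j - coord e x j * coord e y i)) p" by blast
  obtain i j where p_eq: "p = (i, j)" by (cases p)
  have ij: "i \<in> {1..CARD('d)}" "j \<in> {1..CARD('d)}" using p by (auto simp: p_eq)
  have r: "r = v (coord e x i * coord e y j - coord e x j * coord e y i)" using rp by (simp add: p_eq)
  have "r \<le> max (v (coord e x i * coord e y j)) (v (- (coord e x j * coord e y i)))"
    unfolding r using v_facts(4)[of "coord e x i * coord e y j" "- (coord e x j * coord e y i)"] by simp
  also have "\<dots> = max (v (coord e x i) * v (coord e y j)) (v (coord e x j) * v (coord e y i))"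
    by (simp add: v_units v_facts)
  also have "\<dots> \<le> N x * N y"
    using ij by (auto intro!: mult_mono coord_le_N simp: v_facts N_ge_0)
  finally show "r \<le> N x * N y" .
qed (rule finite_imageI, rule finite_pairs)

text \<open>Choose a coordinate \<open>i\<close> at which \<open>x\<close> attains its norm and
  subtract the multiple of \<open>x\<close> that kills this coordinate of \<open>y\<close>. For the
  remainder \<open>z\<close>, the minors involving \<open>i\<close> have absolute value
  \<open>N x * v (coord e z j)\<close>, and the largest of these is
  \<open>N x * N z\<close>.\<close>

lemma wedge_projection:
  assumes "x \<noteq> 0"
  shows "\<exists>a. wedge_norm v e x y = N x * N (y - a *s x) \<and> N (a *s x) \<le> N y"
proof -
  obtain i where i: "i \<in> {1..CARD('d)}" "N x = v (coord e x i)" by (rule N_attained)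
  then have xi: "coord e x i \<noteq> 0" using assms N_zero_iff v_facts(2) by metis
  define a where "a = coord e y i / coord e x i"
  define z where "z = y - a *s x"
  have "N (a *s x) = v (coord e y i)"
    using xi v_facts(2)[of "coord e x i"] by (simp add: N_homogeneous a_def v_quotient i)
  then have le: "N (a *s x) \<le> N y" using coord_le_N[OF i(1)] by simp
  have zi: "coord e z i = 0" using xi by (simp add: z_def a_def coord_diff coord_scale e_basis)
  obtain j where j: "j \<in> {1..CARD('d)}" "N z = v (coord e z j)" by (rule N_attained)
  have "N x * N z \<le> wedge_norm v e x z"
  proof (cases "i = j")
    case True
    then have "N z = 0" using j zi v_units by simp
    moreover have "0 \<le> wedge_norm v e x z"
    proof -
      have "v (coord e x 1 * coord e z 2 - coord e x 2 * coord e z 1) \<le> wedge_norm v e x z"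
        unfolding wedge_eq_Max using dim by (intro Max_ge finite_imageI finite_pairs) force
      then show ?thesis using v_facts(1) order_trans by blast
    qed
    ultimately show ?thesis by simp
  next
    case False
    \<comment> \<open>Minors are indexed by increasing pairs; swapping the indices changes only the
      sign.\<close>
    define p where "p = (min i j, max i j)"
    have "N x * N z = v (coord e x i * coord e z j - coord e x j * coord e z i)"
      by (simp add: i j zi v_facts)
    also have "\<dots> = v (coord e x j * coord e z i - coord e x i * coord e z j)"
      using v_units(3)[of "coord e x j * coord e z i - coord e x i * coord e z j"] by simp
    finally have "N x * N z = (\<lambda>(i, j). v (coord e x i * coord e z j - coord e x j * coord e z i)) p"
      by (auto simp: p_def min_def max_def i j zi v_facts)
    moreover have "p \<in> {(i, j). 1 \<le> i \<and> i < j \<and> j \<le> CARD('d)}"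
      using i j False by (auto simp: p_def)
    ultimately show ?thesis
      unfolding wedge_eq_Max by (intro Max_ge finite_imageI finite_pairs) blast
  qed
  then have "wedge_norm v e x z = N x * N z" using wedge_le_mult by (simp add: antisym)
  then show ?thesis using le by (auto simp: z_def wedge_norm_shear[OF e_basis])
qed

lemma N_basis_1:
  assumes "i \<in> {1..CARD('d)}"
  shows "N (e i) = 1"
proof (rule antisym)
  show "N (e i) \<le> 1" unfolding N_le_iff using assms by (auto simp: coord_basis e_basis v_units)
  show "1 \<le> N (e i)"
    using coord_le_N[OF assms, of "e i"] assms by (simp add: coord_basis e_basis v_units)
qed

text \<open>By the ultrametric inequality the operator norm is attained at a basis vector, so
  finitely many candidates replace compactness.\<close>

lemma endomorphism_maximizer:
  assumes "Vector_Spaces.linear (*s) (*s) G"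
  shows "\<exists>x. x \<noteq> 0 \<and> (\<forall>y. N (G y) * N x \<le> N (G x) * N y)"
proof -
  have "Max ((\<lambda>i. N (G (e i))) ` {1..CARD('d)}) \<in> (\<lambda>i. N (G (e i))) ` {1..CARD('d)}"
    using dim by (intro Max_in) auto
  then obtain k where k: "k \<in> {1..CARD('d)}" "Max ((\<lambda>i. N (G (e i))) ` {1..CARD('d)}) = N (G (e k))"
    by (elim imageE) blast
  then have max: "N (G (e i)) \<le> N (G (e k))" if "i \<in> {1..CARD('d)}" for i
    using that by (metis Max_ge finite_atLeastAtMost finite_imageI imageI)
  have "N (G y) \<le> N (G (e k)) * N y" for y
  proof -
    have mG: "matrix G *v x = G x" for x by (rule matrix_works[OF assms])
    have "G y = matrix G *v (\<Sum>i=1..CARD('d). coord e y i *s e i)"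
      unfolding sum_coord[OF e_basis] mG ..
    also have "\<dots> = (\<Sum>i=1..CARD('d). coord e y i *s G (e i))"
      by (simp only: vec.sum vec.scale mG)
    also have "N \<dots> \<le> N (G (e k)) * N y"
    proof (rule N_sum_ultrametric)
      fix i assume "i \<in> {1..CARD('d)}"
      then show "N (coord e y i *s G (e i)) \<le> N (G (e k)) * N y"
        unfolding N_homogeneous mult.commute[of "N (G (e k))"]
        by (intro mult_mono max coord_le_N) (auto simp: N_ge_0)
    qed (simp add: N_ge_0)
    finally show ?thesis .
  qed
  then show ?thesis using N_basis_1[OF k(1)] N_zero_iff[of "e k"] by (intro exI[of _ "e k"]) auto
qed

sublocale normed_frame v N e
proof
  show "is_basis e" "2 \<le> CARD('d)" by (fact e_basis dim)+
  show "0 \<le> v a" "v a = 0 \<longleftrightarrow> a = 0" "v (a * b) = v a * v b" for a b by (fact v_facts)+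
  show "0 \<le> N x" "N x = 0 \<longleftrightarrow> x = 0" "N (a *s x) = v a * N x" for a x
    by (fact N_ge_0 N_zero_iff N_homogeneous)+
  show "N (x + y) \<le> N x + N y" for x y
    using N_ultrametric[of x y] N_ge_0[of x] N_ge_0[of y] by linarith
  show "N (e i) = 1" if "i \<in> {1..CARD('d)}" for i using that by (rule N_basis_1)
  show "N x \<le> t * N y" if "0 \<le> t"
    "\<And>i. i \<in> {1..CARD('d)} \<Longrightarrow> v (coord e x i) \<le> t * v (coord e y i)" for t x y
    unfolding N_le_iff using that coord_le_N by (meson mult_left_mono order_trans)
  show "\<exists>x. (\<lambda>n. N (u n - x)) \<longlonglongrightarrow> 0"
    if "\<forall>\<epsilon>>0. \<exists>M. \<forall>m\<ge>M. \<forall>n\<ge>M. N (u m - u n) < \<epsilon>" for u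
    using that by (rule N_Cauchy_convergent)
  show "\<exists>a. v a * N x = 1" if "x \<noteq> 0" for x
  proof -
    obtain i where i: "i \<in> {1..CARD('d)}" "N x = v (coord e x i)" by (rule N_attained)
    then have "coord e x i \<noteq> 0" using that N_zero_iff v_facts(2) by metis
    then have "v (1 / coord e x i) * N x = 1"
      using v_facts(2)[of "coord e x i"] by (simp add: i v_quotient v_units del: inverse_eq_divide)
    then show ?thesis ..
  qed
  show "\<exists>l. Vector_Spaces.linear (*s) (*) l \<and> l x = 1 \<and> (\<forall>y. v (l y) \<le> N y)" if "N x = 1" for x
  proof -
    obtain i where i: "i \<in> {1..CARD('d)}" "N x = v (coord e x i)" by (rule N_attained)
    then have xi: "coord e x i \<noteq> 0" "v (coord e x i) = 1" using that v_units by auto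
    show ?thesis
    \<comment> \<open>A coordinate at which \<open>x\<close> attains its norm 1, rescaled to take
      the value 1 at \<open>x\<close>, is a norming functional.\<close>
    proof (intro exI[of _ "\<lambda>y. coord e y i / coord e x i"] conjI allI)
      show "Vector_Spaces.linear (*s) (*) (\<lambda>y. coord e y i / coord e x i)"
        by (simp add: linear_form_iff coord_add coord_scale e_basis add_divide_distrib)
      show "v (coord e y i / coord e x i) \<le> N y" for y
        using coord_le_N[OF i(1)] xi by (simp add: v_quotient)
    qed (use xi in simp)
  qed
  show "\<exists>x. x \<noteq> 0 \<and> (\<forall>y. N (G y) * N x \<le> N (G x) * N y)"
    if "Vector_Spaces.linear (*s) (*s) G" for G
    using that by (rule endomorphism_maximizer)
  show "N w \<le> N (a *s x + w)" if "Vector_Spaces.linear (*s) (*) l" "l x = 1" "N x = 1"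
    "\<And>y. v (l y) \<le> N y" "l w = 0" for l x w a
    using N_join[OF that] by simp
  show "N (a *s x + w) = N (a *s x' + w')" if "Vector_Spaces.linear (*s) (*) l" "l x = 1" "N x = 1"
    "\<And>y. v (l y) \<le> N y" "l w = 0" "Vector_Spaces.linear (*s) (*) l'" "l' x' = 1" "N x' = 1"
    "\<And>y. v (l' y) \<le> N y" "l' w' = 0" "N w = N w'" for l l' x x' w w' a
    using N_join[OF that(1-5)] N_join[OF that(6-10)] that(11) by simp
  show "wedge_norm v e x y \<le> N x * N y" for x y by (rule wedge_le_mult)
  show "\<exists>a. wedge_norm v e x y = N x * N (y - a *s x) \<and> N (a *s x) \<le> N y" if "x \<noteq> 0" for x y
    using that by (rule wedge_projection)
qed

end

section \<open>The Archimedean case\<close>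

text \<open>The ultrametric inequality fails for 1 + 1, of absolute value 2. This selects the
  Euclidean branch of \<open>wedge_norm\<close>.\<close>

lemma arch_not_nonarch:
  assumes "arch_embedding v \<phi>"
  shows "\<not> nonarch_local_field v"
proof
  assume "nonarch_local_field v"
  then have "v (1 + 1) \<le> max (v 1) (v 1)" unfolding nonarch_local_field_def by blast
  moreover have "v (1 + 1) = cmod (1 + 1)" "v 1 = cmod 1"
    using assms unfolding arch_embedding_def by metis+
  ultimately show False by simp
qed

lemma sum_pairs_symmetric:
  fixes q :: "nat \<Rightarrow> nat \<Rightarrow> real"
  assumes sym: "\<And>i j. q i j = q j i" and diag: "\<And>i. q i i = 0"
  shows "(\<Sum>i=1..n. \<Sum>j=1..n. q i j) = 2 * (\<Sum>(i, j)\<in>{(i, j). 1 \<le> i \<and> i < j \<and> j \<le> n}. q i j)"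
proof -
  define P where "P = {(i::nat, j). 1 \<le> i \<and> i < j \<and> j \<le> n}"
  define P' where "P' = prod.swap ` P"
  define D where "D = (\<lambda>i. (i, i)) ` {1..n}"
  have fin: "finite P"
    unfolding P_def by (rule finite_subset[of _ "{1..n} \<times> {1..n}"]) auto
  have eq: "{1..n} \<times> {1..n} = P \<union> P' \<union> D"
    by (auto simp: P_def P'_def D_def image_iff)
  have disj: "P \<inter> P' = {}" "(P \<union> P') \<inter> D = {}"
    by (auto simp: P_def P'_def D_def)
  have "(\<Sum>i=1..n. \<Sum>j=1..n. q i j) = (\<Sum>(i, j)\<in>P \<union> P' \<union> D. q i j)"
    unfolding sum.cartesian_product eq ..
  also have "\<dots> = (\<Sum>(i, j)\<in>P \<union> P'. q i j) + (\<Sum>(i, j)\<in>D. q i j)"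
    by (rule sum.union_disjoint) (use fin disj in \<open>auto simp: P'_def D_def\<close>)
  also have "(\<Sum>(i, j)\<in>D. q i j) = 0"
    by (rule sum.neutral) (auto simp: D_def diag)
  also have "(\<Sum>(i, j)\<in>P \<union> P'. q i j) = (\<Sum>(i, j)\<in>P. q i j) + (\<Sum>(i, j)\<in>P'. q i j)"
    by (rule sum.union_disjoint) (use fin disj in \<open>auto simp: P'_def\<close>)
  also have "(\<Sum>(i, j)\<in>P'. q i j) = (\<Sum>(i, j)\<in>P. q i j)"
    unfolding P'_def by (subst sum.reindex) (auto simp: sym intro!: sum.cong)
  finally show ?thesis by (simp add: P_def)
qed

locale arch_frame =
  fixes v :: "'k::field \<Rightarrow> real" and N :: "'k ^ 'd::finite \<Rightarrow> real" and e :: "nat \<Rightarrow> 'k ^ 'd"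
    and \<phi> :: "'k \<Rightarrow> complex" and B :: "'k ^ 'd \<Rightarrow> 'k ^ 'd \<Rightarrow> complex"
  assumes emb: "arch_embedding v \<phi>" and herm: "hermitian_product \<phi> B"
    and e_basis: "is_basis e" and dim: "2 \<le> CARD('d)"
    and orthonormal: "\<And>i j. i \<in> {1..CARD('d)} \<Longrightarrow> j \<in> {1..CARD('d)} \<Longrightarrow> B (e i) (e j) = (if i = j then 1 else 0)"
    and norm: "N x = sqrt (Re (B x x))"
begin

lemma phi: "\<phi> 1 = 1" "\<phi> (a + b) = \<phi> a + \<phi> b" "\<phi> (a * b) = \<phi> a * \<phi> b"
  and range_phi: "range \<phi> = \<real> \<or> range \<phi> = UNIV" and v_phi: "v a = cmod (\<phi> a)"
  using emb unfolding arch_embedding_def by blast+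

lemma phi_0: "\<phi> 0 = 0"
  using phi(2)[of 0 0] by simp

lemma phi_minus: "\<phi> (- a) = - \<phi> a"
  using phi(2)[of a "- a"] phi_0 by (simp add: eq_neg_iff_add_eq_0 add.commute)

lemma phi_diff: "\<phi> (a - b) = \<phi> a - \<phi> b"
  using phi(2)[of a "- b"] phi_minus by simp

lemma phi_eq_0_iff: "\<phi> a = 0 \<longleftrightarrow> a = 0"
proof
  assume "\<phi> a = 0"
  then have "\<phi> (a * inverse a) = 0" by (simp add: phi)
  then show "a = 0" using phi(1) by (metis right_inverse zero_neq_one)
qed (simp add: phi_0)

lemma phi_inj: "\<phi> a = \<phi> b \<Longrightarrow> a = b"
  using phi_diff[of a b] phi_eq_0_iff[of "a - b"] by simp

text \<open>The real and the complex case differ only in the range of \<open>\<phi>\<close>; with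
  these closure properties the scalars needed below exist in both.\<close>

lemma range_closed: "of_real r \<in> range \<phi>" "z \<in> range \<phi> \<Longrightarrow> w \<in> range \<phi> \<Longrightarrow> z * w \<in> range \<phi>"
  "z \<in> range \<phi> \<Longrightarrow> - z \<in> range \<phi>"
  using range_phi by (elim disjE; simp)+

lemma closed_range: "closed (range \<phi>)"
  using range_phi closed_complex_Reals by auto

lemma B_facts: "B x y \<in> range \<phi>" "B (x + y) z = B x z + B y z" "B (c *s x) y = \<phi> c * B x y"
  "B y x = cnj (B x y)" "x \<noteq> 0 \<Longrightarrow> 0 < Re (B x x)"
  using herm unfolding hermitian_product_def by blast+

lemma B_right: "B x (y + z) = B x y + B x z" "B x (c *s y) = cnj (\<phi> c) * B x y"
  using B_facts(4)[of x] B_facts(2,3) by simp_all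

lemma B_sum: "B (\<Sum>i\<in>I. c i *s f i) y = (\<Sum>i\<in>I. \<phi> (c i) * B (f i) y)"
proof (induction I rule: infinite_finite_induct)
  case (insert i I)
  then show ?case by (simp add: B_facts(2,3))
next
  case empty
  then show ?case using B_facts(3)[of 0 0 y] phi_0 by simp
next
  case (infinite I)
  then show ?case using B_facts(3)[of 0 0 y] phi_0 by simp
qed

lemma B_coord: "B x y = (\<Sum>i=1..CARD('d). \<phi> (coord e x i) * cnj (\<phi> (coord e y i)))"
proof -
  have "B y (e i) = \<phi> (coord e y i)" if i: "i \<in> {1..CARD('d)}" for i
  proof -
    have "B (\<Sum>j=1..CARD('d). coord e y j *s e j) (e i)
        = (\<Sum>j=1..CARD('d). if j = i then \<phi> (coord e y i) else 0)"
      unfolding B_sum using i by (intro sum.cong) (auto simp: orthonormal)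
    then show ?thesis using i unfolding sum_coord[OF e_basis] by simp
  qed
  then have *: "B (e i) y = cnj (\<phi> (coord e y i))" if "i \<in> {1..CARD('d)}" for i
    using B_facts(4)[of "e i" y] that by simp
  have "B (\<Sum>j=1..CARD('d). coord e x j *s e j) y = (\<Sum>i=1..CARD('d). \<phi> (coord e x i) * cnj (\<phi> (coord e y i)))"
    unfolding B_sum using * by (intro sum.cong) auto
  then show ?thesis unfolding sum_coord[OF e_basis] .
qed

lemma B_self: "B x x = of_real (\<Sum>i=1..CARD('d). (v (coord e x i))\<^sup>2)"
  unfolding B_coord by (simp add: v_phi complex_norm_square del: of_real_power)

lemma N_power2: "(N x)\<^sup>2 = (\<Sum>i=1..CARD('d). (v (coord e x i))\<^sup>2)"
  unfolding norm B_self by (simp add: sum_nonneg)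

lemma B_self_N: "B x x = of_real ((N x)\<^sup>2)"
  by (simp only: B_self N_power2)

lemma N_ge_0: "0 \<le> N x"
  unfolding norm B_self by (simp add: sum_nonneg)

lemma pythagoras:
  assumes "B w x = 0"
  shows "(N (a *s x + w))\<^sup>2 = (v a * N x)\<^sup>2 + (N w)\<^sup>2"
proof -
  have "B x w = 0" using B_facts(4)[of x w] assms by simp
  then have "B (a *s x + w) (a *s x + w) = (\<phi> a * cnj (\<phi> a)) * B x x + B w w"
    by (simp add: B_facts(2,3) B_right assms algebra_simps)
  also have "\<dots> = of_real ((v a)\<^sup>2) * B x x + B w w"
    by (simp only: v_phi complex_norm_square)
  finally have "complex_of_real ((N (a *s x + w))\<^sup>2) = of_real ((v a)\<^sup>2 * (N x)\<^sup>2 + (N w)\<^sup>2)"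
    by (simp only: B_self_N of_real_add of_real_mult)
  then show ?thesis by (simp only: of_real_eq_iff power_mult_distrib)
qed

lemma N_zero_iff: "N x = 0 \<longleftrightarrow> x = 0"
  using B_facts(5)[of x] B_facts(3)[of 0 0 0] by (cases "x = 0") (auto simp: norm phi_0)

lemma orthogonal_projection:
  assumes "x \<noteq> 0"
  obtains a where "B (y - a *s x) x = 0" "N (a *s x) \<le> N y" "v a * (N x)\<^sup>2 = cmod (B y x)"
proof -
  have Nx: "(N x)\<^sup>2 \<noteq> 0" using assms N_zero_iff by simp
  \<comment> \<open>The usual projection coefficient is a complex number; it has to lie in the range
    of \<open>\<phi>\<close> to come from a scalar.\<close>
  have "B y x * of_real (1 / (N x)\<^sup>2) \<in> range \<phi>" by (intro range_closed B_facts)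
  then obtain a where a: "\<phi> a = B y x * of_real (1 / (N x)\<^sup>2)" by auto
  have "B (y + (- a) *s x) x = 0"
    unfolding B_facts(2,3) phi_minus a B_self_N using Nx by (simp flip: of_real_mult of_real_power)
  then have orth: "B (y - a *s x) x = 0" by (simp add: vec.scale_minus_left)
  have "(N (a *s x + (y - a *s x)))\<^sup>2 = (v a * N x)\<^sup>2 + (N (y - a *s x))\<^sup>2"
    by (rule pythagoras[OF orth])
  moreover have "(N (a *s x + 0))\<^sup>2 = (v a * N x)\<^sup>2 + (N 0)\<^sup>2"
    by (rule pythagoras) (use B_facts(3)[of 0 0 x] phi_0 in simp)
  ultimately have "(N (a *s x))\<^sup>2 \<le> (N y)\<^sup>2" using N_zero_iff[of 0] by simp
  then have "N (a *s x) \<le> N y" using N_ge_0 by (rule power2_le_imp_le)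
  moreover have "v a * (N x)\<^sup>2 = cmod (B y x)"
    using Nx by (simp add: v_phi a norm_mult norm_divide norm_power)
  ultimately show thesis using that orth by blast
qed

lemma N_homogeneous: "N (a *s x) = v a * N x"
proof -
  have "(N (a *s x + 0))\<^sup>2 = (v a * N x)\<^sup>2 + (N 0)\<^sup>2"
    by (rule pythagoras) (use B_facts(3)[of 0 0 x] phi_0 in simp)
  then have "(N (a *s x))\<^sup>2 = (v a * N x)\<^sup>2" using N_zero_iff[of 0] by simp
  then show ?thesis by (rule power2_eq_imp_eq) (auto simp: N_ge_0 v_phi)
qed

text \<open>The orthogonal projection \<open>a *s x\<close> of \<open>y\<close> is no longer than
  \<open>y\<close>, and its length times \<open>N x\<close> is \<open>cmod (B y x)\<close>.\<close>

lemma Cauchy_Schwarz: "cmod (B y x) \<le> N y * N x"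
proof (cases "x = 0")
  case False
  then obtain a where a: "N (a *s x) \<le> N y" "v a * (N x)\<^sup>2 = cmod (B y x)"
    by (rule orthogonal_projection)
  have "cmod (B y x) = N (a *s x) * N x" using a(2) by (simp add: N_homogeneous power2_eq_square)
  then show ?thesis using a(1) N_ge_0 by (simp add: mult_right_mono)
next
  case True
  then show ?thesis using B_facts(3)[of 0 0 y] B_facts(4)[of y 0] phi_0 N_zero_iff[of 0] by simp
qed

lemma N_subadditive: "N (x + y) \<le> N x + N y"
proof (rule power2_le_imp_le)
  have "complex_of_real ((N (x + y))\<^sup>2) = B x x + B y y + (B x y + cnj (B x y))"
    unfolding B_self_N[symmetric] using B_facts(4)[of y x] by (simp add: B_facts(2) B_right)
  also have "\<dots> = of_real ((N x)\<^sup>2 + (N y)\<^sup>2 + 2 * Re (B x y))"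
    unfolding B_self_N complex_add_cnj by simp
  finally have "(N (x + y))\<^sup>2 = (N x)\<^sup>2 + (N y)\<^sup>2 + 2 * Re (B x y)"
    by (simp only: of_real_eq_iff)
  also have "Re (B x y) \<le> N x * N y"
    using complex_Re_le_cmod[of "B x y"] Cauchy_Schwarz[of x y] by simp
  finally show "(N (x + y))\<^sup>2 \<le> (N x + N y)\<^sup>2" by (simp add: power2_sum)
qed (simp add: N_ge_0)

text \<open>Otherwise moving from \<open>x\<close> in the direction of \<open>w\<close> would decrease the norm below 1 without
  changing the value of \<open>l\<close>.\<close>

lemma norming_orthogonal:
  assumes "Vector_Spaces.linear (*s) (*) l" "l x = 1" "N x = 1" "\<And>y. v (l y) \<le> N y" "l w = 0"
  shows "B w x = 0"
proof -
  define \<beta> where "\<beta> = B w x"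
  \<comment> \<open>The step size along \<open>w\<close>. It keeps \<open>s * (N w)\<^sup>2\<close>
    at most 1, so the quadratic increase of the squared norm is at most half of the linear decrease;
    adding 1 in the denominator covers \<open>w = 0\<close>.\<close>
  define s where "s = 1 / (1 + (N w)\<^sup>2)"
  have pos: "0 < 1 + (N w)\<^sup>2" by (simp add: add_pos_nonneg)
  have s: "0 < s" "s * (N w)\<^sup>2 \<le> 1" using pos by (auto simp: s_def)
  have "- (of_real s * B x w) \<in> range \<phi>" by (intro range_closed B_facts)
  then obtain t where "\<phi> t = - (of_real s * B x w)" by auto
  then have t: "\<phi> t = - (of_real s * cnj \<beta>)" using B_facts(4)[of x w] by (simp add: \<beta>_def)
  have "l (x + t *s w) = 1" using assms(1,2,5) by (simp add: linear_form_iff)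
  then have "v 1 \<le> N (x + t *s w)" using assms(4) by metis
  then have "1 \<le> (N (x + t *s w))\<^sup>2" by (simp add: v_phi phi)
  also have "complex_of_real ((N (x + t *s w))\<^sup>2) = B x x + (\<phi> t * cnj (\<phi> t)) * B w w + (\<phi> t * \<beta> + cnj (\<phi> t * \<beta>))"
    unfolding B_self_N[symmetric] using B_facts(4)[of x w] by (simp add: B_facts(2,3) B_right \<beta>_def algebra_simps)
  then have "complex_of_real ((N (x + t *s w))\<^sup>2) = of_real (1 + (cmod (\<phi> t))\<^sup>2 * (N w)\<^sup>2 + 2 * Re (\<phi> t * \<beta>))"
    unfolding B_self_N complex_norm_square[symmetric] complex_add_cnj by (simp add: assms(3))
  then have "(N (x + t *s w))\<^sup>2 = 1 + (cmod (\<phi> t))\<^sup>2 * (N w)\<^sup>2 + 2 * Re (\<phi> t * \<beta>)"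
    by (simp only: of_real_eq_iff)
  also have "\<phi> t * \<beta> = - of_real (s * (cmod \<beta>)\<^sup>2)"
    unfolding t of_real_mult complex_norm_square by (simp add: mult_ac)
  also have "cmod (\<phi> t) = s * cmod \<beta>" using s by (simp add: t norm_mult)
  \<comment> \<open>The last factor is at most -1, so the inequality forces \<open>\<beta>\<close>
    to vanish.\<close>
  finally have "0 \<le> s * ((cmod \<beta>)\<^sup>2 * (s * (N w)\<^sup>2 - 2))"
    by (simp add: power2_eq_square algebra_simps)
  then have "0 \<le> (cmod \<beta>)\<^sup>2 * (s * (N w)\<^sup>2 - 2)" using s(1) by (simp add: zero_le_mult_iff)
  then have "(cmod \<beta>)\<^sup>2 = 0" using s(2) zero_le_mult_iff[of "(cmod \<beta>)\<^sup>2" "s * (N w)\<^sup>2 - 2"] by auto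
  then show ?thesis by (simp add: \<beta>_def)
qed

lemma N_join:
  assumes "Vector_Spaces.linear (*s) (*) l" "l x = 1" "N x = 1" "\<And>y. v (l y) \<le> N y" "l w = 0"
  shows "N (a *s x + w) = sqrt ((v a)\<^sup>2 + (N w)\<^sup>2)"
  using pythagoras[OF norming_orthogonal[OF assms], of a] N_ge_0[of "a *s x + w"] assms(3)
  by (metis mult_1_right real_sqrt_unique)

text \<open>Lagrange's identity. The double sum over all \<open>i\<close> and \<open>j\<close>
  counts each squared minor twice and has zero diagonal; expanded, it splits into four products of
  values of \<open>B\<close>.\<close>

lemma wedge_power2: "(wedge_norm v e x y)\<^sup>2 = (N x)\<^sup>2 * (N y)\<^sup>2 - (cmod (B x y))\<^sup>2"
proof -
  define X where "X i = \<phi> (coord e x i)" for i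
  define Y where "Y i = \<phi> (coord e y i)" for i
  define q where "q i j = (cmod (X i * Y j - X j * Y i))\<^sup>2" for i j
  have "(wedge_norm v e x y)\<^sup>2 = (\<Sum>(i, j)\<in>{(i, j). 1 \<le> i \<and> i < j \<and> j \<le> CARD('d)}. q i j)"
    using arch_not_nonarch[OF emb]
    by (simp add: wedge_norm_def Let_def sum_nonneg q_def X_def Y_def v_phi phi phi_diff case_prod_unfold)
  then have "2 * (wedge_norm v e x y)\<^sup>2 = (\<Sum>i=1..CARD('d). \<Sum>j=1..CARD('d). q i j)"
    using sum_pairs_symmetric[of q "CARD('d)"] by (simp add: q_def norm_minus_commute mult.commute)
  then have "complex_of_real (2 * (wedge_norm v e x y)\<^sup>2) = (\<Sum>i=1..CARD('d). \<Sum>j=1..CARD('d). of_real (q i j))"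
    by simp
  also have "\<dots> = (\<Sum>i=1..CARD('d). \<Sum>j=1..CARD('d).
      (X i * cnj (X i)) * (Y j * cnj (Y j)) + (Y i * cnj (Y i)) * (X j * cnj (X j))
      - (X i * cnj (Y i)) * (Y j * cnj (X j)) - (Y i * cnj (X i)) * (X j * cnj (Y j)))"
    unfolding q_def complex_norm_square by (simp add: algebra_simps)
  also have "\<dots> = B x x * B y y + B y y * B x x - B x y * B y x - B y x * B x y"
    unfolding B_coord X_def[symmetric] Y_def[symmetric] sum_product by (simp only: sum.distrib sum_subtractf)
  also have "\<dots> = of_real (2 * ((N x)\<^sup>2 * (N y)\<^sup>2 - (cmod (B x y))\<^sup>2))"
    unfolding B_facts(4)[of y x] B_self_N of_real_mult of_real_diff complex_norm_square by (simp add: algebra_simps)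
  finally have "2 * (wedge_norm v e x y)\<^sup>2 = 2 * ((N x)\<^sup>2 * (N y)\<^sup>2 - (cmod (B x y))\<^sup>2)"
    by (simp only: of_real_eq_iff)
  then show ?thesis by (rule mult_left_cancel[THEN iffD1, rotated]) simp
qed

lemma wedge_ge_0: "0 \<le> wedge_norm v e x y"
  using arch_not_nonarch[OF emb] by (simp add: wedge_norm_def Let_def sum_nonneg)

lemma wedge_le_mult: "wedge_norm v e x y \<le> N x * N y"
  by (rule power2_le_imp_le) (simp_all add: wedge_power2 power_mult_distrib N_ge_0)

lemma wedge_projection:
  assumes "x \<noteq> 0"
  shows "\<exists>a. wedge_norm v e x y = N x * N (y - a *s x) \<and> N (a *s x) \<le> N y"
proof -
  obtain a where a: "B (y - a *s x) x = 0" "N (a *s x) \<le> N y"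
    using orthogonal_projection[OF assms] by metis
  have "B x (y - a *s x) = 0" using B_facts(4)[of x "y - a *s x"] a(1) by simp
  then have "(wedge_norm v e x (y - a *s x))\<^sup>2 = (N x * N (y - a *s x))\<^sup>2"
    by (simp add: wedge_power2 power_mult_distrib)
  then have "wedge_norm v e x (y - a *s x) = N x * N (y - a *s x)"
    by (rule power2_eq_imp_eq) (simp_all add: wedge_ge_0 N_ge_0)
  then show ?thesis using a(2) wedge_norm_shear[OF e_basis] by metis
qed

text \<open>An isometric copy of the normed space inside \<open>complex ^ 'd\<close>, from which
  completeness and compactness are borrowed. It is closed because each coordinate runs through the
  reals or through all complex numbers.\<close>

lemma euclidean_model:
  obtains T :: "'k ^ 'd \<Rightarrow> complex ^ 'd" where "\<And>x y. T (x - y) = T x - T y"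
    "\<And>x. norm (T x) = N x" "closed (range T)"
proof -
  obtain h where h: "bij_betw h (UNIV :: 'd set) {1..CARD('d)}"
    using finite_same_card_bij[of "UNIV :: 'd set" "{1..CARD('d)}"] by auto
  define T :: "'k ^ 'd \<Rightarrow> complex ^ 'd" where "T x = (\<chi> j. \<phi> (coord e x (h j)))" for x
  have "T (x - y) = T x - T y" for x y
    by (simp add: T_def vec_eq_iff coord_diff e_basis phi_diff)
  moreover have "norm (T x) = N x" for x
  proof -
    have "(\<Sum>j\<in>UNIV. (cmod (T x $ j))\<^sup>2) = (\<Sum>j\<in>UNIV. (v (coord e x (h j)))\<^sup>2)"
      by (simp add: T_def v_phi)
    also have "\<dots> = (N x)\<^sup>2"
      unfolding N_power2 by (rule sum.reindex_bij_betw[OF h])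
    finally show ?thesis by (simp add: norm_vec_def L2_set_def N_ge_0)
  qed
  moreover have "range T = (\<Inter>j. {X. X $ j \<in> range \<phi>})"
  proof (intro equalityI subsetI)
    fix X :: "complex ^ 'd" assume X: "X \<in> (\<Inter>j. {X. X $ j \<in> range \<phi>})"
    then have "X $ j \<in> range \<phi>" for j by blast
    then have "\<exists>a. \<phi> a = X $ j" for j by (metis imageE)
    then obtain a where a: "\<And>j. \<phi> (a j) = X $ j" by metis
    define x where "x = (\<Sum>i=1..CARD('d). a (inv_into UNIV h i) *s e i)"
    have "coord e x (h j) = a j" for j
    proof -
      have "h j \<in> {1..CARD('d)}" using h by (auto simp: bij_betw_def)
      then show ?thesis using h by (simp add: x_def coord_comb[OF e_basis] bij_betw_def)
    qed
    then have "T x = X" by (simp add: T_def a)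
    then show "X \<in> range T" by blast
  qed (auto simp: T_def)
  then have "closed (range T)"
    using closed_range by (auto intro!: closed_INT closed_vimage[unfolded vimage_def] continuous_intros)
  ultimately show thesis using that by blast
qed

lemma N_Cauchy_convergent:
  assumes u: "\<forall>\<epsilon>>0. \<exists>M. \<forall>m\<ge>M. \<forall>n\<ge>M. N (u m - u n) < \<epsilon>"
  shows "\<exists>x. (\<lambda>n::nat. N (u n - x)) \<longlonglongrightarrow> 0"
proof -
  obtain T :: "'k ^ 'd \<Rightarrow> complex ^ 'd" where T: "\<And>x y. T (x - y) = T x - T y"
    "\<And>x. norm (T x) = N x" "closed (range T)" using euclidean_model by blast
  have "Cauchy (\<lambda>n. T (u n))"
    by (rule CauchyI) (use u in \<open>simp flip: T(1) add: T(2)\<close>)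
  then obtain X where X: "(\<lambda>n. T (u n)) \<longlonglongrightarrow> X"
    using Cauchy_convergent convergent_def by blast
  then obtain x where x: "X = T x"
    using closed_sequentially[OF T(3), of "\<lambda>n. T (u n)"] by auto
  have "(\<lambda>n. norm (T (u n) - T x)) \<longlonglongrightarrow> 0"
    using X unfolding x by (simp add: LIM_zero_iff tendsto_norm_zero)
  then have "(\<lambda>n. N (u n - x)) \<longlonglongrightarrow> 0" by (simp flip: T(1) add: T(2))
  then show ?thesis ..
qed

lemma N_basis_1: "i \<in> {1..CARD('d)} \<Longrightarrow> N (e i) = 1"
  by (simp add: norm orthonormal)

text \<open>Supplies the Lipschitz constant for the compactness argument behind
  \<open>maximizer\<close>, and hence has to precede the interpretation as a
  \<open>normed_frame\<close>.\<close>

lemma endomorphism_bounded: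
  assumes "Vector_Spaces.linear (*s) (*s) G"
  obtains C where "0 \<le> C" "\<And>x. N (G x) \<le> C * N x"
proof
  show "0 \<le> (\<Sum>i=1..CARD('d). N (G (e i)))" by (simp add: sum_nonneg N_ge_0)
  fix x
  have mG: "matrix G *v x = G x" for x by (rule matrix_works[OF assms])
  have N_sum: "N (\<Sum>i\<in>I. f i) \<le> (\<Sum>i\<in>I. N (f i))" for I :: "nat set" and f
  proof (induction I rule: infinite_finite_induct)
    case (insert i I)
    then show ?case using N_subadditive[of "f i" "\<Sum>i\<in>I. f i"] by simp
  qed (use N_zero_iff[of 0] in auto)
  have coord_le: "v (coord e x i) \<le> N x" if "i \<in> {1..CARD('d)}" for i
  proof (rule power2_le_imp_le)
    show "(v (coord e x i))\<^sup>2 \<le> (N x)\<^sup>2"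
      unfolding N_power2 using that by (intro member_le_sum) auto
  qed (rule N_ge_0)
  have "G x = matrix G *v (\<Sum>i=1..CARD('d). coord e x i *s e i)"
    unfolding sum_coord[OF e_basis] mG ..
  also have "\<dots> = (\<Sum>i=1..CARD('d). coord e x i *s G (e i))"
    by (simp only: vec.sum vec.scale mG)
  also have "N \<dots> \<le> (\<Sum>i=1..CARD('d). N (coord e x i *s G (e i)))" by (rule N_sum)
  also have "\<dots> \<le> (\<Sum>i=1..CARD('d). N x * N (G (e i)))"
    unfolding N_homogeneous by (intro sum_mono mult_right_mono coord_le N_ge_0)
  finally show "N (G x) \<le> (\<Sum>i=1..CARD('d). N (G (e i))) * N x"
    by (simp add: sum_distrib_left mult.commute)
qed

lemma normalisation: "x \<noteq> 0 \<Longrightarrow> \<exists>a. v a * N x = 1"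
proof -
  assume "x \<noteq> 0"
  then have "N x \<noteq> 0" by (simp add: N_zero_iff)
  obtain a where "\<phi> a = of_real (1 / N x)" using range_closed(1)[of "1 / N x"] by auto
  then have "v a * N x = 1" using \<open>N x \<noteq> 0\<close> N_ge_0[of x] by (simp add: v_phi norm_divide)
  then show ?thesis ..
qed

text \<open>The length of \<open>G x\<close>, carried over to the Euclidean model, is Lipschitz on a
  compact unit sphere and attains its maximum there; homogeneity extends the bound to all
  vectors.\<close>

lemma endomorphism_maximizer:
  assumes G: "Vector_Spaces.linear (*s) (*s) G"
  shows "\<exists>x. x \<noteq> 0 \<and> (\<forall>y. N (G y) * N x \<le> N (G x) * N y)"
proof -
  obtain T :: "'k ^ 'd \<Rightarrow> complex ^ 'd" where T: "\<And>x y. T (x - y) = T x - T y"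
    "\<And>x. norm (T x) = N x" "closed (range T)" using euclidean_model by blast
  obtain C where C: "0 \<le> C" "\<And>x. N (G x) \<le> C * N x" using endomorphism_bounded[OF G] by blast
  have "inj T"
  proof (rule injI)
    fix x y assume "T x = T y"
    then have "N (x - y) = 0" by (simp flip: T(2) add: T(1))
    then show "x = y" by (simp add: N_zero_iff)
  qed
  define f where "f X = N (G (inv_into UNIV T X))" for X
  have f_T: "f (T x) = N (G x)" for x using \<open>inj T\<close> by (simp add: f_def)
  have G_diff: "G (x - y) = G x - G y" for x y
    using G matrix_works[OF G] by (metis vec.diff)
  have f_le: "f (T x) - f (T y) \<le> C * dist (T x) (T y)" for x y
  proof -
    have "N (G x) \<le> N (G x - G y) + N (G y)" using N_subadditive[of "G x - G y" "G y"] by simp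
    also have "N (G x - G y) \<le> C * N (x - y)" using C(2)[of "x - y"] by (simp add: G_diff)
    finally show ?thesis by (simp add: f_T dist_norm T(2) flip: T(1))
  qed
  define S where "S = sphere 0 1 \<inter> range T"
  have "compact S" unfolding S_def using T(3) by (intro compact_Int_closed compact_sphere)
  moreover have "T (e 1) \<in> S" using dim by (simp add: S_def T(2) N_basis_1)
  then have "S \<noteq> {}" by blast
  moreover have "C-lipschitz_on S f"
  proof (rule lipschitz_onI)
    fix X Y assume "X \<in> S" "Y \<in> S"
    then obtain x y where "X = T x" "Y = T y" by (auto simp: S_def)
    then show "dist (f X) (f Y) \<le> C * dist X Y"
      using f_le[of x y] f_le[of y x] by (simp add: dist_real_def dist_commute abs_le_iff)
  qed (rule C(1))
  then have "continuous_on S f" by (rule lipschitz_on_continuous_on)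
  ultimately obtain X where X: "X \<in> S" "\<And>Y. Y \<in> S \<Longrightarrow> f Y \<le> f X"
    using continuous_attains_sup by metis
  then obtain x where x: "X = T x" by (auto simp: S_def)
  then have Nx: "N x = 1" using X(1) T(2)[of x] by (simp add: S_def)
  have "N (G y) \<le> N (G x) * N y" for y
  proof (cases "y = 0")
    case False
    then obtain a where a: "v a * N y = 1" using normalisation by blast
    then have "T (a *s y) \<in> S" by (simp add: S_def T(2) N_homogeneous)
    then have "N (G (a *s y)) \<le> N (G x)" using X(2) x f_T by metis
    then have "v a * N (G y) \<le> N (G x)" using G by (simp add: linear_endo_iff N_homogeneous)
    then have "(v a * N (G y)) * N y \<le> N (G x) * N y" using N_ge_0 by (rule mult_right_mono)
    moreover have "(v a * N (G y)) * N y = (v a * N y) * N (G y)" by simp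
    ultimately show ?thesis using a by simp
  next
    case True
    then show ?thesis using C(2)[of 0] N_ge_0[of "G 0"] N_zero_iff[of 0] by simp
  qed
  then show ?thesis using Nx N_zero_iff[of x] by (intro exI[of _ x]) auto
qed

sublocale normed_frame v N e
proof
  show "is_basis e" "2 \<le> CARD('d)" by (fact e_basis dim)+
  show "0 \<le> v a" "v a = 0 \<longleftrightarrow> a = 0" "v (a * b) = v a * v b" for a b
    by (simp_all add: v_phi phi_eq_0_iff phi norm_mult)
  show "0 \<le> N x" "N x = 0 \<longleftrightarrow> x = 0" "N (a *s x) = v a * N x" "N (x + y) \<le> N x + N y" for a x y
    by (fact N_ge_0 N_zero_iff N_homogeneous N_subadditive)+
  show "N (e i) = 1" if "i \<in> {1..CARD('d)}" for i using that by (rule N_basis_1)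
  show "N x \<le> t * N y" if "0 \<le> t"
    "\<And>i. i \<in> {1..CARD('d)} \<Longrightarrow> v (coord e x i) \<le> t * v (coord e y i)" for t x y
  proof (rule power2_le_imp_le)
    have "(N x)\<^sup>2 \<le> (\<Sum>i=1..CARD('d). (t * v (coord e y i))\<^sup>2)"
      unfolding N_power2 using that by (intro sum_mono power_mono) (auto simp: v_phi)
    also have "\<dots> = (t * N y)\<^sup>2" by (simp add: power_mult_distrib N_power2 sum_distrib_left)
    finally show "(N x)\<^sup>2 \<le> (t * N y)\<^sup>2" .
  qed (use that N_ge_0 in simp)
  show "\<exists>x. (\<lambda>n. N (u n - x)) \<longlonglongrightarrow> 0"
    if "\<forall>\<epsilon>>0. \<exists>M. \<forall>m\<ge>M. \<forall>n\<ge>M. N (u m - u n) < \<epsilon>" for u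
    using that by (rule N_Cauchy_convergent)
  show "\<exists>a. v a * N x = 1" if "x \<noteq> 0" for x using that by (rule normalisation)
  show "\<exists>l. Vector_Spaces.linear (*s) (*) l \<and> l x = 1 \<and> (\<forall>y. v (l y) \<le> N y)" if "N x = 1" for x
  proof -
    \<comment> \<open>The product with \<open>x\<close>, read back through \<open>\<phi>\<close>, is
      a functional that norms \<open>x\<close>, by \<open>Cauchy_Schwarz\<close>.\<close>
    have "\<exists>b. \<phi> b = B y x" for y using B_facts(1)[of y x] by auto
    then obtain l where l: "\<And>y. \<phi> (l y) = B y x" by metis
    show ?thesis
    proof (intro exI[of _ l] conjI allI)
      show "Vector_Spaces.linear (*s) (*) l"
        unfolding linear_form_iff by (auto intro!: phi_inj simp: l phi B_facts(2,3))
      show "l x = 1" by (rule phi_inj) (simp add: l phi B_self_N that)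
      show "v (l y) \<le> N y" for y using Cauchy_Schwarz[of y x] that by (simp add: v_phi l)
    qed
  qed
  show "\<exists>x. x \<noteq> 0 \<and> (\<forall>y. N (G y) * N x \<le> N (G x) * N y)"
    if "Vector_Spaces.linear (*s) (*s) G" for G
    using that by (rule endomorphism_maximizer)
  show "N w \<le> N (a *s x + w)" if "Vector_Spaces.linear (*s) (*) l" "l x = 1" "N x = 1"
    "\<And>y. v (l y) \<le> N y" "l w = 0" for l x w a
    using N_join[OF that, of a] by (simp add: real_le_rsqrt)
  show "N (a *s x + w) = N (a *s x' + w')" if "Vector_Spaces.linear (*s) (*) l" "l x = 1" "N x = 1"
    "\<And>y. v (l y) \<le> N y" "l w = 0" "Vector_Spaces.linear (*s) (*) l'" "l' x' = 1" "N x' = 1"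
    "\<And>y. v (l' y) \<le> N y" "l' w' = 0" "N w = N w'" for l l' x x' w w' a
    using N_join[OF that(1-5), of a] N_join[OF that(6-10), of a] that(11) by simp
  show "wedge_norm v e x y \<le> N x * N y" for x y by (rule wedge_le_mult)
  show "\<exists>a. wedge_norm v e x y = N x * N (y - a *s x) \<and> N (a *s x) \<le> N y" if "x \<noteq> 0" for x y
    using that by (rule wedge_projection)
qed

end

section \<open>Both kinds of good norm as frames, and the dimension bound\<close>

lemma good_norm_imp_normed_frame:
  fixes v :: "'k::field \<Rightarrow> real" and N :: "'k ^ 'd::finite \<Rightarrow> real" and e :: "nat \<Rightarrow> 'k ^ 'd"
  assumes good: "good_norm v N e" and dim: "2 \<le> CARD('d)"
  shows "normed_frame v N e"
proof -
  have basis: "is_basis e" using good by (simp add: good_norm_def)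
  from good consider
    (arch) \<phi> B where "arch_embedding v \<phi>" "hermitian_product \<phi> B"
      "\<forall>i\<in>{1..CARD('d)}. \<forall>j\<in>{1..CARD('d)}. B (e i) (e j) = (if i = j then 1 else 0)"
      "\<forall>x. N x = sqrt (Re (B x x))"
    | (nonarch) "nonarch_local_field v" "\<forall>x. N x = Max ((\<lambda>i. v (coord e x i)) ` {1..CARD('d)})"
    unfolding good_norm_def by blast
  then show ?thesis
  proof cases
    case arch
    interpret arch_frame v N e \<phi> B
      by (rule arch_frame.intro) (use arch basis dim in blast)+
    show ?thesis by (rule normed_frame_axioms)
  next
    case nonarch
    interpret nonarch_frame v N e
      by (rule nonarch_frame.intro) (use nonarch basis dim in blast)+
    show ?thesis by (rule normed_frame_axioms)
  qed
qed

theorem proposition4p1: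
  fixes v :: "'k::field \<Rightarrow> real"
    and N :: "'k ^ 'd::finite \<Rightarrow> real"
    and e :: "nat \<Rightarrow> 'k ^ 'd"
    and \<Gamma> :: "('g, 'b) monoid_scheme"
    and S :: "'g set"
    and \<rho> :: "'g \<Rightarrow> ('k ^ 'd ^ 'd) set"
  assumes "local_field v"
    and "2 \<le> CARD('d)"
    and "good_norm v N e"
    and "group \<Gamma>"
    and "finite_symmetric_generating \<Gamma> S"
    and "word_hyperbolic \<Gamma> S"
    and "\<rho> \<in> hom \<Gamma> PGL"
    and "projective_anosov v N e \<Gamma> S \<rho>"
  shows "hausdorff_dim proj_space (proj_dist v N e) (boundary_map v N e \<rho> ` gromov_boundary \<Gamma> S)
           \<le> critical_exponent (carrier \<Gamma>) (\<lambda>\<gamma>. sv_ratio v N e (\<rho> \<gamma>))"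
proof -
  interpret normed_frame v N e using assms(3,2) by (rule good_norm_imp_normed_frame)
  interpret anosov v N e \<Gamma> S \<rho>
    by (rule anosov.intro[OF normed_frame_axioms]) (rule anosov_axioms.intro[OF assms(4,5,7,8)])
  show ?thesis by (rule hausdorff_dim_le_critical_exponent)
qed

end
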